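(* Let $u,\sigma$ be the solution and multiplier of the obstacle problem and $u_h,\sigma_h$ those of the discrete problem (as defined in the context). There is a constant $C>0$ depending only on the shape-regularity of $\mathcal T_h$ such that, for any $\bar f$ with $\bar f|_T\in\mathbb P_0(T)$ for all $T\in\mathcal T_h$ and any $T\in\mathcal T_h$, $$h_T\|f-\sigma_h\|_{L^2(T)}\le C\big(|u-u_h|_{H^1(T)}+\|\sigma-\sigma_h\|_{H^{-1}(T)}+h_T\|f-\bar f\|_{L^2(T)}\big),$$ $$h_T^2\|\nabla\sigma_h\|_{L^2(T)}\le C\big(|u-u_h|_{H^1(T)}+\|\sigma-\sigma_h\|_{H^{-1}(T)}+h_T\|f-\bar f\|_{L^2(T)}\big).$$ Furthermore, for any interior edge $e\in\mathcal E_h^i$, $$h_e^{1/2}\|[\nabla u_h]\|_{L^2(e)}\le C\big(|u-u_h|_{H^1(\mathcal T_e)}+\|\sigma-\sigma_h\|_{H^{-1}(\mathcal T_e)}+h_e\|f-\bar f\|_{L^2(\mathcal T_e)}\big),$$ where $\mathcal T_e$ is the patch of the two triangles $T_\pm$ sharing the edge $e$.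
   Context: Continuous problem. $\Omega\subset\mathbb R^2$ is a bounded polygonal domain (without slits); $(\cdot,\cdot)$ is the $L^2(\Omega)$ inner product; $\gamma_0:H^1(\Omega)\to L^2(\partial\Omega)$ is the trace map; $f\in L^2(\Omega)$; $g\in C(\partial\Omega)$ is the trace of some $H^1(\Omega)$ function; $\chi\in C(\bar\Omega)\cap H^1(\Omega)$ satisfies $\chi|_{\partial\Omega}\le g$. Put $a(v,w)=(\nabla v,\nabla w)$ and $\mathcal K=\{v\in H^1(\Omega): v\ge\chi \text{ a.e. in }\Omega,\ \gamma_0(v)=g\}$. $u\in\mathcal K$ is the unique solution of $a(u,v-u)\ge(f,v-u)$ for all $v\in\mathcal K$. The multiplier $\sigma\in H^{-1}(\Omega)$ is given by $\langle\sigma,v\rangle=(f,v)-a(u,v)$ for $v\in H^1_0(\Omega)$. $L^2$ functions are identified with functionals via the $L^2$ inner product. For a triangle or patch $\omega$, $\|\cdot\|_{H^{-1}(\omega)}$ is the norm dual to $|\cdot|_{H^1(\omega)}=\|\nabla\cdot\|_{L^2(\omega)}$ on $H^1_0(\omega)$, elements of $H^{-1}(\Omega)$ being restricted to $H^1_0(\omega)$ through extension by zero. Mesh. $\mathcal T_h$ is a conforming (no hanging nodes), shape-regular triangulation of $\Omega$ into closed triangles (all angles bounded below by a fixed positive angle). $h_T$ is the diameter of $T$, $|T|$ its area, $\mathcal V_T$ its set of vertices; $\mathcal V_h^i,\mathcal V_h^b$ are the sets of vertices in $\Omega$ and on $\partial\Omega$; $\mathcal E_h^i,\mathcal E_h^b$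 are the sets of interior and boundary edges; $h_e$ is the length of $e$. Each triangle with an edge on $\partial\Omega$ is assumed to have at most one such edge. On $e=\partial T_+\cap\partial T_-\in\mathcal E_h^i$ with outer unit normals $n_\pm$ of $T_\pm$, $[w]=w_+\cdot n_++w_-\cdot n_-$ for a piecewise $H^1$ vector field $w$ with $w_\pm=w|_{T_\pm}$. Discrete problem. $V_h=\{v\in H^1(\Omega):v|_T\in\mathbb P_1(T)\ \forall T\in\mathcal T_h\}$, $V_h^0=V_h\cap H^1_0(\Omega)$. $g_h\in C(\partial\Omega)$ is the piecewise affine (on each $e\in\mathcal E_h^b$) nodal interpolant of $g$ at $\mathcal V_h^b$. $\mathcal K_h=\{v_h\in V_h: v_h(z)\ge\chi(z)\ \forall z\in\mathcal V_h^i,\ v_h=g_h\text{ on }\partial\Omega\}$. $u_h\in\mathcal K_h$ is the unique solution of $a(u_h,v_h-u_h)\ge(f,v_h-u_h)$ for all $v_h\in\mathcal K_h$. $\sigma_h\in V_h^0$ is given by $\langle\sigma_h,v\rangle_h=(f,v)-a(u_h,v)$ for all $v\in V_h^0$, where $\langle w,v\rangle_h=\sum_{T\in\mathcal T_h}\frac{|T|}{3}\sum_{z\in\mathcal V_T}w(z)v(z)$. *)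

theory Defs
  imports "HOL-Analysis.Analysis"
begin

section \<open>Square-integrable functions\<close>

text \<open>
  Elements of $L^2$ and of Sobolev spaces are represented by functions, not by classes modulo
  null sets.  The measure is a parameter, because both area and arc length occur below; as
  \<^term>\<open>lebesgue_on S\<close> is complete, null sets do not affect membership.
\<close>

definition L2_space :: "'a measure \<Rightarrow> ('a \<Rightarrow> 'b::euclidean_space) set" where
  "L2_space M = {v. v \<in> borel_measurable M \<and> integrable M (\<lambda>x. (norm (v x))\<^sup>2)}"

definition L2_inner :: "'a measure \<Rightarrow> ('a \<Rightarrow> 'b::euclidean_space) \<Rightarrow> ('a \<Rightarrow> 'b) \<Rightarrow> real" where
  "L2_inner M v w = (\<integral>x. v x \<bullet> w x \<partial>M)"

definition L2_norm :: "'a measure \<Rightarrow> ('a \<Rightarrow> 'b::euclidean_space) \<Rightarrow> real" where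
  "L2_norm M v = sqrt (L2_inner M v v)"

section \<open>Arc length\<close>

text \<open>
  Arc length on edges and on $\partial\Omega$ is one-dimensional Hausdorff measure: the supremum
  over $\delta > 0$ of the infimum of the sums of diameters over countable covers by sets of
  diameter at most $\delta$.  The covers in \<^const>\<open>outer_measure\<close> are disjoint, which makes no
  difference since diameters are monotone.  The constant \<^const>\<open>measure_of\<close> gives the null measure
  when applied to a set function that is not countably additive; that this does not happen here
  is \<open>emeasure_arc_length\<close>.
\<close>

definition small_diameter :: "real \<Rightarrow> 'a::metric_space set \<Rightarrow> ennreal" where
  "small_diameter \<delta> U = (if bounded U \<and> diameter U \<le> \<delta> then ennreal (diameter U) else \<infinity>)"

definition hausdorff1 :: "'a::metric_space set \<Rightarrow> ennreal" where
  "hausdorff1 A = (SUP \<delta>\<in>{0<..}. outer_measure UNIV (small_diameter \<delta>) A)"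

definition arc_length :: "(real^2) measure" where
  "arc_length = measure_of UNIV (sets borel) hausdorff1"

lemma small_diameter_empty: "0 \<le> \<delta> \<Longrightarrow> small_diameter \<delta> {} = 0"
  by (simp add: small_diameter_def)

lemma small_diameter_mono: "A \<subseteq> B \<Longrightarrow> small_diameter \<delta> A \<le> small_diameter \<delta> B"
  using diameter_subset[of A B] bounded_subset[of B A]
  by (auto simp: small_diameter_def intro!: ennreal_leI)

lemma outer_measure_space_small_diameter:
  assumes "0 \<le> \<delta>"
  shows "outer_measure_space UNIV (outer_measure UNIV (small_diameter \<delta>))"
proof -
  interpret ring_of_sets UNIV "UNIV :: 'a set set"
    using ring_of_sets_Pow[of "UNIV :: 'a set"] by simp
  show ?thesis
    using outer_measure_space_outer_measure[of "small_diameter \<delta>"] assms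
    by (simp add: positive_def increasing_def small_diameter_empty small_diameter_mono)
qed

lemma outer_measure_space_hausdorff1:
  "outer_measure_space UNIV (hausdorff1 :: 'a::metric_space set \<Rightarrow> ennreal)"
proof -
  have o: "outer_measure_space UNIV (outer_measure UNIV (small_diameter \<delta> :: 'a set \<Rightarrow> _))" if "0 < \<delta>" for \<delta>
    using that by (intro outer_measure_space_small_diameter) simp
  have "positive UNIV (hausdorff1 :: 'a set \<Rightarrow> _)"
    using o by (auto simp: outer_measure_space_def positive_def hausdorff1_def image_constant_conv)
  moreover have "increasing UNIV (hausdorff1 :: 'a set \<Rightarrow> _)"
    unfolding increasing_def hausdorff1_def
    by (intro ballI impI SUP_mono) (use o in \<open>unfold outer_measure_space_def increasing_def, blast\<close>)
  moreover have "countably_subadditive UNIV (hausdorff1 :: 'a set \<Rightarrow> _)"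
    unfolding countably_subadditive_def
  proof (intro allI impI)
    fix A :: "nat \<Rightarrow> 'a set" assume "disjoint_family A"
    show "hausdorff1 (\<Union>i. A i) \<le> (\<Sum>i. hausdorff1 (A i))"
      unfolding hausdorff1_def[of "\<Union>i. A i"]
    proof (rule SUP_least)
      fix \<delta> :: real assume d: "\<delta> \<in> {0<..}"
      then have "outer_measure UNIV (small_diameter \<delta>) (\<Union>i. A i)
            \<le> (\<Sum>i. outer_measure UNIV (small_diameter \<delta>) (A i))"
        using o[of \<delta>] \<open>disjoint_family A\<close>
        by (auto simp: outer_measure_space_def countably_subadditive_def)
      also have "\<dots> \<le> (\<Sum>i. hausdorff1 (A i))"
        using d by (intro suminf_le) (auto simp: hausdorff1_def intro!: SUP_upper)
      finally show "outer_measure UNIV (small_diameter \<delta>) (\<Union>i. A i) \<le> (\<Sum>i. hausdorff1 (A i))" .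
    qed
  qed
  ultimately show ?thesis by (simp add: outer_measure_space_def)
qed

lemma hausdorff1_mono: "A \<subseteq> B \<Longrightarrow> hausdorff1 A \<le> hausdorff1 B"
  using outer_measure_space_hausdorff1 by (auto simp: outer_measure_space_def increasing_def)

lemma outer_measure_small_diameter_antimono:
  assumes "\<delta> \<le> \<epsilon>"
  shows "outer_measure UNIV (small_diameter \<epsilon>) A \<le> outer_measure UNIV (small_diameter \<delta>) A"
  unfolding outer_measure_def using assms
  by (intro INF_mono) (auto intro!: suminf_le simp: small_diameter_def)

lemma hausdorff1_separated:
  fixes A B :: "'a::metric_space set"
  assumes "0 < d" and d: "\<And>a b. a \<in> A \<Longrightarrow> b \<in> B \<Longrightarrow> d \<le> dist a b"
  shows "hausdorff1 A + hausdorff1 B \<le> hausdorff1 (A \<union> B)"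
proof -
  let ?O = "\<lambda>\<delta>. outer_measure UNIV (small_diameter \<delta> :: 'a set \<Rightarrow> _)"
  have sub: "?O \<delta> A + ?O \<delta> B \<le> ?O \<delta> (A \<union> B)" if "0 < \<delta>" "\<delta> < d" for \<delta>
    unfolding outer_measure_def[of _ _ "A \<union> B"]
  proof (safe intro!: INF_greatest)
    fix U :: "nat \<Rightarrow> 'a set" assume U: "disjoint_family U" "A \<union> B \<subseteq> (\<Union>i. U i)"
    have le: "?O \<delta> X \<le> (\<Sum>i. small_diameter \<delta> (U i \<inter> X))" if "X \<subseteq> A \<union> B" for X
      unfolding outer_measure_def using U that
      by (intro INF_lower2[of "\<lambda>i. U i \<inter> X"]) (auto simp: disjoint_family_on_def)
    have "?O \<delta> A + ?O \<delta> B
        \<le> (\<Sum>i. small_diameter \<delta> (U i \<inter> A)) + (\<Sum>i. small_diameter \<delta> (U i \<inter> B))"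
      by (intro add_mono le) auto
    also have "\<dots> = (\<Sum>i. small_diameter \<delta> (U i \<inter> A) + small_diameter \<delta> (U i \<inter> B))"
      by (rule suminf_add) auto
    also have "\<dots> \<le> (\<Sum>i. small_diameter \<delta> (U i))"
    proof (intro suminf_le)
      fix i
      show "small_diameter \<delta> (U i \<inter> A) + small_diameter \<delta> (U i \<inter> B) \<le> small_diameter \<delta> (U i)"
      proof (cases "bounded (U i) \<and> diameter (U i) \<le> \<delta>")
        case True
        have "U i \<inter> A = {} \<or> U i \<inter> B = {}"
        proof (rule ccontr)
          assume "\<not> ?thesis"
          then obtain a b where "a \<in> U i" "a \<in> A" "b \<in> U i" "b \<in> B" by auto
          then show False
            using d[of a b] diameter_bounded_bound[of "U i" a b] True that by auto
        qed
        then show ?thesis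
          using that small_diameter_mono[of "U i \<inter> A" "U i" \<delta>] small_diameter_mono[of "U i \<inter> B" "U i" \<delta>]
          by (auto simp: small_diameter_empty)
      qed (auto simp: small_diameter_def)
    qed auto
    finally show "?O \<delta> A + ?O \<delta> B \<le> (\<Sum>i. small_diameter \<delta> (U i))" .
  qed
  have "?O \<delta> A + ?O \<epsilon> B \<le> hausdorff1 (A \<union> B)" if "0 < \<delta>" "0 < \<epsilon>" for \<delta> \<epsilon>
  proof -
    define m where "m = min (min \<delta> \<epsilon>) (d / 2)"
    have m: "0 < m" "m < d" "m \<le> \<delta>" "m \<le> \<epsilon>" using that \<open>0 < d\<close> by (auto simp: m_def)
    have "?O \<delta> A + ?O \<epsilon> B \<le> ?O m A + ?O m B"
      by (intro add_mono outer_measure_small_diameter_antimono m)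
    also have "\<dots> \<le> ?O m (A \<union> B)" by (rule sub[OF m(1,2)])
    also have "\<dots> \<le> hausdorff1 (A \<union> B)"
      using m(1) unfolding hausdorff1_def by (intro SUP_upper) auto
    finally show ?thesis .
  qed
  then have "(SUP \<delta>\<in>{0<..}. SUP \<epsilon>\<in>{0<..}. ?O \<delta> A + ?O \<epsilon> B) \<le> hausdorff1 (A \<union> B)"
    by (auto intro!: SUP_least)
  then have "(SUP \<delta>\<in>{0<..}. ?O \<delta> A + (SUP \<epsilon>\<in>{0<..}. ?O \<epsilon> B)) \<le> hausdorff1 (A \<union> B)"
    by (simp add: ennreal_SUP_add_right)
  then show ?thesis
    unfolding hausdorff1_def[of A] hausdorff1_def[of B] by (subst (asm) ennreal_SUP_add_left) auto
qed

lemma hausdorff1_closed: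
  fixes F a :: "'a::metric_space set"
  assumes "closed F"
  shows "hausdorff1 (a \<inter> F) + hausdorff1 (a - F) \<le> hausdorff1 a"
proof (cases "F = {} \<or> hausdorff1 a = \<infinity>")
  case True
  have "hausdorff1 ({} :: 'a set) = 0"
    using outer_measure_space_hausdorff1 by (auto simp: outer_measure_space_def positive_def)
  with True show ?thesis by auto
next
  case False
  let ?H = "hausdorff1 :: 'a set \<Rightarrow> _"
  have H0: "?H {} = 0" and sub: "\<And>A B. ?H (A \<union> B) \<le> ?H A + ?H B"
    and csub: "\<And>A. disjoint_family A \<Longrightarrow> ?H (\<Union>i::nat. A i) \<le> (\<Sum>i. ?H (A i))"
  proof -
    have *: "positive UNIV ?H" "increasing UNIV ?H" "countably_subadditive UNIV ?H"
      using outer_measure_space_hausdorff1 by (auto simp: outer_measure_space_def)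
    interpret ring_of_sets UNIV "UNIV :: 'a set set"
      using ring_of_sets_Pow[of "UNIV :: 'a set"] by simp
    have sa: "subadditive UNIV ?H"
      using countably_subadditive_subadditive[OF *(1,3)] .
    show "?H {} = 0" using * by (auto simp: positive_def)
    show "\<And>A. disjoint_family A \<Longrightarrow> ?H (\<Union>i::nat. A i) \<le> (\<Sum>i. ?H (A i))"
      using * by (auto simp: countably_subadditive_def)
    show "?H (A \<union> B) \<le> ?H A + ?H B" for A B
    proof -
      have "?H (A \<union> (B - A)) \<le> ?H A + ?H (B - A)"
        using sa[unfolded subadditive_def, rule_format, of A "B - A"] by simp
      also have "\<dots> \<le> ?H A + ?H B" by (intro add_mono hausdorff1_mono) auto
      finally show ?thesis by simp
    qed
  qed
  define t where "t n = 1 / real (Suc n)" for n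
  have t_pos: "t n > 0" for n by (simp add: t_def)
  have t_mono: "m \<le> n \<Longrightarrow> t n \<le> t m" for m n by (simp add: t_def field_simps)
  have t_strict: "m < n \<Longrightarrow> t n < t m" for m n by (simp add: t_def field_simps)
  define A where "A n = {x \<in> a. t n \<le> infdist x F}" for n
  define R where "R n = {x \<in> a. t (Suc n) \<le> infdist x F \<and> infdist x F < t n}" for n
  have inf_dist: "infdist x F \<le> dist x y + infdist y F" for x y
    using infdist_triangle[of x F y] by simp
  have odd_even: "(\<Sum>k<n. ?H (R (2 * k + j))) \<le> ?H a" for n j
  proof -
    have "(\<Sum>k<n. ?H (R (2 * k + j))) \<le> ?H (\<Union>k<n. R (2 * k + j))"
    proof (induction n)
      case 0
      then show ?case by (simp add: H0)
    next
      case (Suc n)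
      have "(\<Sum>k<Suc n. ?H (R (2 * k + j))) \<le> ?H (\<Union>k<n. R (2 * k + j)) + ?H (R (2 * n + j))"
        using Suc by (simp add: add_mono)
      also have "\<dots> \<le> ?H ((\<Union>k<n. R (2 * k + j)) \<union> R (2 * n + j))"
      proof (cases n)
        case 0
        then show ?thesis by (simp add: H0)
      next
        case n: (Suc m)
        show ?thesis
        proof (rule hausdorff1_separated)
          show "0 < t (2 * n + j - 1) - t (2 * n + j)" using t_strict[of "2*n+j-1" "2*n+j"] n by simp
          fix x y assume "x \<in> (\<Union>k<n. R (2 * k + j))" "y \<in> R (2 * n + j)"
          then obtain k where k: "k < n" "t (Suc (2 * k + j)) \<le> infdist x F" "infdist y F < t (2 * n + j)"
            by (auto simp: R_def)
          have "t (2 * n + j - 1) \<le> t (Suc (2 * k + j))" using k by (intro t_mono) auto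
          then show "t (2 * n + j - 1) - t (2 * n + j) \<le> dist x y"
            using k inf_dist[of x y] by linarith
        qed
      qed
      also have "(\<Union>k<n. R (2 * k + j)) \<union> R (2 * n + j) = (\<Union>k<Suc n. R (2 * k + j))"
        by (auto simp: less_Suc_eq)
      finally show ?case .
    qed
    also have "\<dots> \<le> ?H a" by (intro hausdorff1_mono) (auto simp: R_def)
    finally show ?thesis .
  qed
  have part: "(\<Sum>k<2 * n. ?H (R k)) \<le> ?H a + ?H a" for n
  proof -
    have "(\<Sum>k<2 * n. ?H (R k)) = (\<Sum>k<n. ?H (R (2 * k + 0))) + (\<Sum>k<n. ?H (R (2 * k + 1)))"
      by (induction n) (simp_all add: ac_simps)
    also have "\<dots> \<le> ?H a + ?H a" by (intro add_mono odd_even)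
    finally show ?thesis .
  qed
  have "(\<Sum>k. ?H (R k)) \<le> ?H a + ?H a"
  proof (rule suminf_le_const[OF summableI])
    fix n
    have "(\<Sum>k<n. ?H (R k)) \<le> (\<Sum>k<2 * n. ?H (R k))" by (intro sum_mono2) auto
    then show "(\<Sum>k<n. ?H (R k)) \<le> ?H a + ?H a" using part[of n] by (rule order_trans)
  qed
  moreover have "?H a + ?H a < \<infinity>" using False by (simp add: less_top)
  ultimately have fin: "(\<Sum>k. ?H (R k)) < \<infinity>" by (rule le_less_trans)
  define r where "r k = enn2real (?H (R k))" for k
  have Hr: "?H (R k) = ennreal (r k)" for k
  proof -
    have "?H (R k) \<le> ?H a" by (intro hausdorff1_mono) (auto simp: R_def)
    then show ?thesis using False by (simp add: r_def less_top top.not_eq_extremum le_less_trans)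
  qed
  have r0: "0 \<le> r k" for k by (simp add: r_def)
  have sr: "summable r"
    using fin by (intro summable_suminf_not_top r0) (auto simp: Hr)
  have step: "?H (a \<inter> F) + ?H (a - F) \<le> ?H a + ennreal (\<Sum>k. r (k + n))" for n
  proof -
    have "a - F \<subseteq> A n \<union> (\<Union>k. R (k + n))"
    proof
      fix x assume x: "x \<in> a - F"
      have pos: "0 < infdist x F"
        using x False assms infdist_pos_not_in_closed[of F x] by auto
      then obtain m where "t m < infdist x F"
        unfolding t_def using reals_Archimedean[of "infdist x F"] by (auto simp: inverse_eq_divide)
      then have ex: "\<exists>m. t m \<le> infdist x F" by (auto intro: less_imp_le)
      define l where "l = (LEAST m. t m \<le> infdist x F)"
      have l: "t l \<le> infdist x F" unfolding l_def using ex by (rule LeastI_ex)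
      show "x \<in> A n \<union> (\<Union>k. R (k + n))"
      proof (cases "l \<le> n")
        case True
        then show ?thesis using l t_mono[of l n] x by (auto simp: A_def)
      next
        case lt: False
        then have "infdist x F < t (l - 1)"
          using not_less_Least[of "l - 1" "\<lambda>m. t m \<le> infdist x F"] by (auto simp: l_def[symmetric])
        then have "x \<in> R ((l - 1 - n) + n)" using lt l x by (auto simp: R_def)
        then show ?thesis by blast
      qed
    qed
    then have "?H (a - F) \<le> ?H (A n \<union> (\<Union>k. R (k + n)))" by (rule hausdorff1_mono)
    also have "\<dots> \<le> ?H (A n) + ?H (\<Union>k. R (k + n))" by (rule sub)
    also have "?H (\<Union>k. R (k + n)) \<le> (\<Sum>k. ?H (R (k + n)))"
    proof (rule csub)
      show "disjoint_family (\<lambda>k. R (k + n))"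
        unfolding disjoint_family_on_def
      proof (intro ballI impI)
        fix i j :: nat assume "i \<noteq> j"
        show "R (i + n) \<inter> R (j + n) = {}"
        proof (rule ccontr)
          assume "\<not> ?thesis"
          then obtain x where x: "x \<in> R (i + n)" "x \<in> R (j + n)" by auto
          show False
            using x \<open>i \<noteq> j\<close> t_mono[of "Suc (i + n)" "j + n"] t_mono[of "Suc (j + n)" "i + n"]
            by (cases "i < j") (auto simp: R_def)
        qed
      qed
    qed
    also have "(\<Sum>k. ?H (R (k + n))) = ennreal (\<Sum>k. r (k + n))"
      using sr by (simp add: Hr r0 suminf_ennreal2 summable_iff_shift)
    finally have 1: "?H (a - F) \<le> ?H (A n) + ennreal (\<Sum>k. r (k + n))" by simp
    have 2: "?H (a \<inter> F) + ?H (A n) \<le> ?H a"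
    proof -
      have "?H (a \<inter> F) + ?H (A n) \<le> ?H ((a \<inter> F) \<union> A n)"
      proof (rule hausdorff1_separated[OF t_pos[of n]])
        fix x y assume "x \<in> a \<inter> F" "y \<in> A n"
        then show "t n \<le> dist x y"
          using infdist_le[of x F y] by (auto simp: A_def dist_commute)
      qed
      also have "\<dots> \<le> ?H a" by (intro hausdorff1_mono) (auto simp: A_def)
      finally show ?thesis .
    qed
    have "?H (a \<inter> F) + ?H (a - F) \<le> (?H (a \<inter> F) + ?H (A n)) + ennreal (\<Sum>k. r (k + n))"
      using 1 by (simp add: add.assoc add_left_mono)
    also have "\<dots> \<le> ?H a + ennreal (\<Sum>k. r (k + n))" using 2 by (rule add_right_mono)
    finally show ?thesis .
  qed
  have "(\<lambda>n. \<Sum>k. r (k + n)) \<longlonglongrightarrow> 0"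
    using suminf_exist_split2[OF sr] .
  then have "(\<lambda>n. ?H a + ennreal (\<Sum>k. r (k + n))) \<longlonglongrightarrow> ?H a + ennreal 0"
    by (intro tendsto_add tendsto_const tendsto_ennrealI)
  then have "?H (a \<inter> F) + ?H (a - F) \<le> ?H a + ennreal 0"
    by (rule LIMSEQ_le_const) (use step in blast)
  then show ?thesis by simp
qed

lemma measure_space_hausdorff1:
  "measure_space UNIV (sets borel) (hausdorff1 :: 'a::metric_space set \<Rightarrow> ennreal)"
proof -
  let ?H = "hausdorff1 :: 'a set \<Rightarrow> _"
  let ?L = "lambda_system UNIV UNIV ?H"
  interpret sigma_algebra UNIV "UNIV :: 'a set set"
    using sigma_algebra_Pow[of "UNIV :: 'a set"] by simp
  have ms: "measure_space UNIV ?L ?H"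
    by (rule caratheodory_lemma[OF outer_measure_space_hausdorff1])
  have "subadditive UNIV ?H"
    using outer_measure_space_hausdorff1
    by (auto simp: outer_measure_space_def intro: countably_subadditive_subadditive)
  then have "?H a \<le> ?H (a \<inter> F) + ?H (a - F)" for a F
    unfolding subadditive_def by (elim ballE[where x = "a \<inter> F"] ballE[where x = "a - F"]) (auto simp: Int_Diff_Un)
  then have "{F. closed F} \<subseteq> ?L"
    using hausdorff1_closed by (auto simp: lambda_system_eq intro!: antisym)
  moreover have "sigma_algebra UNIV ?L" using ms by (simp add: measure_space_def)
  ultimately have "sets (borel :: 'a measure) \<subseteq> ?L"
    by (simp add: borel_eq_closed sigma_algebra.sigma_sets_subset)
  then show ?thesis
    using ms sets.sigma_algebra_axioms[of "borel :: 'a measure"]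
    by (auto simp: measure_space_def positive_def countably_additive_def)
qed

lemma sets_arc_length: "sets arc_length = sets borel"
  by (simp add: arc_length_def sets.sigma_sets_eq[of borel, simplified])

lemma emeasure_arc_length: "A \<in> sets borel \<Longrightarrow> emeasure arc_length A = hausdorff1 A"
  unfolding arc_length_def using measure_space_hausdorff1[where 'a = "real^2"]
  by (intro emeasure_measure_of_sigma) (auto simp: measure_space_def)

section \<open>Sobolev spaces\<close>

definition gradient :: "(real^2 \<Rightarrow> real) \<Rightarrow> real^2 \<Rightarrow> real^2" where
  "gradient \<phi> x = (\<chi> i. frechet_derivative \<phi> (at x) (axis i 1))"

primrec C_k :: "nat \<Rightarrow> (real^2 \<Rightarrow> real) \<Rightarrow> bool" where
  "C_k 0 \<phi> \<longleftrightarrow> continuous_on UNIV \<phi>"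
| "C_k (Suc k) \<phi> \<longleftrightarrow> (\<forall>x. \<phi> differentiable (at x)) \<and> (\<forall>i. C_k k (\<lambda>x. gradient \<phi> x $ i))"

definition test_functions :: "(real^2) set \<Rightarrow> (real^2 \<Rightarrow> real) set" where
  "test_functions \<Omega> = {\<phi>. (\<forall>k. C_k k \<phi>) \<and> compact (closure {x. \<phi> x \<noteq> 0}) \<and> closure {x. \<phi> x \<noteq> 0} \<subseteq> \<Omega>}"

definition has_weak_gradient :: "(real^2) set \<Rightarrow> (real^2 \<Rightarrow> real) \<Rightarrow> (real^2 \<Rightarrow> real^2) \<Rightarrow> bool" where
  "has_weak_gradient \<Omega> v G \<longleftrightarrow>
     v \<in> L2_space (lebesgue_on \<Omega>) \<and> G \<in> L2_space (lebesgue_on \<Omega>) \<and>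
     (\<forall>\<phi>\<in>test_functions \<Omega>. \<forall>i.
        (\<integral>x. v x * gradient \<phi> x $ i \<partial>lebesgue_on \<Omega>) = - (\<integral>x. G x $ i * \<phi> x \<partial>lebesgue_on \<Omega>))"

definition H1 :: "(real^2) set \<Rightarrow> (real^2 \<Rightarrow> real) set" where
  "H1 \<Omega> = {v. \<exists>G. has_weak_gradient \<Omega> v G}"

text \<open>The weak gradient is determined up to a null set, so the choice below is immaterial.\<close>

definition weak_gradient :: "(real^2) set \<Rightarrow> (real^2 \<Rightarrow> real) \<Rightarrow> real^2 \<Rightarrow> real^2" where
  "weak_gradient \<Omega> v = (SOME G. has_weak_gradient \<Omega> v G)"

definition energy :: "(real^2) set \<Rightarrow> (real^2 \<Rightarrow> real) \<Rightarrow> (real^2 \<Rightarrow> real) \<Rightarrow> real" where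
  "energy \<Omega> v w = L2_inner (lebesgue_on \<Omega>) (weak_gradient \<Omega> v) (weak_gradient \<Omega> w)"

definition H1_seminorm :: "(real^2) set \<Rightarrow> (real^2 \<Rightarrow> real) \<Rightarrow> real" where
  "H1_seminorm \<Omega> v = L2_norm (lebesgue_on \<Omega>) (weak_gradient \<Omega> v)"

definition H1_norm :: "(real^2) set \<Rightarrow> (real^2 \<Rightarrow> real) \<Rightarrow> real" where
  "H1_norm \<Omega> v = sqrt ((L2_norm (lebesgue_on \<Omega>) v)\<^sup>2 + (H1_seminorm \<Omega> v)\<^sup>2)"

definition H10 :: "(real^2) set \<Rightarrow> (real^2 \<Rightarrow> real) set" where
  "H10 \<Omega> = {v \<in> H1 \<Omega>. \<exists>\<phi>. (\<forall>n. \<phi> n \<in> test_functions \<Omega>) \<and>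
                          (\<lambda>n. H1_norm \<Omega> (\<lambda>x. v x - \<phi> n x)) \<longlonglongrightarrow> 0}"

text \<open>
  Elements of $H^{-1}(\Omega)$ are represented by functionals on functions, of which only the values
  on \<^term>\<open>H10 \<Omega>\<close> matter.
\<close>

definition Hm1_norm :: "(real^2) set \<Rightarrow> ((real^2 \<Rightarrow> real) \<Rightarrow> real) \<Rightarrow> real" where
  "Hm1_norm \<omega> F = Sup {\<bar>F (\<lambda>x. if x \<in> \<omega> then v x else 0)\<bar> | v. v \<in> H10 \<omega> \<and> H1_seminorm \<omega> v \<le> 1}"

text \<open>
  The trace map is the continuous extension, from $H^1(\Omega) \cap C(\overline\Omega)$ to $H^1(\Omega)$,
  of restriction to the boundary.
\<close>

definition has_trace :: "(real^2) set \<Rightarrow> (real^2 \<Rightarrow> real) \<Rightarrow> (real^2 \<Rightarrow> real) \<Rightarrow> bool" where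
  "has_trace \<Omega> v g \<longleftrightarrow>
     g \<in> L2_space (restrict_space arc_length (frontier \<Omega>)) \<and>
     (\<exists>\<phi>. (\<forall>n. \<phi> n \<in> H1 \<Omega> \<and> continuous_on (closure \<Omega>) (\<phi> n)) \<and>
          (\<lambda>n. H1_norm \<Omega> (\<lambda>x. v x - \<phi> n x)) \<longlonglongrightarrow> 0 \<and>
          (\<lambda>n. L2_norm (restrict_space arc_length (frontier \<Omega>)) (\<lambda>x. g x - \<phi> n x)) \<longlonglongrightarrow> 0)"

section \<open>Domain and mesh\<close>

text \<open>The last condition excludes slits.\<close>

definition polygonal_domain :: "(real^2) set \<Rightarrow> bool" where
  "polygonal_domain \<Omega> \<longleftrightarrow>
     open \<Omega> \<and> connected \<Omega> \<and> bounded \<Omega> \<and> \<Omega> \<noteq> {} \<and>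
     (\<exists>S. finite S \<and> (\<forall>s\<in>S. \<exists>a b. s = closed_segment a b) \<and> frontier \<Omega> = \<Union>S) \<and>
     interior (closure \<Omega>) = \<Omega>"

text \<open>
  In \<^const>\<open>triangulation\<close> any two cells meet in a common face (possibly empty), so there are no
  hanging nodes.
\<close>

definition conforming_mesh :: "(real^2) set \<Rightarrow> (real^2) set set \<Rightarrow> bool" where
  "conforming_mesh \<Omega> \<T> \<longleftrightarrow> triangulation \<T> \<and> (\<forall>T\<in>\<T>. 2 simplex T) \<and> \<Union>\<T> = closure \<Omega>"

definition vertices :: "(real^2) set \<Rightarrow> (real^2) set" where
  "vertices T = {z. z extreme_point_of T}"

definition interior_vertices :: "(real^2) set \<Rightarrow> (real^2) set set \<Rightarrow> (real^2) set" where
  "interior_vertices \<Omega> \<T> = (\<Union>T\<in>\<T>. vertices T) \<inter> \<Omega>"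

definition boundary_vertices :: "(real^2) set \<Rightarrow> (real^2) set set \<Rightarrow> (real^2) set" where
  "boundary_vertices \<Omega> \<T> = (\<Union>T\<in>\<T>. vertices T) \<inter> frontier \<Omega>"

definition interior_edges :: "(real^2) set \<Rightarrow> (real^2) set set \<Rightarrow> (real^2) set set" where
  "interior_edges \<Omega> \<T> = {e. (\<exists>T\<in>\<T>. e edge_of T) \<and> \<not> e \<subseteq> frontier \<Omega>}"

definition boundary_edges :: "(real^2) set \<Rightarrow> (real^2) set set \<Rightarrow> (real^2) set set" where
  "boundary_edges \<Omega> \<T> = {e. (\<exists>T\<in>\<T>. e edge_of T) \<and> e \<subseteq> frontier \<Omega>}"

definition at_most_one_boundary_edge :: "(real^2) set \<Rightarrow> (real^2) set set \<Rightarrow> bool" where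
  "at_most_one_boundary_edge \<Omega> \<T> \<longleftrightarrow>
     (\<forall>T\<in>\<T>. \<forall>e\<in>boundary_edges \<Omega> \<T>. \<forall>e'\<in>boundary_edges \<Omega> \<T>. e edge_of T \<and> e' edge_of T \<longrightarrow> e = e')"

definition angle_at :: "real^2 \<Rightarrow> real^2 \<Rightarrow> real^2 \<Rightarrow> real" where
  "angle_at z a b = arccos (((a - z) \<bullet> (b - z)) / (norm (a - z) * norm (b - z)))"

definition shape_regular :: "real \<Rightarrow> (real^2) set set \<Rightarrow> bool" where
  "shape_regular \<theta> \<T> \<longleftrightarrow>
     (\<forall>T\<in>\<T>. \<forall>z\<in>vertices T. \<forall>a\<in>vertices T - {z}. \<forall>b\<in>vertices T - {z, a}. \<theta> \<le> angle_at z a b)"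

definition outer_normal :: "(real^2) set \<Rightarrow> (real^2) set \<Rightarrow> real^2" where
  "outer_normal T e = (THE n. norm n = 1 \<and> (\<forall>x\<in>e. \<forall>y\<in>T. n \<bullet> (y - x) \<le> 0))"

definition normal_jump :: "(real^2) set \<Rightarrow> (real^2) set \<Rightarrow> (real^2 \<Rightarrow> real^2) \<Rightarrow> (real^2 \<Rightarrow> real^2) \<Rightarrow>
    real^2 \<Rightarrow> real" where
  "normal_jump Tp Tm wp wm x =
     wp x \<bullet> outer_normal Tp (Tp \<inter> Tm) + wm x \<bullet> outer_normal Tm (Tp \<inter> Tm)"

section \<open>Finite element spaces\<close>

definition P0_on :: "(real^2) set \<Rightarrow> (real^2 \<Rightarrow> real) \<Rightarrow> bool" where
  "P0_on T v \<longleftrightarrow> (\<exists>c. AE x in lebesgue_on T. v x = c)"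

definition P1_on :: "(real^2) set \<Rightarrow> (real^2 \<Rightarrow> real) \<Rightarrow> bool" where
  "P1_on T v \<longleftrightarrow> (\<exists>c b. \<forall>x\<in>T. v x = c + b \<bullet> x)"

definition P1_gradient :: "(real^2) set \<Rightarrow> (real^2 \<Rightarrow> real) \<Rightarrow> real^2" where
  "P1_gradient T v = (THE b. \<exists>c. \<forall>x\<in>T. v x = c + b \<bullet> x)"

text \<open>
  Discrete functions are affine on every closed triangle at every point, so they are the
  continuous representatives; this is what gives point values at vertices a meaning.
\<close>

definition V_h :: "(real^2) set \<Rightarrow> (real^2) set set \<Rightarrow> (real^2 \<Rightarrow> real) set" where
  "V_h \<Omega> \<T> = {v \<in> H1 \<Omega>. \<forall>T\<in>\<T>. P1_on T v}"

definition V_h0 :: "(real^2) set \<Rightarrow> (real^2) set set \<Rightarrow> (real^2 \<Rightarrow> real) set" where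
  "V_h0 \<Omega> \<T> = V_h \<Omega> \<T> \<inter> H10 \<Omega>"

definition boundary_interpolant ::
    "(real^2) set \<Rightarrow> (real^2) set set \<Rightarrow> (real^2 \<Rightarrow> real) \<Rightarrow> (real^2 \<Rightarrow> real) \<Rightarrow> bool" where
  "boundary_interpolant \<Omega> \<T> g g\<^sub>h \<longleftrightarrow>
     continuous_on (frontier \<Omega>) g\<^sub>h \<and> (\<forall>e\<in>boundary_edges \<Omega> \<T>. P1_on e g\<^sub>h) \<and>
     (\<forall>z\<in>boundary_vertices \<Omega> \<T>. g\<^sub>h z = g z)"

definition lumped_inner :: "(real^2) set set \<Rightarrow> (real^2 \<Rightarrow> real) \<Rightarrow> (real^2 \<Rightarrow> real) \<Rightarrow> real" where
  "lumped_inner \<T> w v = (\<Sum>T\<in>\<T>. measure lebesgue T / 3 * (\<Sum>z\<in>vertices T. w z * v z))"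

section \<open>Obstacle problem and discrete obstacle problem\<close>

definition obstacle_data ::
    "(real^2) set \<Rightarrow> (real^2 \<Rightarrow> real) \<Rightarrow> (real^2 \<Rightarrow> real) \<Rightarrow> (real^2 \<Rightarrow> real) \<Rightarrow> bool" where
  "obstacle_data \<Omega> f g \<psi> \<longleftrightarrow>
     f \<in> L2_space (lebesgue_on \<Omega>) \<and>
     continuous_on (frontier \<Omega>) g \<and> (\<exists>w\<in>H1 \<Omega>. has_trace \<Omega> w g) \<and>
     \<psi> \<in> H1 \<Omega> \<and> continuous_on (closure \<Omega>) \<psi> \<and> (\<forall>x\<in>frontier \<Omega>. \<psi> x \<le> g x)"

definition K_set :: "(real^2) set \<Rightarrow> (real^2 \<Rightarrow> real) \<Rightarrow> (real^2 \<Rightarrow> real) \<Rightarrow> (real^2 \<Rightarrow> real) set" where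
  "K_set \<Omega> g \<psi> = {v \<in> H1 \<Omega>. (AE x in lebesgue_on \<Omega>. v x \<ge> \<psi> x) \<and> has_trace \<Omega> v g}"

definition obstacle_solution :: "(real^2) set \<Rightarrow> (real^2 \<Rightarrow> real) \<Rightarrow> (real^2 \<Rightarrow> real) \<Rightarrow>
    (real^2 \<Rightarrow> real) \<Rightarrow> (real^2 \<Rightarrow> real) \<Rightarrow> bool" where
  "obstacle_solution \<Omega> f g \<psi> u \<longleftrightarrow>
     u \<in> K_set \<Omega> g \<psi> \<and>
     (\<forall>v\<in>K_set \<Omega> g \<psi>. energy \<Omega> u (\<lambda>x. v x - u x) \<ge> L2_inner (lebesgue_on \<Omega>) f (\<lambda>x. v x - u x))"

definition multiplier :: "(real^2) set \<Rightarrow> (real^2 \<Rightarrow> real) \<Rightarrow> (real^2 \<Rightarrow> real) \<Rightarrow>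
    ((real^2 \<Rightarrow> real) \<Rightarrow> real) \<Rightarrow> bool" where
  "multiplier \<Omega> f u \<sigma> \<longleftrightarrow> (\<forall>v\<in>H10 \<Omega>. \<sigma> v = L2_inner (lebesgue_on \<Omega>) f v - energy \<Omega> u v)"

definition K_h :: "(real^2) set \<Rightarrow> (real^2) set set \<Rightarrow> (real^2 \<Rightarrow> real) \<Rightarrow> (real^2 \<Rightarrow> real) \<Rightarrow>
    (real^2 \<Rightarrow> real) set" where
  "K_h \<Omega> \<T> g\<^sub>h \<psi> = {v \<in> V_h \<Omega> \<T>. (\<forall>z\<in>interior_vertices \<Omega> \<T>. v z \<ge> \<psi> z) \<and> (\<forall>x\<in>frontier \<Omega>. v x = g\<^sub>h x)}"

definition discrete_solution :: "(real^2) set \<Rightarrow> (real^2) set set \<Rightarrow> (real^2 \<Rightarrow> real) \<Rightarrow>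
    (real^2 \<Rightarrow> real) \<Rightarrow> (real^2 \<Rightarrow> real) \<Rightarrow> (real^2 \<Rightarrow> real) \<Rightarrow> bool" where
  "discrete_solution \<Omega> \<T> f g\<^sub>h \<psi> u\<^sub>h \<longleftrightarrow>
     u\<^sub>h \<in> K_h \<Omega> \<T> g\<^sub>h \<psi> \<and>
     (\<forall>v\<in>K_h \<Omega> \<T> g\<^sub>h \<psi>. energy \<Omega> u\<^sub>h (\<lambda>x. v x - u\<^sub>h x) \<ge> L2_inner (lebesgue_on \<Omega>) f (\<lambda>x. v x - u\<^sub>h x))"

definition discrete_multiplier :: "(real^2) set \<Rightarrow> (real^2) set set \<Rightarrow> (real^2 \<Rightarrow> real) \<Rightarrow>
    (real^2 \<Rightarrow> real) \<Rightarrow> (real^2 \<Rightarrow> real) \<Rightarrow> bool" where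
  "discrete_multiplier \<Omega> \<T> f u\<^sub>h \<sigma>\<^sub>h \<longleftrightarrow>
     \<sigma>\<^sub>h \<in> V_h0 \<Omega> \<T> \<and>
     (\<forall>v\<in>V_h0 \<Omega> \<T>. lumped_inner \<T> \<sigma>\<^sub>h v = L2_inner (lebesgue_on \<Omega>) f v - energy \<Omega> u\<^sub>h v)"

end

theory Submission
  imports Defs "HOL-Computational_Algebra.Polynomial"
begin

text \<open>
  For an open set \<open>\<omega>\<close> inside the domain and a smooth \<open>v\<close> with compact support in \<open>\<omega>\<close>, the
  definition of the multiplier gives
  \<open>(f - \<sigma>\<^sub>h, v) - (\<nabla>u\<^sub>h, \<nabla>v) = \<langle>\<sigma> - \<sigma>\<^sub>h, v\<rangle> + (\<nabla>(u - u\<^sub>h), \<nabla>v)\<close>.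
  The right-hand side is at most the \<open>H\<^sup>1\<close> seminorm of \<open>v\<close> times the error on \<open>\<omega>\<close>, that is, the energy
  error plus the dual norm of \<open>\<sigma> - \<sigma>\<^sub>h\<close> (\<open>residual_bound\<close>).  The estimates follow from good choices
  of \<open>v\<close>.

  On a triangle \<open>T\<close> of diameter \<open>h\<close> the gradient of \<open>u\<^sub>h\<close> is constant, hence orthogonal to the
  gradient of every \<open>v\<close> supported in \<open>T\<close>.  Let \<open>p\<close> be the affine function \<open>fbar - \<sigma>\<^sub>h\<close> and \<open>v\<close> a bump
  times \<open>p\<close>.  Affine functions form a finite-dimensional space, so \<open>(p, v)\<close> dominates the square of
  the \<open>L\<^sup>2\<close> norm of \<open>p\<close> while the seminorm of \<open>v\<close> is at most that norm divided by \<open>h\<close>, up to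
  constants.  This bounds \<open>h\<close> times the norm of \<open>p\<close> by the error and the oscillation of \<open>f\<close>; the first
  claim is then the triangle inequality, the second an inverse estimate for \<open>p\<close>
  (\<open>affine_residual_le\<close>, \<open>triangle_estimate\<close>).

  Across an edge the gradient of \<open>u\<^sub>h\<close> jumps by a multiple \<open>J\<close> of the normal \<open>n\<close>, because \<open>u\<^sub>h\<close> is
  continuous.  For a bump \<open>v\<close> around the midpoint, \<open>(\<nabla>u\<^sub>h, \<nabla>v)\<close> is therefore \<open>J\<close> times the integral of
  \<open>\<nabla>v \<bullet> n\<close> over one of the two triangles, where the integrand has a sign.  The remaining term
  \<open>(f - \<sigma>\<^sub>h, v)\<close> is controlled by the element estimate, which is stated with the error on any open set
  that contains the interior of the triangle, so that it applies to the patch (\<open>edge_estimate\<close>).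

  Radial bumps on discs take the place of the customary products of barycentric coordinates.  They
  are test functions themselves, and the geometry reduces to two facts: each triangle contains a disc
  around its centroid, and two neighbours contain together a disc around the midpoint of their common
  edge, both of radius comparable to the diameter (\<open>cball_centroid_subset\<close>,
  \<open>half_ball_midpoint_subset\<close>).  Both follow from a lower bound for the area (\<open>triangle_area_ge\<close>).

  Two general facts make the definitions usable.  The weak gradient is a chosen function, so its
  uniqueness up to null sets is needed to compute with it (\<open>has_weak_gradient_unique\<close>); and the dual
  norm is a supremum of reals, which says something only if the set is bounded, a consequence of
  Poincare's inequality (\<open>H10_poincare\<close>).
\<close>

section \<open>Smooth bumps\<close>

lemma gradient_eq:
  assumes "(\<phi> has_derivative (\<lambda>h. q \<bullet> h)) (at x)"
  shows "gradient \<phi> x = q"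
  by (simp add: gradient_def vec_eq_iff inner_axis flip: frechet_derivative_at[OF assms])

lemma has_derivative_gradient:
  assumes "\<phi> differentiable (at x)"
  shows "(\<phi> has_derivative (\<lambda>h. gradient \<phi> x \<bullet> h)) (at x)"
proof -
  let ?f = "frechet_derivative \<phi> (at x)"
  have d: "(\<phi> has_derivative ?f) (at x)" using assms by (simp add: frechet_derivative_works)
  then interpret f: linear ?f by (rule has_derivative_linear)
  have "?f h = gradient \<phi> x \<bullet> h" for h
  proof -
    have "h = (\<Sum>i\<in>UNIV. h $ i *\<^sub>R axis i 1)"
      by (simp add: vec_eq_iff axis_def if_distrib cong: if_cong)
    then have "?f h = (\<Sum>i\<in>UNIV. h $ i *\<^sub>R ?f (axis i 1))"
      using f.sum f.scale by (metis (no_types, lifting) sum.cong)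
    then show ?thesis by (simp add: gradient_def inner_vec_def mult.commute)
  qed
  then have "?f = (\<lambda>h. gradient \<phi> x \<bullet> h)" by (rule ext)
  then show ?thesis using d by simp
qed

lemma gradient_add:
  assumes "\<phi> differentiable (at x)" "\<psi> differentiable (at x)"
  shows "gradient (\<lambda>x. \<phi> x + \<psi> x) x = gradient \<phi> x + gradient \<psi> x"
  by (rule gradient_eq)
     (use has_derivative_add[OF has_derivative_gradient[OF assms(1)] has_derivative_gradient[OF assms(2)]]
      in \<open>simp add: inner_add_left\<close>)

lemma gradient_mult:
  assumes "\<phi> differentiable (at x)" "\<psi> differentiable (at x)"
  shows "gradient (\<lambda>x. \<phi> x * \<psi> x) x = \<phi> x *\<^sub>R gradient \<psi> x + \<psi> x *\<^sub>R gradient \<phi> x"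
  by (rule gradient_eq)
     (use has_derivative_mult[OF has_derivative_gradient[OF assms(1)] has_derivative_gradient[OF assms(2)]]
      in \<open>simp add: inner_add_left mult.commute\<close>)

lemma gradient_compose:
  assumes "(h has_field_derivative d) (at (\<phi> x))" "\<phi> differentiable (at x)"
  shows "gradient (\<lambda>x. h (\<phi> x)) x = d *\<^sub>R gradient \<phi> x"
  by (rule gradient_eq)
     (use has_derivative_compose[OF has_derivative_gradient[OF assms(2)] assms(1)[unfolded has_field_derivative_def]]
      in \<open>simp add: o_def mult.commute\<close>)

lemma gradient_const [simp]: "gradient (\<lambda>x. c) x = 0"
  by (rule gradient_eq) simp

lemma gradient_affine [simp]: "gradient (\<lambda>x. c + q \<bullet> x) x = q"
  by (rule gradient_eq) (auto intro!: derivative_eq_intros)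

lemma C_k_const [simp]: "C_k k (\<lambda>x. c)"
  by (induction k arbitrary: c) auto

lemma C_k_affine [simp]: "C_k k (\<lambda>x. c + q \<bullet> x)"
  by (cases k) (auto intro!: continuous_intros derivative_intros)

lemma C_k_Suc_D: "C_k (Suc k) \<phi> \<Longrightarrow> C_k k \<phi>"
proof (induction k arbitrary: \<phi>)
  case 0
  then show ?case
    by (auto intro!: continuous_at_imp_continuous_on differentiable_imp_continuous_within)
next
  case (Suc k)
  from Suc.prems have "\<forall>x. \<phi> differentiable (at x)" "\<And>i. C_k (Suc k) (\<lambda>x. gradient \<phi> x $ i)"
    by simp_all
  with Suc.IH show ?case unfolding C_k.simps(2)[of k \<phi>] by blast
qed

lemma C_k_add: "C_k k \<phi> \<Longrightarrow> C_k k \<psi> \<Longrightarrow> C_k k (\<lambda>x. \<phi> x + \<psi> x)"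
proof (induction k arbitrary: \<phi> \<psi>)
  case (Suc k)
  then show ?case by (simp add: gradient_add)
qed (auto intro: continuous_intros)

lemma C_k_mult: "C_k k \<phi> \<Longrightarrow> C_k k \<psi> \<Longrightarrow> C_k k (\<lambda>x. \<phi> x * \<psi> x)"
proof (induction k arbitrary: \<phi> \<psi>)
  case (Suc k)
  have "C_k k \<phi>" "C_k k \<psi>" using Suc.prems by (auto intro: C_k_Suc_D simp del: C_k.simps)
  with Suc show ?case by (simp add: gradient_mult C_k_add)
qed (auto intro: continuous_intros)

text \<open>
  The functions equal to \<open>p (1 / t) exp (- 1 / t)\<close> for positive \<open>t\<close> and to \<open>0\<close> otherwise, with \<open>p\<close>
  a polynomial, form a class that is closed under differentiation.  Carrying the polynomial along
  turns smoothness of \<open>exp (- 1 / t)\<close> into a one-step induction.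
\<close>

definition flat :: "real poly \<Rightarrow> real \<Rightarrow> real" where
  "flat p t = (if t \<le> 0 then 0 else poly p (1 / t) * exp (- (1 / t)))"

definition flat_deriv :: "real poly \<Rightarrow> real poly" where
  "flat_deriv p = pCons 0 (pCons 0 (p - pderiv p))"

lemma poly_times_exp_tendsto_0: "((\<lambda>x::real. poly p x * exp (- x)) \<longlongrightarrow> 0) at_top"
proof -
  have "((\<lambda>x::real. \<Sum>i\<le>degree p. coeff p i * (x ^ i / exp x)) \<longlongrightarrow> (\<Sum>i\<le>degree p. coeff p i * 0)) at_top"
    by (intro tendsto_sum tendsto_mult tendsto_const tendsto_power_div_exp_0)
  then show ?thesis
    by (simp add: poly_altdef sum_distrib_right exp_minus divide_inverse mult.assoc)
qed

lemma flat_tendsto_0: "(flat p \<longlongrightarrow> 0) (at 0)"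
proof (rule filterlim_split_at)
  show "(flat p \<longlongrightarrow> 0) (at_left 0)"
    by (rule tendsto_eventually) (auto simp: eventually_at_filter flat_def)
  have "((\<lambda>t. poly p (inverse t) * exp (- inverse t)) \<longlongrightarrow> 0) (at_right 0)"
    by (rule filterlim_compose[OF poly_times_exp_tendsto_0 filterlim_inverse_at_top_right])
  then show "(flat p \<longlongrightarrow> 0) (at_right 0)"
    by (rule Lim_transform_eventually)
       (auto simp: eventually_at_filter flat_def inverse_eq_divide)
qed

lemma DERIV_flat: "(flat p has_field_derivative flat (flat_deriv p) t) (at t)"
proof -
  consider "t < 0" | "t > 0" | "t = 0" by linarith
  then show ?thesis
  proof cases
    case 1
    have "(flat p has_field_derivative 0) (at t)"
      by (rule has_field_derivative_transform_within_open[OF DERIV_const[of 0 "at t"], where S = "{..<0}"])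
         (use 1 in \<open>auto simp: flat_def\<close>)
    then show ?thesis using 1 by (simp add: flat_def)
  next
    case 2
    have inv: "((\<lambda>t. 1 / t) has_field_derivative - (1 / t * (1 / t))) (at t)"
      using 2 by (auto intro!: derivative_eq_intros)
    have "((\<lambda>t. poly p (1 / t) * exp (- (1 / t))) has_field_derivative
        poly (pderiv p) (1 / t) * (- (1 / t * (1 / t))) * exp (- (1 / t)) +
        exp (- (1 / t)) * (- (- (1 / t * (1 / t)))) * poly p (1 / t)) (at t)"
      by (rule DERIV_mult[OF DERIV_chain2[OF poly_DERIV inv] DERIV_chain2[OF DERIV_exp DERIV_minus[OF inv]]])
    also have "poly (pderiv p) (1 / t) * (- (1 / t * (1 / t))) * exp (- (1 / t)) +
        exp (- (1 / t)) * (- (- (1 / t * (1 / t)))) * poly p (1 / t) = flat (flat_deriv p) t"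
      using 2 by (simp add: flat_def flat_deriv_def algebra_simps)
    finally show ?thesis
      by (rule has_field_derivative_transform_within_open[where S = "{0<..}"])
         (use 2 in \<open>auto simp: flat_def\<close>)
  next
    case 3
    have "((\<lambda>h. (flat p (0 + h) - flat p 0) / h) \<longlongrightarrow> 0) (at 0)"
      by (rule Lim_transform_eventually[OF flat_tendsto_0[of "pCons 0 p"]])
         (auto simp: eventually_at_filter flat_def)
    then show ?thesis using 3 by (simp add: DERIV_def flat_def)
  qed
qed

lemma C_k_flat:
  assumes "\<And>k. C_k k \<phi>"
  shows "C_k k (\<lambda>x. flat p (\<phi> x))"
proof (induction k arbitrary: p)
  case 0
  have "continuous_on UNIV (flat p)"
    using DERIV_flat by (intro continuous_at_imp_continuous_on) (auto intro: DERIV_isCont)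
  then show ?case using assms[of 0] by (auto intro: continuous_on_compose2)
next
  case (Suc k)
  have \<phi>: "\<phi> differentiable (at x)" "C_k k (\<lambda>x. gradient \<phi> x $ i)" for x i
    using assms[of "Suc k"] by auto
  have "(\<lambda>x. flat p (\<phi> x)) differentiable (at x)" for x
    using has_derivative_compose[OF has_derivative_gradient[OF \<phi>(1)]
        DERIV_flat[unfolded has_field_derivative_def]]
    by (auto simp: differentiable_def)
  then show ?case
    using Suc.IH \<phi> by (simp add: gradient_compose[OF DERIV_flat] C_k_mult)
qed

text \<open>
  The classical bump \<open>exp (- 1 / (1 - |x - c|\<^sup>2 / \<rho>\<^sup>2))\<close> on the disc of radius \<open>\<rho>\<close>.
\<close>

definition bump :: "real^2 \<Rightarrow> real \<Rightarrow> real^2 \<Rightarrow> real" where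
  "bump c \<rho> x = flat 1 (1 - ((x - c) \<bullet> (x - c)) / \<rho>\<^sup>2)"

lemma C_k_bump: "C_k k (bump c \<rho>)"
proof -
  have eq: "1 - ((x - c) \<bullet> (x - c)) / \<rho>\<^sup>2 =
      1 + (- 1 / \<rho>\<^sup>2) * ((- (c $ 1) + axis 1 1 \<bullet> x) * (- (c $ 1) + axis 1 1 \<bullet> x)
         + (- (c $ 2) + axis 2 1 \<bullet> x) * (- (c $ 2) + axis 2 1 \<bullet> x))" for x :: "real^2"
    by (simp add: inner_vec_def sum_2 axis_def algebra_simps add_divide_distrib diff_divide_distrib)
  show ?thesis unfolding bump_def eq
    by (intro C_k_flat C_k_add C_k_mult C_k_const C_k_affine)
qed

lemma bump_eq_0_iff: "\<rho> > 0 \<Longrightarrow> bump c \<rho> x = 0 \<longleftrightarrow> x \<notin> ball c \<rho>"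
proof -
  assume "\<rho> > 0"
  then have "(1 - ((x - c) \<bullet> (x - c)) / \<rho>\<^sup>2 \<le> 0) \<longleftrightarrow> \<rho>\<^sup>2 \<le> (norm (x - c))\<^sup>2"
    by (simp add: field_simps power2_norm_eq_inner)
  also have "\<dots> \<longleftrightarrow> \<rho> \<le> norm (x - c)" using \<open>\<rho> > 0\<close> by (simp add: power_mono_iff)
  finally show ?thesis by (simp add: bump_def flat_def dist_norm norm_minus_commute not_less)
qed

lemma bump_bounds: "0 \<le> bump c \<rho> x" "bump c \<rho> x \<le> 1"
  by (auto simp: bump_def flat_def)

text \<open>
  The lower bounds are needed only on discs well inside the support, where the argument of \<open>flat\<close>
  stays away from its zero.
\<close>

lemma bump_argument_ge:
  assumes "\<rho> > 0" "norm (x - c) \<le> \<rho> / 2"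
  shows "1 / 2 \<le> 1 - ((x - c) \<bullet> (x - c)) / \<rho>\<^sup>2"
proof -
  have "(norm (x - c))\<^sup>2 \<le> (\<rho> / 2)\<^sup>2" using assms by (intro power_mono) auto
  then have "((x - c) \<bullet> (x - c)) / \<rho>\<^sup>2 \<le> 1 / 4"
    using assms(1) by (simp add: power2_norm_eq_inner power_divide pos_divide_le_eq)
  then show ?thesis by linarith
qed

lemma bump_ge:
  assumes "\<rho> > 0" "norm (x - c) \<le> \<rho> / 2"
  shows "exp (-2) \<le> bump c \<rho> x"
proof -
  define t where "t = 1 - ((x - c) \<bullet> (x - c)) / \<rho>\<^sup>2"
  have "1 / 2 \<le> t" unfolding t_def by (rule bump_argument_ge[OF assms])
  moreover from this have "1 / t \<le> 2"
    by (simp add: field_simps)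
  ultimately show ?thesis by (simp add: bump_def flat_def flip: t_def)
qed

text \<open>
  The derivative of the radial profile, up to the inner derivative.
\<close>

definition bump_slope :: "real^2 \<Rightarrow> real \<Rightarrow> real^2 \<Rightarrow> real" where
  "bump_slope c \<rho> x = flat (flat_deriv 1) (1 - ((x - c) \<bullet> (x - c)) / \<rho>\<^sup>2)"

lemma gradient_bump: "gradient (bump c \<rho>) x = (- 2 * bump_slope c \<rho> x / \<rho>\<^sup>2) *\<^sub>R (x - c)"
proof -
  have "((\<lambda>x. 1 - ((x - c) \<bullet> (x - c)) / \<rho>\<^sup>2) has_derivative (\<lambda>h. ((- 2 / \<rho>\<^sup>2) *\<^sub>R (x - c)) \<bullet> h)) (at x)"
    unfolding divide_inverse by (auto intro!: derivative_eq_intros simp: inner_commute fun_eq_iff)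
  then have "gradient (\<lambda>x. 1 - ((x - c) \<bullet> (x - c)) / \<rho>\<^sup>2) x = (- 2 / \<rho>\<^sup>2) *\<^sub>R (x - c)"
    and "(\<lambda>x. 1 - ((x - c) \<bullet> (x - c)) / \<rho>\<^sup>2) differentiable (at x)"
    by (rule gradient_eq, auto simp: differentiable_def)
  then show ?thesis unfolding bump_def [abs_def] bump_slope_def
    by (subst gradient_compose[OF DERIV_flat]) auto
qed

lemma bump_slope_bounds: "0 \<le> bump_slope c \<rho> x" "bump_slope c \<rho> x \<le> 2"
proof -
  have le: "y\<^sup>2 * exp (- y) \<le> 2" if "y > 0" for y :: real
  proof -
    \<comment> \<open>The derivative is of the form \<open>y\<^sup>2 exp (- y)\<close> with \<open>y = 1 / t\<close>.\<close>
    have "1 + y + y\<^sup>2 / 2 \<le> exp y" using that by (intro exp_lower_Taylor_quadratic) simp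
    then have "y\<^sup>2 \<le> 2 * exp y" using that by linarith
    then show ?thesis by (simp add: exp_minus field_simps)
  qed
  show "0 \<le> bump_slope c \<rho> x" by (auto simp: bump_slope_def flat_def flat_deriv_def)
  show "bump_slope c \<rho> x \<le> 2"
    using le[of "1 / (1 - ((x - c) \<bullet> (x - c)) / \<rho>\<^sup>2)"]
    by (auto simp: bump_slope_def flat_def flat_deriv_def power2_eq_square mult.assoc)
qed

lemma bump_slope_ge:
  assumes "\<rho> > 0" "norm (x - c) \<le> \<rho> / 2"
  shows "exp (-2) \<le> bump_slope c \<rho> x"
proof -
  define t where "t = 1 - ((x - c) \<bullet> (x - c)) / \<rho>\<^sup>2"
  have t: "1 / 2 \<le> t" "t \<le> 1"
    using bump_argument_ge[OF assms] by (simp_all add: t_def)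
  have "1 \<le> 1 / t" "1 / t \<le> 2" using t by (simp_all add: field_simps)
  then have "1 * 1 * exp (- 2) \<le> 1 / t * (1 / t) * exp (- (1 / t))"
    using t by (intro mult_mono) auto
  then show ?thesis using t by (simp add: bump_slope_def flat_def flat_deriv_def mult.assoc flip: t_def)
qed

lemma norm_gradient_bump:
  assumes "\<rho> > 0"
  shows "norm (gradient (bump c \<rho>) x) \<le> 4 / \<rho>"
proof (cases "x \<in> ball c \<rho>")
  case True
  then have "norm (x - c) \<le> \<rho>" by (simp add: dist_norm norm_minus_commute)
  then have "bump_slope c \<rho> x * norm (x - c) \<le> 2 * \<rho>"
    using bump_slope_bounds[of c \<rho> x] assms by (intro mult_mono) auto
  then have "2 * (bump_slope c \<rho> x * norm (x - c)) / \<rho>\<^sup>2 \<le> 2 * (2 * \<rho>) / \<rho>\<^sup>2"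
    by (intro divide_right_mono mult_left_mono) auto
  then show ?thesis using assms bump_slope_bounds[of c \<rho> x]
    by (simp add: gradient_bump power2_eq_square)
next
  case False
  then have "1 - ((x - c) \<bullet> (x - c)) / \<rho>\<^sup>2 \<le> 0"
    using assms bump_eq_0_iff[OF assms, of c x] by (auto simp: bump_def flat_def split: if_splits)
  then show ?thesis using assms by (simp add: gradient_bump bump_slope_def flat_def)
qed

text \<open>
  The supply of test functions for all later arguments.
\<close>

lemma bump_times_in_test_functions:
  assumes "\<rho> > 0" "cball c \<rho> \<subseteq> \<Omega>" "\<And>k. C_k k \<phi>"
  shows "(\<lambda>x. bump c \<rho> x * \<phi> x) \<in> test_functions \<Omega>"
proof -
  have sub: "closure {x. bump c \<rho> x * \<phi> x \<noteq> 0} \<subseteq> cball c \<rho>"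
  proof (rule closure_minimal)
    show "{x. bump c \<rho> x * \<phi> x \<noteq> 0} \<subseteq> cball c \<rho>"
      by (auto simp: bump_eq_0_iff[OF assms(1)])
  qed simp
  then have "compact (closure {x. bump c \<rho> x * \<phi> x \<noteq> 0})"
    using bounded_subset[OF bounded_cball] by (simp add: compact_eq_bounded_closed)
  then show ?thesis
    using sub assms(2) C_k_mult[OF C_k_bump assms(3)] unfolding test_functions_def by blast
qed

section \<open>Square-integrable functions\<close>

lemma L2_space_measurable: "v \<in> L2_space M \<Longrightarrow> v \<in> borel_measurable M"
  by (simp add: L2_space_def)

lemma L2_space_integrable: "v \<in> L2_space M \<Longrightarrow> integrable M (\<lambda>x. (norm (v x))\<^sup>2)"
  by (simp add: L2_space_def)

lemma two_inner_le: "2 * \<bar>a \<bullet> b\<bar> \<le> (norm a)\<^sup>2 + (norm (b::'a::real_inner))\<^sup>2"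
proof -
  have "2 * (norm a * norm b) \<le> (norm a)\<^sup>2 + (norm b)\<^sup>2"
    using sum_squares_bound[of "norm a" "norm b"] by (simp add: mult.assoc)
  then show ?thesis using Cauchy_Schwarz_ineq2[of a b] by linarith
qed

lemma integrable_L2_inner:
  assumes "v \<in> L2_space M" "w \<in> L2_space M"
  shows "integrable M (\<lambda>x. v x \<bullet> w x)"
proof (rule Bochner_Integration.integrable_bound)
  show "integrable M (\<lambda>x. (norm (v x))\<^sup>2 + (norm (w x))\<^sup>2)"
    using assms by (simp add: L2_space_integrable)
  show "(\<lambda>x. v x \<bullet> w x) \<in> borel_measurable M"
    using assms by (auto dest!: L2_space_measurable)
  show "AE x in M. norm (v x \<bullet> w x) \<le> norm ((norm (v x))\<^sup>2 + (norm (w x))\<^sup>2)"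
  proof (rule AE_I2)
    fix x show "norm (v x \<bullet> w x) \<le> norm ((norm (v x))\<^sup>2 + (norm (w x))\<^sup>2)"
      using two_inner_le[of "v x" "w x"] by simp
  qed
qed

lemma L2_space_scale: "v \<in> L2_space M \<Longrightarrow> (\<lambda>x. c *\<^sub>R v x) \<in> L2_space M"
  by (auto simp: L2_space_def power_mult_distrib)

lemma L2_space_scale_real: "v \<in> L2_space M \<Longrightarrow> (\<lambda>x. c * v x :: real) \<in> L2_space M"
  using L2_space_scale[of v M c] by simp

lemma norm_add_power2: "(norm (a + b))\<^sup>2 = (norm a)\<^sup>2 + 2 * (a \<bullet> b) + (norm (b::'a::real_inner))\<^sup>2"
  by (simp add: power2_norm_eq_inner inner_add_left inner_add_right inner_commute)

lemma L2_space_add: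
  assumes "v \<in> L2_space M" "w \<in> L2_space M"
  shows "(\<lambda>x. v x + w x) \<in> L2_space M"
  using assms integrable_L2_inner[OF assms]
  by (auto simp: L2_space_def norm_add_power2)

lemma L2_space_diff:
  assumes "v \<in> L2_space M" "w \<in> L2_space M"
  shows "(\<lambda>x. v x - w x) \<in> L2_space M"
  using L2_space_add[OF assms(1) L2_space_scale[OF assms(2), of "-1"]] by simp

lemma L2_space_component: "v \<in> L2_space M \<Longrightarrow> (\<lambda>x. v x $ i) \<in> L2_space (M :: 'b measure)"
  for v :: "'b \<Rightarrow> real^'n"
proof -
  assume v: "v \<in> L2_space M"
  have m: "(\<lambda>x. v x $ i) \<in> borel_measurable M"
    using borel_measurable_inner[OF L2_space_measurable[OF v] borel_measurable_const[of "axis i 1"]]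
    by (simp add: inner_axis)
  have "(norm (v x $ i))\<^sup>2 \<le> (norm (v x))\<^sup>2" for x
    using component_le_norm_cart[of "v x" i] by (intro power_mono) auto
  then have "integrable M (\<lambda>x. (norm (v x $ i))\<^sup>2)"
    by (intro Bochner_Integration.integrable_bound[OF L2_space_integrable[OF v]]) (use m in auto)
  then show ?thesis using m by (simp add: L2_space_def)
qed

lemma L2_norm_nonneg [simp]: "0 \<le> L2_norm M v"
  by (simp add: L2_norm_def L2_inner_def)

lemma L2_norm_power2: "(L2_norm M v)\<^sup>2 = (\<integral>x. (norm (v x))\<^sup>2 \<partial>M)"
  by (simp add: L2_norm_def L2_inner_def power2_norm_eq_inner)

lemma L2_inner_le:
  assumes v: "v \<in> L2_space M" and w: "w \<in> L2_space M"
  shows "\<bar>L2_inner M v w\<bar> \<le> L2_norm M v * L2_norm M w"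
proof -
  define A where "A = (L2_norm M v)\<^sup>2"
  define B where "B = L2_inner M v w"
  define C where "C = (L2_norm M w)\<^sup>2"
  \<comment> \<open>The discriminant argument; for \<open>C = 0\<close> the affine function of \<open>t\<close> is bounded below only if \<open>B = 0\<close>.\<close>
  have q: "0 \<le> A + 2 * t * B + t\<^sup>2 * C" for t
  proof -
    have "0 \<le> (\<integral>x. (norm (v x + t *\<^sub>R w x))\<^sup>2 \<partial>M)" by (intro integral_nonneg_AE) simp
    also have "(\<lambda>x. (norm (v x + t *\<^sub>R w x))\<^sup>2) =
        (\<lambda>x. (norm (v x))\<^sup>2 + 2 * t * (v x \<bullet> w x) + t\<^sup>2 * (norm (w x))\<^sup>2)"
      by (simp add: norm_add_power2 power_mult_distrib mult.assoc)
    also have "(\<integral>x. (norm (v x))\<^sup>2 + 2 * t * (v x \<bullet> w x) + t\<^sup>2 * (norm (w x))\<^sup>2 \<partial>M) = A + 2 * t * B + t\<^sup>2 * C"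
      using integrable_L2_inner[OF v w] L2_space_integrable[OF v] L2_space_integrable[OF w]
      by (simp add: A_def B_def C_def L2_norm_power2 L2_inner_def)
    finally show ?thesis .
  qed
  have "B\<^sup>2 \<le> A * C"
  proof (cases "C = 0")
    case True
    have "B = 0"
    proof (rule ccontr)
      assume "B \<noteq> 0"
      then have "2 * (- (A + 1) / (2 * B)) * B = - (A + 1)" by simp
      then show False using q[of "- (A + 1) / (2 * B)"] True by simp
    qed
    then show ?thesis using True by simp
  next
    case False
    then have "C > 0" by (simp add: C_def)
    then have "A + 2 * (- B / C) * B + (- B / C)\<^sup>2 * C = A - B\<^sup>2 / C"
      by (simp add: power2_eq_square)
    then have "B\<^sup>2 / C \<le> A" using q[of "- B / C"] by linarith
    then show ?thesis using \<open>C > 0\<close> by (simp add: pos_divide_le_eq)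
  qed
  also have "A * C = (L2_norm M v * L2_norm M w)\<^sup>2" by (simp add: A_def C_def power_mult_distrib)
  finally have "\<bar>L2_inner M v w\<bar>\<^sup>2 \<le> (L2_norm M v * L2_norm M w)\<^sup>2" by (simp add: B_def)
  then show ?thesis by (rule power2_le_imp_le) simp
qed

lemma L2_norm_triangle:
  assumes v: "v \<in> L2_space M" and w: "w \<in> L2_space M"
  shows "L2_norm M (\<lambda>x. v x + w x) \<le> L2_norm M v + L2_norm M w"
proof (rule power2_le_imp_le)
  have "(L2_norm M (\<lambda>x. v x + w x))\<^sup>2 = (L2_norm M v)\<^sup>2 + 2 * L2_inner M v w + (L2_norm M w)\<^sup>2"
    using integrable_L2_inner[OF v w] L2_space_integrable[OF v] L2_space_integrable[OF w]
    by (simp add: L2_norm_power2 L2_inner_def norm_add_power2)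
  then show "(L2_norm M (\<lambda>x. v x + w x))\<^sup>2 \<le> (L2_norm M v + L2_norm M w)\<^sup>2"
    using L2_inner_le[OF v w] by (simp add: power2_sum)
qed simp

lemma L2_norm_scale: "L2_norm M (\<lambda>x. c *\<^sub>R v x) = \<bar>c\<bar> * L2_norm M v"
proof -
  have "(L2_norm M (\<lambda>x. c *\<^sub>R v x))\<^sup>2 = (\<bar>c\<bar> * L2_norm M v)\<^sup>2"
    by (simp add: L2_norm_power2 power_mult_distrib)
  then show ?thesis by (rule power2_eq_imp_eq) auto
qed

lemma L2_norm_commute: "L2_norm M (\<lambda>x. v x - w x) = L2_norm M (\<lambda>x. w x - v x)"
  using L2_norm_scale[of M "-1" "\<lambda>x. v x - w x"] by simp

lemma L2_norm_mono:
  assumes w: "w \<in> L2_space M" and v: "v \<in> borel_measurable M"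
    and le: "\<And>x. x \<in> space M \<Longrightarrow> norm (v x) \<le> c * norm (w x)" and c: "0 \<le> c"
  shows "L2_norm M v \<le> c * L2_norm M w"
proof (rule power2_le_imp_le)
  have sq: "(norm (v x))\<^sup>2 \<le> c\<^sup>2 * (norm (w x))\<^sup>2" if "x \<in> space M" for x
    using power_mono[OF le[OF that], of 2] by (simp add: power_mult_distrib)
  have "(L2_norm M v)\<^sup>2 \<le> (\<integral>x. c\<^sup>2 * (norm (w x))\<^sup>2 \<partial>M)"
    unfolding L2_norm_power2 using L2_space_integrable[OF w] sq by (intro integral_mono') auto
  then show "(L2_norm M v)\<^sup>2 \<le> (c * L2_norm M w)\<^sup>2" by (simp add: L2_norm_power2 power_mult_distrib)
qed (use c in simp)

lemma L2_norm_component: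
  fixes G :: "'a \<Rightarrow> real^'n"
  assumes "G \<in> L2_space M"
  shows "L2_norm M (\<lambda>x. G x $ i) \<le> L2_norm M G"
  using L2_norm_mono[OF assms, of "\<lambda>x. G x $ i" 1] L2_space_measurable[OF L2_space_component[OF assms, of i]]
    component_le_norm_cart by auto

lemma L2_norm_cong_AE:
  assumes "v \<in> L2_space M" "w \<in> L2_space M" "AE x in M. v x = w x"
  shows "L2_norm M v = L2_norm M w"
proof -
  have "(L2_norm M v)\<^sup>2 = (L2_norm M w)\<^sup>2"
    unfolding L2_norm_power2 using assms
    by (intro integral_cong_AE) (auto dest: L2_space_measurable L2_space_integrable)
  then show ?thesis by (rule power2_eq_imp_eq) auto
qed

lemma L2_inner_cong_AE:
  assumes "v \<in> L2_space M" "w \<in> L2_space M" "v' \<in> L2_space M" "w' \<in> L2_space M"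
    "AE x in M. v x = v' x" "AE x in M. w x = w' x"
  shows "L2_inner M v w = L2_inner M v' w'"
  unfolding L2_inner_def using assms(5,6)
  by (intro integral_cong_AE borel_measurable_inner L2_space_measurable assms) auto

text \<open>
  Completeness of Lebesgue measure: a change on a null set preserves measurability.
\<close>

lemma L2_space_cong_AE_lebesgue:
  fixes v w :: "'a::euclidean_space \<Rightarrow> 'b::euclidean_space"
  assumes v: "v \<in> L2_space (lebesgue_on S)" and S: "S \<in> sets lebesgue"
    and AE: "AE x in lebesgue_on S. v x = w x"
  shows "w \<in> L2_space (lebesgue_on S)"
proof -
  obtain N where N: "N \<in> null_sets (lebesgue_on S)" "{x \<in> S. v x \<noteq> w x} \<subseteq> N"
    using AE by (auto elim!: AE_E simp: null_sets_def)
  have "v \<in> borel_measurable (lebesgue_on (S - N))"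
    using borel_measurable_diff_null[OF N(1) S] L2_space_measurable[OF v] by blast
  then have "w \<in> borel_measurable (lebesgue_on (S - N))"
    by (rule measurable_cong[THEN iffD1, rotated]) (use N in auto)
  then have w: "w \<in> borel_measurable (lebesgue_on S)"
    using borel_measurable_diff_null[OF N(1) S] by blast
  moreover have "integrable (lebesgue_on S) (\<lambda>x. (norm (w x))\<^sup>2)"
  proof (rule integrable_cong_AE_imp[OF L2_space_integrable[OF v]])
    show "AE x in lebesgue_on S. (norm (v x))\<^sup>2 = (norm (w x))\<^sup>2"
      using AE by (rule eventually_mono) simp
  qed (use w in auto)
  ultimately show ?thesis by (simp add: L2_space_def)
qed

lemma
  fixes v :: "'a::euclidean_space \<Rightarrow> 'b::euclidean_space"
  assumes v: "v \<in> L2_space (lebesgue_on \<Omega>)" and S: "S \<in> sets lebesgue" "\<Omega> \<in> sets lebesgue" "S \<subseteq> \<Omega>"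
  shows L2_space_subset: "v \<in> L2_space (lebesgue_on S)"
    and L2_norm_subset: "L2_norm (lebesgue_on S) v \<le> L2_norm (lebesgue_on \<Omega>) v"
proof -
  have i: "integrable (lebesgue_on S) (\<lambda>x. (norm (v x))\<^sup>2)"
  proof -
    have "integrable lebesgue (\<lambda>x. indicator S x *\<^sub>R (indicator \<Omega> x *\<^sub>R (norm (v x))\<^sup>2))"
      using L2_space_integrable[OF v] S
      by (intro integrable_mult_indicator[OF S(1)]) (simp add: integrable_restrict_space sets.Int_space_eq2)
    also have "(\<lambda>x. indicator S x *\<^sub>R (indicator \<Omega> x *\<^sub>R (norm (v x))\<^sup>2)) = (\<lambda>x. indicator S x *\<^sub>R (norm (v x))\<^sup>2)"
      using S(3) by (auto simp: indicator_def fun_eq_iff)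
    finally show ?thesis using S by (simp add: integrable_restrict_space sets.Int_space_eq2)
  qed
  show "v \<in> L2_space (lebesgue_on S)"
    using measurable_restrict_mono[OF L2_space_measurable[OF v] S(3)] i by (simp add: L2_space_def)
  have "(L2_norm (lebesgue_on S) v)\<^sup>2 = (\<integral>x. (if x \<in> S then (norm (v x))\<^sup>2 else 0) \<partial>lebesgue_on \<Omega>)"
    using S by (simp add: L2_norm_power2 integral_restrict)
  also have "\<dots> \<le> (L2_norm (lebesgue_on \<Omega>) v)\<^sup>2"
    unfolding L2_norm_power2
    by (intro integral_mono' L2_space_integrable[OF v]) auto
  finally show "L2_norm (lebesgue_on S) v \<le> L2_norm (lebesgue_on \<Omega>) v"
    by (rule power2_le_imp_le) simp
qed

text \<open>
  Test functions and their limits live on a patch and are extended by zero to the domain; the norms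
  do not notice.
\<close>

lemma
  fixes v :: "'a::euclidean_space \<Rightarrow> 'b::euclidean_space"
  assumes v: "v \<in> L2_space (lebesgue_on S)" and S: "S \<in> sets lebesgue" "\<Omega> \<in> sets lebesgue" "S \<subseteq> \<Omega>"
  shows L2_space_extend: "(\<lambda>x. if x \<in> S then v x else 0) \<in> L2_space (lebesgue_on \<Omega>)"
    and L2_norm_extend: "L2_norm (lebesgue_on \<Omega>) (\<lambda>x. if x \<in> S then v x else 0) = L2_norm (lebesgue_on S) v"
proof -
  have m: "(\<lambda>x. if x \<in> S then v x else 0) \<in> borel_measurable lebesgue"
    using L2_space_measurable[OF v] S by (simp add: borel_measurable_if)
  have sq: "(\<lambda>x. (norm (if x \<in> S then v x else 0))\<^sup>2) = (\<lambda>x. if x \<in> S then (norm (v x))\<^sup>2 else 0)"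
    by auto
  have "integrable lebesgue (\<lambda>x. if x \<in> S then (norm (v x))\<^sup>2 else 0)"
  proof -
    have "integrable lebesgue (\<lambda>x. indicator S x *\<^sub>R (norm (v x))\<^sup>2)"
      using L2_space_integrable[OF v] S by (simp add: integrable_restrict_space sets.Int_space_eq2)
    also have "(\<lambda>x. indicator S x *\<^sub>R (norm (v x))\<^sup>2) = (\<lambda>x. if x \<in> S then (norm (v x))\<^sup>2 else 0)"
      by (auto simp: indicator_def)
    finally show ?thesis .
  qed
  then have "integrable (lebesgue_on \<Omega>) (\<lambda>x. if x \<in> S then (norm (v x))\<^sup>2 else 0)"
    using S(2) integrable_mult_indicator[of \<Omega> lebesgue "\<lambda>x. if x \<in> S then (norm (v x))\<^sup>2 else 0"]
    by (subst integrable_restrict_space) (auto simp del: real_scaleR_def)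
  then show "(\<lambda>x. if x \<in> S then v x else 0) \<in> L2_space (lebesgue_on \<Omega>)"
    using m by (simp add: L2_space_def sq measurable_restrict_space1)
  have "(L2_norm (lebesgue_on \<Omega>) (\<lambda>x. if x \<in> S then v x else 0))\<^sup>2 = (L2_norm (lebesgue_on S) v)\<^sup>2"
    using S by (simp add: L2_norm_power2 sq integral_restrict)
  then show "L2_norm (lebesgue_on \<Omega>) (\<lambda>x. if x \<in> S then v x else 0) = L2_norm (lebesgue_on S) v"
    by (rule power2_eq_imp_eq) auto
qed

lemma L2_inner_extend:
  assumes "S \<in> sets lebesgue" "\<Omega> \<in> sets lebesgue" "S \<subseteq> \<Omega>" "\<And>x. x \<in> \<Omega> - S \<Longrightarrow> w x = 0"
  shows "L2_inner (lebesgue_on \<Omega>) v w = L2_inner (lebesgue_on S) v w"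
proof -
  have "L2_inner (lebesgue_on \<Omega>) v w = (\<integral>x. (if x \<in> S then v x \<bullet> w x else 0) \<partial>lebesgue_on \<Omega>)"
    unfolding L2_inner_def by (rule Bochner_Integration.integral_cong) (use assms(4) in auto)
  then show ?thesis using assms by (simp add: L2_inner_def integral_restrict)
qed

text \<open>
  Used for \<open>S\<close> the interior of a triangle \<open>T\<close>, since weak gradients live on open sets while the
  oscillation is measured on closed triangles.
\<close>

lemma L2_space_negligible:
  fixes v :: "'a::euclidean_space \<Rightarrow> 'b::euclidean_space"
  assumes v: "v \<in> L2_space (lebesgue_on S)" and S: "S \<in> sets lebesgue" "S \<subseteq> T" "negligible (T - S)"
  shows "v \<in> L2_space (lebesgue_on T)"
proof -
  have T: "T \<in> sets lebesgue"
    using S negligible_imp_sets[OF S(3)] by (metis Diff_partition sets.Un)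
  have "T - S \<in> null_sets (lebesgue_on T)"
    using S(3) T by (auto simp: null_sets_restrict_space negligible_iff_null_sets)
  then have "AE x in lebesgue_on T. (if x \<in> S then v x else 0) = v x"
    by (rule AE_I') auto
  then show ?thesis by (rule L2_space_cong_AE_lebesgue[OF L2_space_extend[OF v S(1) T S(2)] T])
qed

lemma negligible_diff_interior:
  fixes S :: "'a::euclidean_space set"
  assumes "convex S"
  shows "negligible (S - interior S)"
proof -
  have "S - interior S \<subseteq> frontier S" by (auto simp: frontier_def intro: closure_subset[THEN subsetD])
  then show ?thesis using negligible_convex_frontier[OF assms] negligible_subset by blast
qed

lemma
  fixes v :: "'a::euclidean_space \<Rightarrow> 'b::euclidean_space"
  assumes v: "v \<in> L2_space (lebesgue_on S)" "v \<in> L2_space (lebesgue_on T)"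
    and m: "S \<in> sets lebesgue" "T \<in> sets lebesgue"
  shows L2_space_Un: "v \<in> L2_space (lebesgue_on (S \<union> T))"
    and L2_norm_Un_le: "L2_norm (lebesgue_on (S \<union> T)) v \<le> L2_norm (lebesgue_on S) v + L2_norm (lebesgue_on T) v"
proof -
  let ?M = "lebesgue_on (S \<union> T)"
  have U: "S \<union> T \<in> sets lebesgue" "T - S \<in> sets lebesgue" using m by auto
  have d: "v \<in> L2_space (lebesgue_on (T - S))" by (rule L2_space_subset[OF v(2)]) (use m in auto)
  let ?a = "\<lambda>x. if x \<in> S then v x else 0" and ?b = "\<lambda>x. if x \<in> T - S then v x else 0"
  have a: "?a \<in> L2_space ?M" "L2_norm ?M ?a = L2_norm (lebesgue_on S) v"
    by (rule L2_space_extend[OF v(1) m(1) U(1)], simp, rule L2_norm_extend[OF v(1) m(1) U(1)], simp)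
  have b: "?b \<in> L2_space ?M" "L2_norm ?M ?b = L2_norm (lebesgue_on (T - S)) v"
    by (rule L2_space_extend[OF d U(2,1)], blast, rule L2_norm_extend[OF d U(2,1)], blast)
  have AE: "AE x in ?M. ?a x + ?b x = v x" by (rule AE_I2) auto
  show w: "v \<in> L2_space ?M" by (rule L2_space_cong_AE_lebesgue[OF L2_space_add[OF a(1) b(1)] U(1) AE])
  have "L2_norm ?M v = L2_norm ?M (\<lambda>x. ?a x + ?b x)"
    by (rule L2_norm_cong_AE[OF L2_space_add[OF a(1) b(1)] w AE, symmetric])
  also have "\<dots> \<le> L2_norm (lebesgue_on S) v + L2_norm (lebesgue_on (T - S)) v"
    using L2_norm_triangle[OF a(1) b(1)] a(2) b(2) by simp
  also have "L2_norm (lebesgue_on (T - S)) v \<le> L2_norm (lebesgue_on T) v"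
    by (rule L2_norm_subset[OF v(2)]) (use m in auto)
  finally show "L2_norm ?M v \<le> L2_norm (lebesgue_on S) v + L2_norm (lebesgue_on T) v" by simp
qed

lemma bounded_imp_L2_space:
  fixes v :: "'a::euclidean_space \<Rightarrow> 'b::euclidean_space"
  assumes S: "S \<in> lmeasurable" and v: "v \<in> borel_measurable (lebesgue_on S)"
    and B: "\<And>x. x \<in> S \<Longrightarrow> norm (v x) \<le> B" "0 \<le> B"
  shows "v \<in> L2_space (lebesgue_on S)" and "L2_norm (lebesgue_on S) v \<le> B * sqrt (measure lebesgue S)"
proof -
  have c: "integrable (lebesgue_on S) (\<lambda>x. B\<^sup>2)" and cv: "(\<integral>x. B\<^sup>2 \<partial>lebesgue_on S) = B\<^sup>2 * measure lebesgue S"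
  proof -
    have f: "emeasure (lebesgue_on S) (space (lebesgue_on S)) < \<infinity>"
      using S fmeasurableD2[OF S]
      by (subst emeasure_restrict_space) (auto simp: fmeasurable_def less_top simp del: emeasure_completion)
    then show "integrable (lebesgue_on S) (\<lambda>x. B\<^sup>2)" by (simp add: finite_measure.integrable_const finite_measureI)
    show "(\<integral>x. B\<^sup>2 \<partial>lebesgue_on S) = B\<^sup>2 * measure lebesgue S"
      using S by (simp add: measure_restrict_space fmeasurableD)
  qed
  have le: "(norm (v x))\<^sup>2 \<le> B\<^sup>2" if "x \<in> S" for x using B(1)[OF that] by (intro power_mono) auto
  have i: "integrable (lebesgue_on S) (\<lambda>x. (norm (v x))\<^sup>2)"
    by (rule Bochner_Integration.integrable_bound[OF c]) (use v le in auto)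
  then show "v \<in> L2_space (lebesgue_on S)" using v by (simp add: L2_space_def)
  have "(L2_norm (lebesgue_on S) v)\<^sup>2 \<le> B\<^sup>2 * measure lebesgue S"
    unfolding L2_norm_power2 cv[symmetric] by (rule integral_mono[OF i c]) (use le in auto)
  also have "\<dots> = (B * sqrt (measure lebesgue S))\<^sup>2" by (simp add: power_mult_distrib)
  finally show "L2_norm (lebesgue_on S) v \<le> B * sqrt (measure lebesgue S)"
    by (rule power2_le_imp_le) (use B in auto)
qed

lemma measurable_continuous_lebesgue_on:
  fixes v :: "'a::euclidean_space \<Rightarrow> 'b::euclidean_space"
  assumes "continuous_on UNIV v"
  shows "v \<in> borel_measurable (lebesgue_on S)"
  using borel_measurable_continuous_onI[OF assms]
  by (intro measurable_restrict_space1 measurable_completion) simp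

lemma continuous_imp_L2_space:
  fixes v :: "'a::euclidean_space \<Rightarrow> 'b::euclidean_space"
  assumes v: "continuous_on UNIV v" and S: "S \<in> sets lebesgue" "bounded S"
  shows "v \<in> L2_space (lebesgue_on S)"
proof -
  have "compact (v ` closure S)"
    using S v by (intro compact_continuous_image) (auto simp: compact_closure intro: continuous_on_subset)
  then obtain B where B: "\<And>x. x \<in> closure S \<Longrightarrow> norm (v x) \<le> B"
    by (meson bounded_iff compact_imp_bounded image_eqI)
  have "norm (v x) \<le> max B 0" if "x \<in> S" for x
    using B[of x] that closure_subset[of S] by auto
  then show ?thesis
    using S v measurable_continuous_lebesgue_on[OF v]
    by (intro bounded_imp_L2_space(1)[of _ _ "max B 0"]) (auto simp: bounded_set_imp_lmeasurable)
qed

section \<open>Weak gradients\<close>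

lemma C_1_D:
  assumes "C_k (Suc 0) \<phi>"
  shows "\<phi> differentiable (at x)" "continuous_on UNIV \<phi>" "continuous_on UNIV (gradient \<phi>)"
proof -
  show d: "\<phi> differentiable (at x)" for x using assms by simp
  show "continuous_on UNIV \<phi>" using C_k_Suc_D[OF assms] by simp
  have "continuous_on UNIV (\<lambda>x. \<chi> i. gradient \<phi> x $ i)"
    using assms by (intro continuous_on_vec_lambda) simp
  then show "continuous_on UNIV (gradient \<phi>)" by simp
qed

lemma gradient_eq_0_off_closed:
  assumes "closed K" "\<And>x. x \<notin> K \<Longrightarrow> \<phi> x = 0" "x \<notin> K"
  shows "gradient \<phi> x = 0"
proof (rule gradient_eq)
  have "((\<lambda>_. 0) has_derivative (\<lambda>h. 0 \<bullet> h)) (at x)" by simp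
  then show "(\<phi> has_derivative (\<lambda>h. 0 \<bullet> h)) (at x)"
    by (rule has_derivative_transform_within_open[where s = "- K"]) (use assms in auto)
qed

lemma integrable_compact_support:
  fixes f :: "'a::euclidean_space \<Rightarrow> real"
  assumes "continuous_on UNIV f" "\<And>x. x \<notin> cball 0 R \<Longrightarrow> f x = 0"
  shows "integrable lborel f"
proof -
  have "integrable lborel (\<lambda>x. indicator (cball 0 R) x *\<^sub>R f x)"
    using assms(1) by (intro borel_integrable_compact) (auto intro: continuous_on_subset)
  also have "(\<lambda>x. indicator (cball 0 R) x *\<^sub>R f x) = f"
    using assms(2) by (auto simp: indicator_def fun_eq_iff)
  finally show ?thesis .
qed

lemma
  fixes f :: "'a::euclidean_space \<Rightarrow> real"
  assumes "integrable lborel f"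
  shows integrable_translate: "integrable lborel (\<lambda>x. f (x + a))"
    and integral_translate: "(\<integral>x. f (x + a) \<partial>lborel) = (\<integral>x. f x \<partial>lborel)"
proof -
  have "f \<in> borel_measurable borel" using assms by auto
  moreover have "distr lborel borel ((+) a) = (lborel :: 'a measure)" by (rule lborel_distr_plus)
  ultimately show "integrable lborel (\<lambda>x. f (x + a))" "(\<integral>x. f (x + a) \<partial>lborel) = (\<integral>x. f x \<partial>lborel)"
    using integrable_distr_eq[of "(+) a" lborel borel f] integral_distr[of "(+) a" lborel borel f] assms
    by (auto simp: add.commute)
qed

text \<open>
  The difference quotients of \<open>\<phi>\<close> in a fixed direction have integral \<open>0\<close> by translation
  invariance, and they converge boundedly.  This gives the divergence theorem for compactly
  supported functions without iterated integrals.
\<close>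

lemma integral_gradient_eq_0:
  assumes \<phi>: "C_k (Suc 0) \<phi>" and R: "\<And>x. x \<notin> cball 0 R \<Longrightarrow> \<phi> x = 0"
  shows "(\<integral>x. gradient \<phi> x $ i \<partial>lborel) = 0"
proof -
  define e :: "real^2" where "e = axis i 1"
  have e: "norm e = 1" by (simp add: e_def)
  note d = C_1_D(1)[OF \<phi>] and c = C_1_D(2,3)[OF \<phi>]
  have g0: "gradient \<phi> x = 0" if "x \<notin> cball 0 R" for x
    by (rule gradient_eq_0_off_closed[of "cball 0 R"]) (use R that in auto)
  have "compact (gradient \<phi> ` cball 0 R)"
    using c by (intro compact_continuous_image) (auto intro: continuous_on_subset)
  then obtain B0 where B0: "\<And>x. x \<in> cball 0 R \<Longrightarrow> norm (gradient \<phi> x) \<le> B0"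
    by (meson bounded_iff compact_imp_bounded image_eqI)
  define B where "B = max B0 0"
  have B: "norm (gradient \<phi> x) \<le> B" for x
    using B0[of x] g0[of x] by (cases "x \<in> cball 0 R") (auto simp: B_def)
  have lip: "norm (\<phi> y - \<phi> x) \<le> B * norm (y - x)" for x y
  proof (rule differentiable_bound[where S = UNIV])
    show "onorm ((\<bullet>) (gradient \<phi> z)) \<le> B" for z
    proof (rule onorm_le)
      fix h show "norm (gradient \<phi> z \<bullet> h) \<le> B * norm h"
        using Cauchy_Schwarz_ineq2[of "gradient \<phi> z" h] mult_right_mono[OF B[of z], of "norm h"]
        by simp
    qed
  qed (use has_derivative_gradient[OF d] in auto)
  define h :: "nat \<Rightarrow> real" where "h n = 1 / real (Suc n)" for n
  have h: "0 < h n" "h n \<le> 1" for n by (simp_all add: h_def)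
  have h0: "filterlim h (at 0) sequentially"
    unfolding h_def using LIMSEQ_inverse_real_of_nat
    by (intro filterlim_atI) (auto simp: inverse_eq_divide)
  define s where "s n x = (\<phi> (x + h n *\<^sub>R e) - \<phi> x) / h n" for n x
  have \<phi>i: "integrable lborel \<phi>" using integrable_compact_support[OF c(1) R] .
  have s0: "(\<integral>x. s n x \<partial>lborel) = 0" for n
    unfolding s_def using integrable_translate[OF \<phi>i, of "h n *\<^sub>R e"] integral_translate[OF \<phi>i, of "h n *\<^sub>R e"] \<phi>i
    by simp
  have "(\<lambda>n. \<integral>x. s n x \<partial>lborel) \<longlonglongrightarrow> (\<integral>x. gradient \<phi> x $ i \<partial>lborel)"
  proof (rule integral_dominated_convergence[where w = "\<lambda>x. indicator (cball 0 (R + 1)) x * B"])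
    show "(\<lambda>x. gradient \<phi> x $ i) \<in> borel_measurable lborel"
      using \<phi> by (auto intro: borel_measurable_continuous_onI)
    show "s n \<in> borel_measurable lborel" for n
      unfolding s_def using \<phi>i integrable_translate[OF \<phi>i] by (auto intro!: borel_measurable_divide borel_measurable_diff)
    show "integrable lborel (\<lambda>x. indicator (cball 0 (R + 1)) x * B)"
      using borel_integrable_compact[of "cball 0 (R + 1)" "\<lambda>x. B"] by auto
    show "AE x in lborel. (\<lambda>n. s n x) \<longlonglongrightarrow> gradient \<phi> x $ i"
    proof (rule AE_I2)
      fix x
      have "((\<lambda>t. \<phi> (x + t *\<^sub>R e)) has_field_derivative gradient \<phi> x \<bullet> e) (at 0)"
      proof -
        have 1: "((\<lambda>t::real. x + t *\<^sub>R e) has_derivative (\<lambda>t. t *\<^sub>R e)) (at 0)"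
          by (auto intro!: derivative_eq_intros)
        have 2: "(\<phi> has_derivative (\<lambda>h. gradient \<phi> x \<bullet> h)) (at (x + 0 *\<^sub>R e))"
          using has_derivative_gradient[OF d[of x]] by simp
        show ?thesis using has_derivative_compose[OF 1 2]
          by (simp add: has_field_derivative_def mult_commute_abs)
      qed
      then have "((\<lambda>t. (\<phi> (x + t *\<^sub>R e) - \<phi> x) / t) \<longlongrightarrow> gradient \<phi> x \<bullet> e) (at 0)"
        by (simp add: DERIV_def)
      from filterlim_compose[OF this h0] show "(\<lambda>n. s n x) \<longlonglongrightarrow> gradient \<phi> x $ i"
        by (simp add: s_def e_def inner_axis)
    qed
    show "AE x in lborel. norm (s n x) \<le> indicator (cball 0 (R + 1)) x * B" for n
    proof (rule AE_I2)
      fix x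
      show "norm (s n x) \<le> indicator (cball 0 (R + 1)) x * B"
      proof (cases "x \<in> cball 0 (R + 1)")
        case True
        have "norm (s n x) \<le> B * norm (h n *\<^sub>R e) / h n"
          unfolding s_def using lip[of "x + h n *\<^sub>R e" x] h[of n]
          by (simp add: divide_right_mono del: norm_scaleR)
        then show ?thesis using True h[of n] e by simp
      next
        case False
        then have x: "norm x > R + 1" by simp
        have "norm x \<le> norm (x + h n *\<^sub>R e) + norm (h n *\<^sub>R e)"
          using norm_triangle_ineq4[of "x + h n *\<^sub>R e" "h n *\<^sub>R e"] by simp
        then have "norm (x + h n *\<^sub>R e) > R" using x h[of n] e by simp
        then show ?thesis using R[of x] R[of "x + h n *\<^sub>R e"] x False by (simp add: s_def)
      qed
    qed
  qed
  then show ?thesis using s0 by (simp add: LIMSEQ_const_iff)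
qed

lemma test_functionsD:
  assumes "\<psi> \<in> test_functions \<Omega>"
  shows "C_k k \<psi>" "\<psi> differentiable (at x)" "x \<notin> \<Omega> \<Longrightarrow> \<psi> x = 0" "x \<notin> \<Omega> \<Longrightarrow> gradient \<psi> x = 0"
    "\<exists>R. \<forall>x. x \<notin> cball 0 R \<longrightarrow> \<psi> x = 0 \<and> gradient \<psi> x = 0"
proof -
  let ?K = "closure {x. \<psi> x \<noteq> 0}"
  have K: "compact ?K" "?K \<subseteq> \<Omega>" and C: "\<And>k. C_k k \<psi>" using assms by (auto simp: test_functions_def)
  have z: "\<psi> x = 0" if "x \<notin> ?K" for x using that closure_subset[of "{x. \<psi> x \<noteq> 0}"] by auto
  show "C_k k \<psi>" by (rule C)
  show "\<psi> differentiable (at x)" by (rule C_1_D(1)[OF C])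
  show "\<psi> x = 0" if "x \<notin> \<Omega>" using z that K by blast
  show "gradient \<psi> x = 0" if "x \<notin> \<Omega>"
    by (rule gradient_eq_0_off_closed[OF closed_closure z]) (use that K(2) in blast)+
  obtain R where R: "?K \<subseteq> cball 0 R"
    using bounded_subset_ballD[OF compact_imp_bounded[OF K(1)], of 0] ball_subset_cball by blast
  have "gradient \<psi> x = 0" if "x \<notin> ?K" for x by (rule gradient_eq_0_off_closed[OF closed_closure z that])
  then have "\<psi> x = 0" "gradient \<psi> x = 0" if "x \<notin> cball 0 R" for x using z R that by blast+
  then show "\<exists>R. \<forall>x. x \<notin> cball 0 R \<longrightarrow> \<psi> x = 0 \<and> gradient \<psi> x = 0" by blast
qed

lemma test_functions_mono: "\<omega> \<subseteq> \<Omega> \<Longrightarrow> test_functions \<omega> \<subseteq> test_functions \<Omega>"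
  by (auto simp: test_functions_def)

lemma test_functions_mult:
  assumes "\<psi> \<in> test_functions \<Omega>" "\<And>k. C_k k \<phi>"
  shows "(\<lambda>x. \<psi> x * \<phi> x) \<in> test_functions \<Omega>"
proof -
  have "closure {x. \<psi> x * \<phi> x \<noteq> 0} \<subseteq> closure {x. \<psi> x \<noteq> 0}" by (intro closure_mono) auto
  moreover from this have "compact (closure {x. \<psi> x * \<phi> x \<noteq> 0})"
    using assms(1) bounded_subset by (auto simp: test_functions_def compact_eq_bounded_closed)
  ultimately show ?thesis
    using assms C_k_mult unfolding test_functions_def by blast
qed

lemma test_functions_scale: "\<psi> \<in> test_functions \<Omega> \<Longrightarrow> (\<lambda>x. c * \<psi> x) \<in> test_functions \<Omega>"
  using test_functions_mult[of \<psi> \<Omega> "\<lambda>x. c"] by (simp add: mult.commute)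

text \<open>
  Integration by parts is obtained on the whole plane; this transfers it to a set that carries the
  integrands.
\<close>

lemma
  fixes f :: "'a::euclidean_space \<Rightarrow> real"
  assumes f: "integrable lborel f" and S: "S \<in> sets lebesgue" "\<And>x. x \<notin> S \<Longrightarrow> f x = 0"
  shows integrable_lborel_on: "integrable (lebesgue_on S) f"
    and integral_lborel_on: "(\<integral>x. f x \<partial>lebesgue_on S) = (\<integral>x. f x \<partial>lborel)"
proof -
  have e: "(\<lambda>x. if x \<in> S then f x else 0) = f" "(\<lambda>x. indicator S x *\<^sub>R f x) = f"
    using S(2) by (auto simp: fun_eq_iff indicator_def)
  have fl: "f \<in> borel_measurable lborel" using f by auto
  have "integrable lebesgue f" using f fl by (simp add: integrable_completion)
  then show "integrable (lebesgue_on S) f"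
    using S e(2) by (subst integrable_restrict_space) auto
  show "(\<integral>x. f x \<partial>lebesgue_on S) = (\<integral>x. f x \<partial>lborel)"
    using Lebesgue_Measure.integral_restrict_UNIV[OF S(1), of f] integral_completion[OF fl] e(1) by simp
qed

text \<open>
  The integral of the gradient of the product, which has compact support, vanishes.
\<close>

lemma integral_by_parts:
  assumes \<phi>: "C_k (Suc 0) \<phi>" and \<psi>: "\<psi> \<in> test_functions \<Omega>" and \<Omega>: "\<Omega> \<in> sets lebesgue"
  shows "(\<integral>x. \<phi> x * gradient \<psi> x $ i \<partial>lebesgue_on \<Omega>) = - (\<integral>x. gradient \<phi> x $ i * \<psi> x \<partial>lebesgue_on \<Omega>)"
proof -
  obtain R where R: "\<And>x. x \<notin> cball 0 R \<Longrightarrow> \<psi> x = 0"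
    and gR: "\<And>x. x \<notin> cball 0 R \<Longrightarrow> gradient \<psi> x = 0" using test_functionsD(5)[OF \<psi>] by blast
  note p = C_1_D[OF \<phi>] C_1_D[OF test_functionsD(1)[OF \<psi>]]
  have i1: "integrable lborel (\<lambda>x. \<phi> x * gradient \<psi> x $ i)"
    by (rule integrable_compact_support[of _ R]) (use p gR in \<open>auto intro!: continuous_intros\<close>)
  have i2: "integrable lborel (\<lambda>x. gradient \<phi> x $ i * \<psi> x)"
    by (rule integrable_compact_support[of _ R]) (use p R in \<open>auto intro!: continuous_intros\<close>)
  have "(\<integral>x. gradient (\<lambda>x. \<phi> x * \<psi> x) x $ i \<partial>lborel) = 0"
    using C_k_mult[OF \<phi> test_functionsD(1)[OF \<psi>]] R by (intro integral_gradient_eq_0[of _ R]) auto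
  also have "(\<lambda>x. gradient (\<lambda>x. \<phi> x * \<psi> x) x $ i) = (\<lambda>x. \<phi> x * gradient \<psi> x $ i + gradient \<phi> x $ i * \<psi> x)"
    using p by (simp add: gradient_mult mult.commute)
  finally have "(\<integral>x. \<phi> x * gradient \<psi> x $ i \<partial>lborel) = - (\<integral>x. gradient \<phi> x $ i * \<psi> x \<partial>lborel)"
    using i1 i2 by simp
  then show ?thesis
    using test_functionsD(3,4)[OF \<psi>] by (simp add: integral_lborel_on[OF i1 \<Omega>] integral_lborel_on[OF i2 \<Omega>])
qed

lemma has_weak_gradient_C_1:
  assumes "C_k (Suc 0) \<phi>" "bounded \<omega>" "\<omega> \<in> sets lebesgue"
  shows "has_weak_gradient \<omega> \<phi> (gradient \<phi>)"
  using C_1_D[OF assms(1)] assms integral_by_parts[OF assms(1)]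
  by (auto simp: has_weak_gradient_def intro!: continuous_imp_L2_space)

lemma has_weak_gradientD:
  assumes "has_weak_gradient \<Omega> v G"
  shows "v \<in> L2_space (lebesgue_on \<Omega>)" "G \<in> L2_space (lebesgue_on \<Omega>)"
    "\<psi> \<in> test_functions \<Omega> \<Longrightarrow>
      (\<integral>x. v x * gradient \<psi> x $ i \<partial>lebesgue_on \<Omega>) = - (\<integral>x. G x $ i * \<psi> x \<partial>lebesgue_on \<Omega>)"
  using assms by (auto simp: has_weak_gradient_def)

lemma has_weak_gradient_cong:
  assumes v: "has_weak_gradient \<Omega> v G" and eq: "\<And>x. x \<in> \<Omega> \<Longrightarrow> v x = w x" and \<Omega>: "\<Omega> \<in> sets lebesgue"
  shows "has_weak_gradient \<Omega> w G"
  unfolding has_weak_gradient_def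
proof (intro conjI ballI allI)
  show "w \<in> L2_space (lebesgue_on \<Omega>)"
    by (rule L2_space_cong_AE_lebesgue[OF has_weak_gradientD(1)[OF v] \<Omega>]) (rule AE_I2, simp add: eq)
  fix \<psi> i assume \<psi>: "\<psi> \<in> test_functions \<Omega>"
  have "(\<integral>x. w x * gradient \<psi> x $ i \<partial>lebesgue_on \<Omega>) = (\<integral>x. v x * gradient \<psi> x $ i \<partial>lebesgue_on \<Omega>)"
    by (rule Bochner_Integration.integral_cong) (simp_all add: eq)
  then show "(\<integral>x. w x * gradient \<psi> x $ i \<partial>lebesgue_on \<Omega>) = - (\<integral>x. G x $ i * \<psi> x \<partial>lebesgue_on \<Omega>)"
    using has_weak_gradientD(3)[OF v \<psi>] by simp
qed (rule has_weak_gradientD(2)[OF v])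

lemma has_weak_gradient_affine:
  assumes "bounded A" "A \<in> sets lebesgue" and v: "\<And>x. x \<in> A \<Longrightarrow> v x = \<alpha> + q \<bullet> x"
  shows "has_weak_gradient A v (\<lambda>_. q)"
proof (rule has_weak_gradient_cong)
  have "gradient (\<lambda>x. \<alpha> + q \<bullet> x) = (\<lambda>_. q)" by (rule ext) (rule gradient_affine)
  then show "has_weak_gradient A (\<lambda>x. \<alpha> + q \<bullet> x) (\<lambda>_. q)"
    using has_weak_gradient_C_1[OF C_k_affine assms(1,2), of \<alpha> q] by (simp only:)
qed (use v assms(2) in auto)

section \<open>Uniqueness of the weak gradient\<close>

text \<open>
  The sets over which the integral of \<open>h\<close> vanishes form a Dynkin system that contains the boxes.
\<close>

lemma AE_eq_0_of_box_integrals: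
  fixes h :: "real^2 \<Rightarrow> real"
  assumes h: "integrable lborel h" and box: "\<And>a b. (\<integral>x. indicator (box a b) x * h x \<partial>lborel) = 0"
  shows "AE x in lborel. h x = 0"
proof (rule sigma_finite_measure.density_zero)
  show "sigma_finite_measure (lborel :: (real^2) measure)" by (rule sigma_finite_lborel)
  have hm[measurable]: "h \<in> borel_measurable borel" using h by auto
  have int: "integrable lborel (\<lambda>x. indicator A x * h x)" if "A \<in> sets borel" for A
    using integrable_mult_indicator[OF _ h, of A] that by simp
  fix A :: "(real^2) set" assume "A \<in> sets lborel"
  then have A: "A \<in> sigma_sets UNIV (range (\<lambda>(a, b). box a b))"
    by (simp add: borel_eq_box)
  have tot: "(\<integral>x. h x \<partial>lborel) = 0"
  proof -
    have "(\<lambda>n. \<integral>x. indicator (box (- (\<chi> i. real n)) (\<chi> i. real n)) x * h x \<partial>lborel) \<longlonglongrightarrow> (\<integral>x. h x \<partial>lborel)"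
    proof (rule integral_dominated_convergence[where w = "\<lambda>x. norm (h x)"])
      show "AE x in lborel. (\<lambda>n. indicator (box (- (\<chi> i. real n)) (\<chi> i. real n)) x * h x) \<longlonglongrightarrow> h x"
      proof (rule AE_I2)
        fix x :: "real^2"
        obtain N where N: "norm x < real N" using reals_Archimedean2 by blast
        have "eventually (\<lambda>n. indicator (box (- (\<chi> i. real n)) (\<chi> i. real n)) x * h x = h x) sequentially"
        proof (rule eventually_sequentiallyI)
          fix n assume "N \<le> n"
          then have "\<bar>x $ i\<bar> < real n" for i
            using N component_le_norm_cart[of x i] by (meson le_less_trans less_le_trans of_nat_le_iff)
          then have "x \<in> box (- (\<chi> i. real n)) (\<chi> i. real n)"
            by (auto simp: mem_box_cart abs_less_iff minus_less_iff)
          then show "indicator (box (- (\<chi> i. real n)) (\<chi> i. real n)) x * h x = h x" by simp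
        qed
        then show "(\<lambda>n. indicator (box (- (\<chi> i. real n)) (\<chi> i. real n)) x * h x) \<longlonglongrightarrow> h x"
          by (rule tendsto_eventually)
      qed
    qed (use h in \<open>auto simp: indicator_def\<close>)
    then show ?thesis by (simp add: box LIMSEQ_const_iff)
  qed
  have "Int_stable (range (\<lambda>(a, b). box a b :: (real^2) set))"
    by (auto simp: Int_stable_def box_Int_box)
  moreover have "range (\<lambda>(a, b). box a b :: (real^2) set) \<subseteq> Pow UNIV" by simp
  ultimately have "(\<integral>x. indicator A x * h x \<partial>lborel) = 0"
    using A
  proof (induction rule: sigma_sets_induct_disjoint)
    case (compl A)
    then have A: "A \<in> sets borel" by (simp add: borel_eq_box)
    have "(\<integral>x. indicator (UNIV - A) x * h x \<partial>lborel) = (\<integral>x. h x - indicator A x * h x \<partial>lborel)"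
      by (rule Bochner_Integration.integral_cong) (auto simp: indicator_def)
    also have "\<dots> = 0" using h int[OF A] tot compl by simp
    finally show ?case .
  next
    case (union F)
    then have F: "F i \<in> sets borel" for i by (auto simp: borel_eq_box)
    have "set_lebesgue_integral lborel (\<Union>i. F i) h = (\<Sum>i. set_lebesgue_integral lborel (F i) h)"
    proof (rule lebesgue_integral_countable_add)
      show "set_integrable lborel (\<Union>i. F i) h"
        using int[of "\<Union>i. F i"] F by (auto simp: set_integrable_def)
    qed (use F union(1) in \<open>auto simp: disjoint_family_on_def\<close>)
    then show ?case using union by (simp add: set_lebesgue_integral_def)
  qed (use box in auto)
  then show "set_lebesgue_integral lborel A h = 0" by (simp add: set_lebesgue_integral_def)
qed (use assms in auto)

text \<open>
  Replacing \<open>h\<close> by a Borel function that agrees with it almost everywhere.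
\<close>

lemma AE_eq_0_of_box_integrals_lebesgue:
  fixes h :: "real^2 \<Rightarrow> real"
  assumes h: "integrable lebesgue h" and box: "\<And>a b. (\<integral>x. indicator (box a b) x * h x \<partial>lebesgue) = 0"
  shows "AE x in lebesgue. h x = 0"
proof -
  have "h \<in> borel_measurable (completion lborel)" using h by auto
  from completion_ex_borel_measurable_real[OF this]
  obtain h' where h': "h' \<in> borel_measurable lborel" "AE x in lborel. h x = h' x" by auto
  then have AE: "AE x in lebesgue. h x = h' x" by (auto intro: AE_completion)
  have m: "h' \<in> borel_measurable lebesgue" using h'(1) by (rule measurable_completion)
  have "integrable lebesgue h'" by (rule integrable_cong_AE_imp[OF h m AE])
  then have 1: "integrable lborel h'" using h'(1) by (simp add: integrable_completion)
  have 2: "(\<integral>x. indicator (box a b) x * h' x \<partial>lborel) = 0" for a b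
  proof -
    have bm: "indicator (box a b) \<in> borel_measurable (lebesgue :: (real^2) measure)"
      by (intro borel_measurable_indicator) auto
    have "(\<lambda>x. indicator (box a b) x * h' x) \<in> borel_measurable lborel" using h'(1) by measurable
    from integral_completion[OF this]
    have "(\<integral>x. indicator (box a b) x * h' x \<partial>lborel) = (\<integral>x. indicator (box a b) x * h' x \<partial>lebesgue)" by simp
    also have "\<dots> = (\<integral>x. indicator (box a b) x * h x \<partial>lebesgue)"
    proof (rule integral_cong_AE)
      show "AE x in lebesgue. indicator (box a b) x * h' x = indicator (box a b) x * h x"
        using AE by (rule eventually_mono) simp
    qed (use h m bm in \<open>auto intro!: borel_measurable_times\<close>)
    finally show ?thesis by (simp add: box)
  qed
  have "AE x in lborel. h' x = 0" by (rule AE_eq_0_of_box_integrals[OF 1 2])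
  then have "AE x in lebesgue. h' x = 0" by (rule AE_completion)
  with AE show ?thesis by eventually_elim simp
qed

text \<open>
  A smooth approximation of the indicator function of a box: each of the four factors sees the
  distance to one side, magnified by \<open>n\<close>.  The arguments are written as a constant plus an inner
  product, the form in which affine functions are known to be smooth.
\<close>

definition smooth_box :: "real^2 \<Rightarrow> real^2 \<Rightarrow> nat \<Rightarrow> real^2 \<Rightarrow> real" where
  "smooth_box a b n x =
     (flat 1 (- (real n * a $ 1) + (real n *\<^sub>R axis 1 1) \<bullet> x) * flat 1 (real n * b $ 1 + (- real n *\<^sub>R axis 1 1) \<bullet> x)) *
     (flat 1 (- (real n * a $ 2) + (real n *\<^sub>R axis 2 1) \<bullet> x) * flat 1 (real n * b $ 2 + (- real n *\<^sub>R axis 2 1) \<bullet> x))"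

lemma C_k_smooth_box: "C_k k (smooth_box a b n)"
  unfolding smooth_box_def [abs_def] by (intro C_k_mult C_k_flat C_k_affine)

lemma flat_1_bounds: "0 \<le> flat 1 t" "flat 1 t \<le> 1"
  by (auto simp: flat_def)

lemma flat_1_tendsto: "(\<lambda>n. flat 1 (real n * t)) \<longlonglongrightarrow> (if t > 0 then 1 else 0)"
proof (cases "t > 0")
  case True
  have "filterlim (\<lambda>n. real n * t) at_top sequentially"
    using True by (intro filterlim_at_top_mult_tendsto_pos[OF tendsto_const _ filterlim_real_sequentially]
        filterlim_tendsto_pos_mult_at_top) (auto simp: mult.commute)
  then have "(\<lambda>n. 1 / (real n * t)) \<longlonglongrightarrow> 0"
    by (auto intro!: tendsto_divide_0[OF tendsto_const] filterlim_at_top_imp_at_infinity)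
  then have "(\<lambda>n. exp (- (1 / (real n * t)))) \<longlonglongrightarrow> exp (- 0)" by (intro tendsto_exp tendsto_minus)
  moreover have "eventually (\<lambda>n. exp (- (1 / (real n * t))) = flat 1 (real n * t)) sequentially"
    using eventually_gt_at_top[of "0::nat"] by eventually_elim (use True in \<open>auto simp: flat_def mult_le_0_iff\<close>)
  ultimately show ?thesis using True by (auto intro: Lim_transform_eventually)
next
  case False
  then have "flat 1 (real n * t) = 0" for n by (auto simp: flat_def mult_le_0_iff)
  then show ?thesis using False by simp
qed

lemma smooth_box_tendsto: "(\<lambda>n. smooth_box a b n x) \<longlonglongrightarrow> indicator (box a b) x"
proof -
  have eq: "smooth_box a b n x = (flat 1 (real n * (x $ 1 - a $ 1)) * flat 1 (real n * (b $ 1 - x $ 1))) *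
      (flat 1 (real n * (x $ 2 - a $ 2)) * flat 1 (real n * (b $ 2 - x $ 2)))" for n
    by (simp add: smooth_box_def inner_axis' algebra_simps)
  have "(\<lambda>n. smooth_box a b n x) \<longlonglongrightarrow>
      ((if x $ 1 - a $ 1 > 0 then 1 else 0) * (if b $ 1 - x $ 1 > 0 then 1 else 0)) *
      ((if x $ 2 - a $ 2 > 0 then 1 else 0) * (if b $ 2 - x $ 2 > 0 then 1 else 0))"
    unfolding eq by (intro tendsto_mult flat_1_tendsto)
  then show ?thesis by (simp add: indicator_def mem_box_cart forall_2 split: if_splits)
qed

lemma smooth_box_bound: "\<bar>smooth_box a b n x\<bar> \<le> 1"
  unfolding smooth_box_def abs_mult
  by (intro mult_le_one mult_nonneg_nonneg) (auto simp: abs_of_nonneg flat_1_bounds)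

text \<open>
  Fundamental lemma of the calculus of variations.  Multiplied by a bump, \<open>g\<close> can be tested with all
  smooth functions, with or without compact support, in particular with those that converge to the
  indicator function of a box.  Hence \<open>g\<close> times the bump vanishes almost everywhere, and the bump is
  positive on its disc.  Countably many such discs cover \<open>\<omega>\<close>.
\<close>

lemma AE_eq_0_of_test_functions:
  assumes \<omega>: "open \<omega>" and g: "g \<in> L2_space (lebesgue_on \<omega>)"
    and test: "\<And>\<phi>. \<phi> \<in> test_functions \<omega> \<Longrightarrow> (\<integral>x. g x * \<phi> x \<partial>lebesgue_on \<omega>) = 0"
  shows "AE x in lebesgue_on \<omega>. g x = 0"
proof -
  have \<omega>m: "\<omega> \<in> sets lebesgue" using \<omega> by auto
  have ball: "AE x in lebesgue. x \<in> ball c \<rho> \<longrightarrow> g x = 0" if \<rho>: "0 < \<rho>" "cball c \<rho> \<subseteq> \<omega>" for c \<rho>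
  proof -
    let ?S = "cball c \<rho>"
    have Sm: "?S \<in> sets lebesgue" by auto
    define k where "k x = (if x \<in> ?S then g x * bump c \<rho> x else 0)" for x
    have bS: "bump c \<rho> \<in> L2_space (lebesgue_on ?S)"
      using C_1_D(2)[OF C_k_bump] by (intro continuous_imp_L2_space) auto
    have "integrable (lebesgue_on ?S) (\<lambda>x. g x \<bullet> bump c \<rho> x)"
      by (rule integrable_L2_inner[OF L2_space_subset[OF g Sm \<omega>m \<rho>(2)] bS])
    then have "integrable lebesgue (\<lambda>x. indicator ?S x *\<^sub>R (g x * bump c \<rho> x))"
      using Sm by (simp add: integrable_restrict_space)
    also have "(\<lambda>x. indicator ?S x *\<^sub>R (g x * bump c \<rho> x)) = k"
      by (auto simp: k_def fun_eq_iff indicator_def)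
    finally have k: "integrable lebesgue k" .
    have km: "k \<in> borel_measurable lebesgue" using k by auto
    have smooth: "(\<integral>x. k x * \<eta> x \<partial>lebesgue) = 0" if "\<And>k. C_k k \<eta>" for \<eta>
    proof -
      have b0: "bump c \<rho> x = 0" if "x \<notin> ?S" for x
        using that bump_eq_0_iff[OF \<rho>(1), of c x] by auto
      have "(\<lambda>x. k x * \<eta> x) = (\<lambda>x. if x \<in> \<omega> then g x * (bump c \<rho> x * \<eta> x) else 0)"
        using \<rho>(2) b0 by (auto simp: k_def fun_eq_iff)
      then have "(\<integral>x. k x * \<eta> x \<partial>lebesgue) = (\<integral>x. g x * (bump c \<rho> x * \<eta> x) \<partial>lebesgue_on \<omega>)"
        using Lebesgue_Measure.integral_restrict_UNIV[OF \<omega>m, of "\<lambda>x. g x * (bump c \<rho> x * \<eta> x)"] by simp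
      also have "\<dots> = 0" by (rule test[OF bump_times_in_test_functions[OF \<rho> that]])
      finally show ?thesis .
    qed
    have box: "(\<integral>x. indicator (box a b) x * k x \<partial>lebesgue) = 0" for a b
    proof -
      have "(\<lambda>n. \<integral>x. k x * smooth_box a b n x \<partial>lebesgue) \<longlonglongrightarrow> (\<integral>x. k x * indicator (box a b) x \<partial>lebesgue)"
      proof (rule integral_dominated_convergence[where w = "\<lambda>x. norm (k x)"])
        show "(\<lambda>x. k x * smooth_box a b n x) \<in> borel_measurable lebesgue" for n
          using km measurable_continuous_lebesgue_on[OF C_1_D(2)[OF C_k_smooth_box], where S = UNIV]
          by (auto simp: lebesgue_on_UNIV_eq)
        show "(\<lambda>x. k x * indicator (box a b) x) \<in> borel_measurable lebesgue"
          by (intro borel_measurable_times km borel_measurable_indicator) auto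
        show "AE x in lebesgue. (\<lambda>n. k x * smooth_box a b n x) \<longlonglongrightarrow> k x * indicator (box a b) x"
          by (intro AE_I2 tendsto_mult tendsto_const smooth_box_tendsto)
        show "AE x in lebesgue. norm (k x * smooth_box a b n x) \<le> norm (k x)" for n
          using smooth_box_bound[of a b n] by (intro AE_I2) (simp add: abs_mult mult_left_le)
      qed (use k in auto)
      then show ?thesis by (simp add: smooth C_k_smooth_box LIMSEQ_const_iff mult.commute)
    qed
    have "AE x in lebesgue. k x = 0" by (rule AE_eq_0_of_box_integrals_lebesgue[OF k box])
    then show ?thesis
      by (rule eventually_mono) (use bump_eq_0_iff[OF \<rho>(1)] in \<open>auto simp: k_def\<close>)
  qed
  define F where "F = {ball c \<rho> | c \<rho>. 0 < \<rho> \<and> cball c \<rho> \<subseteq> \<omega>}"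
  obtain F' where F': "F' \<subseteq> F" "countable F'" "\<Union>F' = \<Union>F"
    using Lindelof[of F] by (auto simp: F_def)
  have "\<omega> \<subseteq> \<Union>F"
  proof
    fix x assume "x \<in> \<omega>"
    then obtain e where "0 < e" "cball x e \<subseteq> \<omega>" using \<omega> open_contains_cball by blast
    then have "ball x e \<in> F" "x \<in> ball x e" unfolding F_def by (blast, simp)
    then show "x \<in> \<Union>F" by blast
  qed
  have "AE x in lebesgue. \<forall>B\<in>F'. x \<in> B \<longrightarrow> g x = 0"
  proof (subst AE_ball_countable[OF F'(2)], intro ballI)
    fix B assume "B \<in> F'"
    then have "B \<in> F" using F'(1) by blast
    then show "AE x in lebesgue. x \<in> B \<longrightarrow> g x = 0"
      unfolding F_def mem_Collect_eq by (elim exE conjE) (simp only: ball)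
  qed
  then have "AE x in lebesgue. x \<in> \<omega> \<longrightarrow> g x = 0"
  proof (rule eventually_mono, intro impI)
    fix x assume x: "\<forall>B\<in>F'. x \<in> B \<longrightarrow> g x = 0" "x \<in> \<omega>"
    have "x \<in> \<Union>F'" using x(2) \<open>\<omega> \<subseteq> \<Union>F\<close> unfolding F'(3) by (rule rev_subsetD)
    then show "g x = 0" using x(1) by blast
  qed
  moreover have "\<omega> \<inter> space lebesgue \<in> sets lebesgue" using \<omega>m by simp
  ultimately show ?thesis using AE_restrict_space_iff by blast
qed

lemma test_function_L2:
  assumes "\<psi> \<in> test_functions \<Omega>" "S \<in> sets lebesgue"
  shows "\<psi> \<in> L2_space (lebesgue_on S)" "gradient \<psi> \<in> L2_space (lebesgue_on S)"
proof -
  obtain R where R: "\<And>x. x \<notin> cball 0 R \<Longrightarrow> \<psi> x = 0"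
    and gR: "\<And>x. x \<notin> cball 0 R \<Longrightarrow> gradient \<psi> x = 0" using test_functionsD(5)[OF assms(1)] by blast
  let ?K = "cball (0::real^2) R"
  note c = C_1_D(2,3)[OF test_functionsD(1)[OF assms(1)]]
  have e: "(\<lambda>x. if x \<in> ?K then \<psi> x else 0) = \<psi>" "(\<lambda>x. if x \<in> ?K then gradient \<psi> x else 0) = gradient \<psi>"
    using R gR by (auto simp: fun_eq_iff)
  have "\<psi> \<in> L2_space (lebesgue_on UNIV)"
    using L2_space_extend[OF continuous_imp_L2_space[OF c(1), of ?K], of UNIV] unfolding e(1) by simp
  then show "\<psi> \<in> L2_space (lebesgue_on S)" by (rule L2_space_subset) (use assms(2) in auto)
  have "gradient \<psi> \<in> L2_space (lebesgue_on UNIV)"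
    using L2_space_extend[OF continuous_imp_L2_space[OF c(2), of ?K], of UNIV] unfolding e(2) by simp
  then show "gradient \<psi> \<in> L2_space (lebesgue_on S)" by (rule L2_space_subset) (use assms(2) in auto)
qed

lemma integrable_weak_gradient:
  assumes "has_weak_gradient \<Omega> v G" "\<psi> \<in> test_functions \<Omega>" "\<Omega> \<in> sets lebesgue"
  shows "integrable (lebesgue_on \<Omega>) (\<lambda>x. v x * gradient \<psi> x $ i)"
    "integrable (lebesgue_on \<Omega>) (\<lambda>x. G x $ i * \<psi> x)"
  using integrable_L2_inner[OF has_weak_gradientD(1)[OF assms(1)] L2_space_component[OF test_function_L2(2)[OF assms(2,3)]]]
    integrable_L2_inner[OF L2_space_component[OF has_weak_gradientD(2)[OF assms(1)]] test_function_L2(1)[OF assms(2,3)]]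
  by simp_all

lemma has_weak_gradient_unique:
  assumes \<omega>: "open \<omega>" and v: "has_weak_gradient \<omega> v G" "has_weak_gradient \<omega> v G'"
  shows "AE x in lebesgue_on \<omega>. G x = G' x"
proof -
  have \<omega>m: "\<omega> \<in> sets lebesgue" using \<omega> by auto
  have "AE x in lebesgue_on \<omega>. G x $ i - G' x $ i = 0" for i
  proof (rule AE_eq_0_of_test_functions[OF \<omega>])
    show "(\<lambda>x. G x $ i - G' x $ i) \<in> L2_space (lebesgue_on \<omega>)"
      using v by (intro L2_space_diff L2_space_component) (auto dest: has_weak_gradientD)
    fix \<phi> assume \<phi>: "\<phi> \<in> test_functions \<omega>"
    show "(\<integral>x. (G x $ i - G' x $ i) * \<phi> x \<partial>lebesgue_on \<omega>) = 0"
      using integrable_weak_gradient(2)[OF v(1) \<phi> \<omega>m, of i] integrable_weak_gradient(2)[OF v(2) \<phi> \<omega>m, of i]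
        has_weak_gradientD(3)[OF v(1) \<phi>, of i] has_weak_gradientD(3)[OF v(2) \<phi>, of i]
      by (simp add: left_diff_distrib)
  qed
  then have "AE x in lebesgue_on \<omega>. \<forall>i. G x $ i - G' x $ i = 0" by (simp add: AE_all_countable)
  then show ?thesis by (rule eventually_mono) (simp add: vec_eq_iff)
qed

lemma has_weak_gradient_weak_gradient: "v \<in> H1 \<Omega> \<Longrightarrow> has_weak_gradient \<Omega> v (weak_gradient \<Omega> v)"
  using someI_ex[of "has_weak_gradient \<Omega> v"] by (simp add: H1_def weak_gradient_def)

lemma weak_gradient_AE:
  assumes "open \<omega>" "has_weak_gradient \<omega> v G"
  shows "AE x in lebesgue_on \<omega>. weak_gradient \<omega> v x = G x"
  using assms has_weak_gradient_weak_gradient[of v \<omega>]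
  by (intro has_weak_gradient_unique) (auto simp: H1_def)

lemma H1_seminorm_eq:
  assumes "open \<omega>" "has_weak_gradient \<omega> v G"
  shows "H1_seminorm \<omega> v = L2_norm (lebesgue_on \<omega>) G"
  unfolding H1_seminorm_def using assms has_weak_gradient_weak_gradient[of v \<omega>]
  by (intro L2_norm_cong_AE weak_gradient_AE) (auto simp: H1_def dest: has_weak_gradientD)

lemma energy_eq:
  assumes "open \<omega>" "has_weak_gradient \<omega> u D" "has_weak_gradient \<omega> v G"
  shows "energy \<omega> u v = L2_inner (lebesgue_on \<omega>) D G"
  unfolding energy_def using assms has_weak_gradient_weak_gradient[of v \<omega>] has_weak_gradient_weak_gradient[of u \<omega>]
  by (intro L2_inner_cong_AE weak_gradient_AE) (auto simp: H1_def dest: has_weak_gradientD)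

lemma has_weak_gradient_subset:
  assumes v: "has_weak_gradient \<Omega> v G" and s: "open \<omega>" "open \<Omega>" "\<omega> \<subseteq> \<Omega>"
  shows "has_weak_gradient \<omega> v G"
proof -
  have m: "\<omega> \<in> sets lebesgue" "\<Omega> \<in> sets lebesgue" using s by auto
  have "(\<integral>x. v x * gradient \<psi> x $ i \<partial>lebesgue_on \<omega>) = - (\<integral>x. G x $ i * \<psi> x \<partial>lebesgue_on \<omega>)"
    if \<psi>: "\<psi> \<in> test_functions \<omega>" for \<psi> i
  proof -
    have z: "x \<in> \<Omega> - \<omega> \<Longrightarrow> \<psi> x = 0" "x \<in> \<Omega> - \<omega> \<Longrightarrow> gradient \<psi> x $ i = 0" for x
      using test_functionsD[OF \<psi>] by auto
    have "\<psi> \<in> test_functions \<Omega>" using \<psi> test_functions_mono[OF s(3)] by blast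
    from has_weak_gradientD(3)[OF v this, of i] show ?thesis
      using L2_inner_extend[OF m s(3), of "\<lambda>x. gradient \<psi> x $ i" v] z
        L2_inner_extend[OF m s(3), of \<psi> "\<lambda>x. G x $ i"]
      by (simp add: L2_inner_def)
  qed
  then show ?thesis
    using has_weak_gradientD(1,2)[OF v] m s(3) by (auto simp: has_weak_gradient_def intro: L2_space_subset)
qed

lemma has_weak_gradient_diff:
  assumes v: "has_weak_gradient \<Omega> v G" and w: "has_weak_gradient \<Omega> w D" and \<Omega>: "\<Omega> \<in> sets lebesgue"
  shows "has_weak_gradient \<Omega> (\<lambda>x. v x - w x) (\<lambda>x. G x - D x)"
  unfolding has_weak_gradient_def
proof (intro conjI ballI allI)
  fix \<psi> i assume \<psi>: "\<psi> \<in> test_functions \<Omega>"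
  show "(\<integral>x. (v x - w x) * gradient \<psi> x $ i \<partial>lebesgue_on \<Omega>) = - (\<integral>x. (G x - D x) $ i * \<psi> x \<partial>lebesgue_on \<Omega>)"
    using integrable_weak_gradient[OF v \<psi> \<Omega>, of i] integrable_weak_gradient[OF w \<psi> \<Omega>, of i]
      has_weak_gradientD(3)[OF v \<psi>, of i] has_weak_gradientD(3)[OF w \<psi>, of i]
    by (simp add: left_diff_distrib)
qed (use v w in \<open>auto intro!: L2_space_diff dest: has_weak_gradientD\<close>)

lemma has_weak_gradient_test_function:
  assumes "\<psi> \<in> test_functions \<Omega>" "\<omega> \<in> sets lebesgue"
  shows "has_weak_gradient \<omega> \<psi> (gradient \<psi>)"
  unfolding has_weak_gradient_def
  using test_function_L2[OF assms] integral_by_parts[OF test_functionsD(1)[OF assms(1)] _ assms(2)] by blast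

section \<open>Functions vanishing on the boundary and the dual norm\<close>

text \<open>
  Integrating \<open>\<psi>\<^sup>2 = \<psi>\<^sup>2 \<partial>\<^sub>1 x\<^sub>1\<close> by parts gives \<open>- 2 x\<^sub>1 \<psi> \<partial>\<^sub>1 \<psi>\<close>, and \<open>x\<^sub>1\<close> is at most \<open>R\<close> in modulus.
\<close>

lemma poincare_test_function:
  assumes \<psi>: "\<psi> \<in> test_functions \<omega>" and \<omega>: "\<omega> \<in> sets lebesgue" "\<omega> \<subseteq> cball 0 R" and R: "0 \<le> R"
  shows "L2_norm (lebesgue_on \<omega>) \<psi> \<le> 2 * R * L2_norm (lebesgue_on \<omega>) (gradient \<psi>)"
proof -
  let ?M = "lebesgue_on \<omega>"
  have L2: "\<psi> \<in> L2_space ?M" "gradient \<psi> \<in> L2_space ?M" using test_function_L2[OF \<psi> \<omega>(1)] by auto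
  have L21: "(\<lambda>x. gradient \<psi> x $ 1) \<in> L2_space ?M" using L2(2) by (rule L2_space_component)
  define xi where "xi x = 0 + axis 1 1 \<bullet> x" for x :: "real^2"
  have xi: "C_k (Suc 0) xi" "gradient xi x $ 1 = 1" "xi x = x $ 1" for x
    unfolding xi_def [abs_def] by (rule C_k_affine, simp_all only: gradient_affine, simp_all add: inner_axis')
  define w where "w x = xi x * \<psi> x" for x
  have wm: "w \<in> borel_measurable ?M"
    unfolding w_def using measurable_continuous_lebesgue_on[OF C_1_D(2)[OF xi(1)]] L2_space_measurable[OF L2(1)]
    by (intro borel_measurable_times)
  have wle: "norm (w x) \<le> R * norm (\<psi> x)" if "x \<in> \<omega>" for x
  proof -
    have "norm x \<le> R" using that \<omega>(2) by auto
    then have "\<bar>x $ 1\<bar> \<le> R" using component_le_norm_cart[of x 1] by linarith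
    then show ?thesis by (simp add: w_def xi abs_mult mult_right_mono)
  qed
  have w: "L2_norm ?M w \<le> R * L2_norm ?M \<psi>"
    by (rule L2_norm_mono[OF L2(1) wm _ R]) (use wle in auto)
  have wL2: "w \<in> L2_space ?M"
  proof -
    have "(norm (w x))\<^sup>2 \<le> (norm (R * \<psi> x))\<^sup>2" if "x \<in> \<omega>" for x
      using wle[OF that] R by (intro power_mono) (auto simp: abs_mult)
    then have "integrable ?M (\<lambda>x. (norm (w x))\<^sup>2)"
      by (intro Bochner_Integration.integrable_bound[OF L2_space_integrable[OF L2_space_scale_real[OF L2(1), of R]]])
         (use wm in auto)
    then show ?thesis using wm by (simp add: L2_space_def)
  qed
  have "(\<integral>x. xi x * gradient (\<lambda>x. \<psi> x * \<psi> x) x $ 1 \<partial>?M) = - (\<integral>x. gradient xi x $ 1 * (\<psi> x * \<psi> x) \<partial>?M)"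
    by (rule integral_by_parts[OF xi(1) test_functions_mult[OF \<psi> test_functionsD(1)[OF \<psi>]] \<omega>(1)])
  also have "(\<lambda>x. xi x * gradient (\<lambda>x. \<psi> x * \<psi> x) x $ 1) = (\<lambda>x. 2 * (w x * gradient \<psi> x $ 1))"
    using test_functionsD(2)[OF \<psi>] by (simp add: gradient_mult w_def fun_eq_iff)
  finally have "(L2_norm ?M \<psi>)\<^sup>2 = - (2 * L2_inner ?M w (\<lambda>x. gradient \<psi> x $ 1))"
    by (simp add: xi(2) L2_norm_power2 L2_inner_def) (simp add: power2_eq_square)
  also have "\<dots> \<le> 2 * (L2_norm ?M w * L2_norm ?M (\<lambda>x. gradient \<psi> x $ 1))"
    using L2_inner_le[OF wL2 L21] by simp
  also have "\<dots> \<le> 2 * ((R * L2_norm ?M \<psi>) * L2_norm ?M (gradient \<psi>))"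
    by (intro mult_left_mono mult_mono w L2_norm_component L2) (use R in auto)
  finally have "L2_norm ?M \<psi> * L2_norm ?M \<psi> \<le> L2_norm ?M \<psi> * (2 * R * L2_norm ?M (gradient \<psi>))"
    by (simp add: power2_eq_square ac_simps)
  then show ?thesis
    using R by (cases "L2_norm ?M \<psi> = 0") (auto simp: mult_le_cancel_left less_le)
qed

lemma H1_seminorm_nonneg [simp]: "0 \<le> H1_seminorm \<Omega> v"
  by (simp add: H1_seminorm_def)

lemma H10_has_weak_gradient: "v \<in> H10 \<Omega> \<Longrightarrow> has_weak_gradient \<Omega> v (weak_gradient \<Omega> v)"
  by (rule has_weak_gradient_weak_gradient) (simp add: H10_def)

lemma H1_norm_ge: "L2_norm (lebesgue_on \<Omega>) v \<le> H1_norm \<Omega> v" "H1_seminorm \<Omega> v \<le> H1_norm \<Omega> v"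
  by (auto simp: H1_norm_def H1_seminorm_def intro!: real_le_rsqrt)

lemma H10_I:
  assumes \<omega>: "open \<omega>" and v: "has_weak_gradient \<omega> v G" and \<phi>: "\<And>n. \<phi> n \<in> test_functions \<omega>"
    and l: "(\<lambda>n. L2_norm (lebesgue_on \<omega>) (\<lambda>x. v x - \<phi> n x)) \<longlonglongrightarrow> 0"
      "(\<lambda>n. L2_norm (lebesgue_on \<omega>) (\<lambda>x. G x - gradient (\<phi> n) x)) \<longlonglongrightarrow> 0"
  shows "v \<in> H10 \<omega>"
proof -
  have m: "\<omega> \<in> sets lebesgue" using \<omega> by auto
  have "H1_seminorm \<omega> (\<lambda>x. v x - \<phi> n x) = L2_norm (lebesgue_on \<omega>) (\<lambda>x. G x - gradient (\<phi> n) x)" for n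
    by (rule H1_seminorm_eq[OF \<omega> has_weak_gradient_diff[OF v has_weak_gradient_test_function[OF \<phi> m] m]])
  then have "(\<lambda>n. H1_norm \<omega> (\<lambda>x. v x - \<phi> n x)) \<longlonglongrightarrow> sqrt (0\<^sup>2 + 0\<^sup>2)"
    unfolding H1_norm_def by (simp only:) (intro tendsto_intros l)
  then show ?thesis using v \<phi> by (auto simp: H10_def H1_def)
qed

text \<open>
  By uniqueness of the weak gradient, convergence in the \<open>H\<^sup>1\<close> norm means \<open>L\<^sup>2\<close> convergence of the
  functions and of the classical gradients.
\<close>

lemma H10_approx:
  assumes \<omega>: "open \<omega>" and v: "v \<in> H10 \<omega>"
  obtains \<phi> where "\<And>n::nat. \<phi> n \<in> test_functions \<omega>"
    "(\<lambda>n. L2_norm (lebesgue_on \<omega>) (\<lambda>x. v x - \<phi> n x)) \<longlonglongrightarrow> 0"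
    "(\<lambda>n. L2_norm (lebesgue_on \<omega>) (\<lambda>x. weak_gradient \<omega> v x - gradient (\<phi> n) x)) \<longlonglongrightarrow> 0"
proof -
  have m: "\<omega> \<in> sets lebesgue" using \<omega> by auto
  from v obtain \<phi> where \<phi>: "\<And>n::nat. \<phi> n \<in> test_functions \<omega>"
    and l: "(\<lambda>n. H1_norm \<omega> (\<lambda>x. v x - \<phi> n x)) \<longlonglongrightarrow> 0"
    unfolding H10_def by blast
  have vw: "has_weak_gradient \<omega> v (weak_gradient \<omega> v)" by (rule H10_has_weak_gradient[OF v])
  have e: "H1_seminorm \<omega> (\<lambda>x. v x - \<phi> n x) = L2_norm (lebesgue_on \<omega>) (\<lambda>x. weak_gradient \<omega> v x - gradient (\<phi> n) x)" for n
    by (rule H1_seminorm_eq[OF \<omega> has_weak_gradient_diff[OF vw has_weak_gradient_test_function[OF \<phi> m] m]])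
  show ?thesis
  proof (rule that[OF \<phi>])
    show "(\<lambda>n. L2_norm (lebesgue_on \<omega>) (\<lambda>x. v x - \<phi> n x)) \<longlonglongrightarrow> 0"
      by (rule tendsto_sandwich[OF _ _ tendsto_const l]) (simp_all add: H1_norm_ge)
    show "(\<lambda>n. L2_norm (lebesgue_on \<omega>) (\<lambda>x. weak_gradient \<omega> v x - gradient (\<phi> n) x)) \<longlonglongrightarrow> 0"
      unfolding e[symmetric]
      by (rule tendsto_sandwich[OF _ _ tendsto_const l]) (simp_all add: H1_norm_ge)
  qed
qed

text \<open>
  Both sides are continuous along the approximating test functions.
\<close>

lemma H10_poincare:
  assumes \<omega>: "open \<omega>" "\<omega> \<subseteq> cball 0 R" "0 \<le> R" and v: "v \<in> H10 \<omega>"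
  shows "L2_norm (lebesgue_on \<omega>) v \<le> 2 * R * H1_seminorm \<omega> v"
proof -
  have m: "\<omega> \<in> sets lebesgue" using \<omega> by auto
  let ?M = "lebesgue_on \<omega>" and ?G = "weak_gradient \<omega> v"
  obtain \<phi> where \<phi>: "\<And>n::nat. \<phi> n \<in> test_functions \<omega>"
    and l: "(\<lambda>n. L2_norm ?M (\<lambda>x. v x - \<phi> n x)) \<longlonglongrightarrow> 0"
      "(\<lambda>n. L2_norm ?M (\<lambda>x. ?G x - gradient (\<phi> n) x)) \<longlonglongrightarrow> 0"
    using H10_approx[OF \<omega>(1) v] by blast
  have vw: "has_weak_gradient \<omega> v ?G" by (rule H10_has_weak_gradient[OF v])
  note L2 = has_weak_gradientD(1,2)[OF vw] test_function_L2[OF \<phi> m]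
  have le: "L2_norm ?M v \<le> L2_norm ?M (\<lambda>x. v x - \<phi> n x) +
      2 * R * (L2_norm ?M (\<lambda>x. ?G x - gradient (\<phi> n) x) + L2_norm ?M ?G)" for n
  proof -
    have "L2_norm ?M v \<le> L2_norm ?M (\<lambda>x. v x - \<phi> n x) + L2_norm ?M (\<phi> n)"
      using L2_norm_triangle[OF L2_space_diff[OF L2(1,3)] L2(3), of n n] by simp
    moreover have "L2_norm ?M (\<phi> n) \<le> 2 * R * L2_norm ?M (gradient (\<phi> n))"
      by (rule poincare_test_function[OF \<phi> m \<omega>(2,3)])
    moreover have "L2_norm ?M (gradient (\<phi> n)) \<le> L2_norm ?M (\<lambda>x. ?G x - gradient (\<phi> n) x) + L2_norm ?M ?G"
      using L2_norm_triangle[OF L2_space_diff[OF L2(4,2)] L2(2), of n] L2_norm_commute[of ?M ?G "gradient (\<phi> n)"] by simp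
    moreover from this have "2 * R * L2_norm ?M (gradient (\<phi> n)) \<le>
        2 * R * (L2_norm ?M (\<lambda>x. ?G x - gradient (\<phi> n) x) + L2_norm ?M ?G)"
      using \<omega>(3) by (intro mult_left_mono) auto
    ultimately show ?thesis by linarith
  qed
  have "(\<lambda>n. L2_norm ?M (\<lambda>x. v x - \<phi> n x) +
      2 * R * (L2_norm ?M (\<lambda>x. ?G x - gradient (\<phi> n) x) + L2_norm ?M ?G)) \<longlonglongrightarrow> 0 + 2 * R * (0 + L2_norm ?M ?G)"
    by (intro tendsto_intros l)
  then have "L2_norm ?M v \<le> 0 + 2 * R * (0 + L2_norm ?M ?G)"
    by (rule LIMSEQ_le_const) (use le in blast)
  then show ?thesis by (simp add: H1_seminorm_def)
qed

text \<open>
  The approximating test functions of \<open>\<omega>\<close> are test functions of \<open>\<Omega>\<close>.  For them the defining identity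
  of the weak gradient holds on \<open>\<Omega>\<close>, and it survives the limit by Cauchy-Schwarz.
\<close>

lemma
  assumes \<omega>: "open \<omega>" "open \<Omega>" "\<omega> \<subseteq> \<Omega>" and v: "v \<in> H10 \<omega>"
  shows has_weak_gradient_extend:
      "has_weak_gradient \<Omega> (\<lambda>x. if x \<in> \<omega> then v x else 0) (\<lambda>x. if x \<in> \<omega> then weak_gradient \<omega> v x else 0)"
    and H10_extend: "(\<lambda>x. if x \<in> \<omega> then v x else 0) \<in> H10 \<Omega>"
proof -
  have m: "\<omega> \<in> sets lebesgue" "\<Omega> \<in> sets lebesgue" using \<omega> by auto
  let ?M = "lebesgue_on \<omega>" and ?G = "weak_gradient \<omega> v"
  let ?v = "\<lambda>x. if x \<in> \<omega> then v x else 0" and ?D = "\<lambda>x. if x \<in> \<omega> then ?G x else 0"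
  obtain \<phi> where \<phi>: "\<And>n::nat. \<phi> n \<in> test_functions \<omega>"
    and l: "(\<lambda>n. L2_norm ?M (\<lambda>x. v x - \<phi> n x)) \<longlonglongrightarrow> 0"
      "(\<lambda>n. L2_norm ?M (\<lambda>x. ?G x - gradient (\<phi> n) x)) \<longlonglongrightarrow> 0"
    using H10_approx[OF \<omega>(1) v] by blast
  have vw: "has_weak_gradient \<omega> v ?G" by (rule H10_has_weak_gradient[OF v])
  note L2 = has_weak_gradientD(1,2)[OF vw] test_function_L2[OF \<phi> m(1)]
  have parts: "L2_inner ?M v (\<lambda>x. gradient \<psi> x $ i) + L2_inner ?M (\<lambda>x. ?G x $ i) \<psi> = 0"
    if \<psi>: "\<psi> \<in> test_functions \<Omega>" for \<psi> i
  proof -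
    let ?c = "L2_inner ?M v (\<lambda>x. gradient \<psi> x $ i) + L2_inner ?M (\<lambda>x. ?G x $ i) \<psi>"
    have p: "\<psi> \<in> L2_space ?M" "(\<lambda>x. gradient \<psi> x $ i) \<in> L2_space ?M"
      using test_function_L2[OF \<psi> m(1)] by (auto intro: L2_space_component)
    have G: "(\<lambda>x. ?G x $ i) \<in> L2_space ?M" "(\<lambda>x. gradient (\<phi> n) x $ i) \<in> L2_space ?M" for n
      using L2 by (auto intro: L2_space_component)
    have le: "\<bar>?c\<bar> \<le> L2_norm ?M (\<lambda>x. v x - \<phi> n x) * L2_norm ?M (\<lambda>x. gradient \<psi> x $ i) +
        L2_norm ?M (\<lambda>x. ?G x - gradient (\<phi> n) x) * L2_norm ?M \<psi>" for n
    proof -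
      have "L2_inner ?M (\<phi> n) (\<lambda>x. gradient \<psi> x $ i) + L2_inner ?M (\<lambda>x. gradient (\<phi> n) x $ i) \<psi> = 0"
        using integral_by_parts[OF test_functionsD(1)[OF \<psi>] \<phi>[of n] m(1), of i]
        by (simp add: L2_inner_def mult.commute)
      then have "?c = L2_inner ?M (\<lambda>x. v x - \<phi> n x) (\<lambda>x. gradient \<psi> x $ i) +
          L2_inner ?M (\<lambda>x. ?G x $ i - gradient (\<phi> n) x $ i) \<psi>"
        using integrable_L2_inner[OF L2(1) p(2)] integrable_L2_inner[OF L2(3) p(2), of n]
          integrable_L2_inner[OF G(1) p(1)] integrable_L2_inner[OF G(2) p(1), of n]
        by (simp add: L2_inner_def left_diff_distrib)
      also have "\<bar>\<dots>\<bar> \<le> L2_norm ?M (\<lambda>x. v x - \<phi> n x) * L2_norm ?M (\<lambda>x. gradient \<psi> x $ i) +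
          L2_norm ?M (\<lambda>x. (?G x - gradient (\<phi> n) x) $ i) * L2_norm ?M \<psi>"
        using L2_inner_le[OF L2_space_diff[OF L2(1,3)] p(2), of n] L2_inner_le[OF L2_space_diff[OF G(1) G(2)] p(1), of n]
        by simp
      also have "\<dots> \<le> L2_norm ?M (\<lambda>x. v x - \<phi> n x) * L2_norm ?M (\<lambda>x. gradient \<psi> x $ i) +
          L2_norm ?M (\<lambda>x. ?G x - gradient (\<phi> n) x) * L2_norm ?M \<psi>"
        by (intro add_left_mono mult_right_mono L2_norm_component L2_space_diff L2) simp
      finally show ?thesis .
    qed
    have "(\<lambda>n. L2_norm ?M (\<lambda>x. v x - \<phi> n x) * L2_norm ?M (\<lambda>x. gradient \<psi> x $ i) +
        L2_norm ?M (\<lambda>x. ?G x - gradient (\<phi> n) x) * L2_norm ?M \<psi>) \<longlonglongrightarrow>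
        0 * L2_norm ?M (\<lambda>x. gradient \<psi> x $ i) + 0 * L2_norm ?M \<psi>"
      by (intro tendsto_intros l)
    then have "\<bar>?c\<bar> \<le> 0 * L2_norm ?M (\<lambda>x. gradient \<psi> x $ i) + 0 * L2_norm ?M \<psi>"
      by (rule LIMSEQ_le_const) (use le in blast)
    then show ?thesis by simp
  qed
  show hw: "has_weak_gradient \<Omega> ?v ?D"
    unfolding has_weak_gradient_def
  proof (intro conjI ballI allI)
    show "?v \<in> L2_space (lebesgue_on \<Omega>)" "?D \<in> L2_space (lebesgue_on \<Omega>)"
      by (intro L2_space_extend L2 m \<omega>)+
    fix \<psi> i assume \<psi>: "\<psi> \<in> test_functions \<Omega>"
    have "(\<lambda>x. ?v x * gradient \<psi> x $ i) = (\<lambda>x. if x \<in> \<omega> then v x * gradient \<psi> x $ i else 0)"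
      "(\<lambda>x. ?D x $ i * \<psi> x) = (\<lambda>x. if x \<in> \<omega> then ?G x $ i * \<psi> x else 0)"
      by auto
    then show "(\<integral>x. ?v x * gradient \<psi> x $ i \<partial>lebesgue_on \<Omega>) = - (\<integral>x. ?D x $ i * \<psi> x \<partial>lebesgue_on \<Omega>)"
      using parts[OF \<psi>, of i] m \<omega>(3) by (simp add: integral_restrict L2_inner_def)
  qed
  show "?v \<in> H10 \<Omega>"
  proof (rule H10_I[OF \<omega>(2) hw])
    show "\<phi> n \<in> test_functions \<Omega>" for n using \<phi> test_functions_mono[OF \<omega>(3)] by blast
    have e: "(\<lambda>x. ?v x - \<phi> n x) = (\<lambda>x. if x \<in> \<omega> then v x - \<phi> n x else 0)"
      "(\<lambda>x. ?D x - gradient (\<phi> n) x) = (\<lambda>x. if x \<in> \<omega> then ?G x - gradient (\<phi> n) x else 0)" for n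
      using test_functionsD(3,4)[OF \<phi>] by (auto simp: fun_eq_iff)
    show "(\<lambda>n. L2_norm (lebesgue_on \<Omega>) (\<lambda>x. ?v x - \<phi> n x)) \<longlonglongrightarrow> 0"
      unfolding e using l(1) by (simp only: L2_norm_extend[OF L2_space_diff[OF L2(1,3)] m \<omega>(3)])
    show "(\<lambda>n. L2_norm (lebesgue_on \<Omega>) (\<lambda>x. ?D x - gradient (\<phi> n) x)) \<longlonglongrightarrow> 0"
      unfolding e using l(2) by (simp only: L2_norm_extend[OF L2_space_diff[OF L2(2,4)] m \<omega>(3)])
  qed
qed

lemma test_functions_subset_H10:
  assumes "open \<omega>" "\<psi> \<in> test_functions \<omega>"
  shows "\<psi> \<in> H10 \<omega>"
proof -
  have m: "\<omega> \<in> sets lebesgue" using assms by auto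
  show ?thesis
    by (rule H10_I[OF assms(1) has_weak_gradient_test_function[OF assms(2) m], of "\<lambda>_. \<psi>"])
       (simp_all add: assms L2_norm_def L2_inner_def)
qed

text \<open>
  Poincare's inequality bounds the functional \<open>\<sigma> - s\<close> on the unit ball of \<open>H10 \<omega>\<close>, so the supremum in
  \<^const>\<open>Hm1_norm\<close> is an upper bound.  It is applied to \<open>v / S\<close>; the bound \<open>S\<close> instead of the seminorm
  of \<open>v\<close> avoids a division by zero.  What remains of the energy of \<open>u\<close> is that of \<open>u - w\<close>, estimated by
  Cauchy-Schwarz, and that of \<open>w\<close>, kept on the left.
\<close>

lemma residual_bound:
  assumes \<omega>: "open \<omega>" "open \<Omega>" "\<omega> \<subseteq> \<Omega>" "bounded \<Omega>"
    and f: "f \<in> L2_space (lebesgue_on \<Omega>)" and s: "s \<in> L2_space (lebesgue_on \<Omega>)"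
    and u: "u \<in> H1 \<Omega>" and w: "w \<in> H1 \<Omega>" and \<sigma>: "multiplier \<Omega> f u \<sigma>"
    and v: "v \<in> test_functions \<omega>" and S: "L2_norm (lebesgue_on \<omega>) (gradient v) \<le> S" "0 < S"
  shows "\<bar>L2_inner (lebesgue_on \<omega>) (\<lambda>x. f x - s x) v - L2_inner (lebesgue_on \<omega>) (weak_gradient \<Omega> w) (gradient v)\<bar>
    \<le> S * (H1_seminorm \<omega> (\<lambda>x. u x - w x) + Hm1_norm \<omega> (\<lambda>v. \<sigma> v - L2_inner (lebesgue_on \<Omega>) s v))"
proof -
  have m: "\<omega> \<in> sets lebesgue" "\<Omega> \<in> sets lebesgue" using \<omega> by auto
  let ?M = "lebesgue_on \<omega>" and ?U = "weak_gradient \<Omega> u" and ?W = "weak_gradient \<Omega> w"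
  define F where "F v = \<sigma> v - L2_inner (lebesgue_on \<Omega>) s v" for v
  define ext where "ext v = (\<lambda>x. if x \<in> \<omega> then v x else 0 :: real)" for v
  obtain R where R: "\<Omega> \<subseteq> cball 0 R" "0 \<le> R"
    using bounded_subset_ballD[OF \<omega>(4), of 0] ball_subset_cball by (meson less_imp_le subset_trans)
  have hu: "has_weak_gradient \<Omega> u ?U" and hw: "has_weak_gradient \<Omega> w ?W"
    using u w by (auto intro: has_weak_gradient_weak_gradient)
  have L2: "(\<lambda>x. f x - s x) \<in> L2_space ?M" "?U \<in> L2_space ?M" "?W \<in> L2_space ?M"
    using has_weak_gradientD(2)[OF hu] has_weak_gradientD(2)[OF hw] f s m \<omega>
    by (auto intro!: L2_space_diff intro: L2_space_subset)
  have F_eq: "F (ext v) = L2_inner ?M (\<lambda>x. f x - s x) v - L2_inner ?M ?U G"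
    if v: "v \<in> H10 \<omega>" "has_weak_gradient \<omega> v G" for v G
  proof -
    have vw: "has_weak_gradient \<omega> v (weak_gradient \<omega> v)" by (rule H10_has_weak_gradient[OF v(1)])
    have in_ext: "L2_inner (lebesgue_on \<Omega>) g (ext v) = L2_inner ?M g v" for g
    proof -
      have "L2_inner (lebesgue_on \<Omega>) g (ext v) = L2_inner ?M g (ext v)"
        by (rule L2_inner_extend[OF m \<omega>(3)]) (auto simp: ext_def)
      also have "\<dots> = L2_inner ?M g v"
        unfolding L2_inner_def ext_def by (rule Bochner_Integration.integral_cong) auto
      finally show ?thesis .
    qed
    have "energy \<Omega> u (ext v) = L2_inner (lebesgue_on \<Omega>) ?U (\<lambda>x. if x \<in> \<omega> then weak_gradient \<omega> v x else 0)"
      unfolding ext_def by (rule energy_eq[OF \<omega>(2) hu has_weak_gradient_extend[OF \<omega>(1-3) v(1)]])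
    also have "\<dots> = L2_inner ?M ?U (\<lambda>x. if x \<in> \<omega> then weak_gradient \<omega> v x else 0)"
      by (rule L2_inner_extend[OF m \<omega>(3)]) auto
    also have "\<dots> = L2_inner ?M ?U (weak_gradient \<omega> v)"
      unfolding L2_inner_def by (rule Bochner_Integration.integral_cong) auto
    also have "\<dots> = L2_inner ?M ?U G"
      by (rule L2_inner_cong_AE[OF L2(2) _ L2(2) _ _ weak_gradient_AE[OF \<omega>(1) v(2)]])
         (use has_weak_gradientD(2)[OF vw] has_weak_gradientD(2)[OF v(2)] in auto)
    finally have en: "energy \<Omega> u (ext v) = L2_inner ?M ?U G" .
    have "\<sigma> (ext v) = L2_inner (lebesgue_on \<Omega>) f (ext v) - energy \<Omega> u (ext v)"
      using \<sigma> H10_extend[OF \<omega>(1-3) v(1)] by (auto simp: multiplier_def ext_def)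
    then have "F (ext v) = L2_inner ?M f v - L2_inner ?M s v - L2_inner ?M ?U G"
      by (simp add: F_def in_ext en)
    also have "L2_inner ?M f v - L2_inner ?M s v = L2_inner ?M (\<lambda>x. f x - s x) v"
      using integrable_L2_inner[OF L2_space_subset[OF f m \<omega>(3)] has_weak_gradientD(1)[OF v(2)]]
        integrable_L2_inner[OF L2_space_subset[OF s m \<omega>(3)] has_weak_gradientD(1)[OF v(2)]]
      by (simp add: L2_inner_def left_diff_distrib)
    finally show ?thesis .
  qed
  have bdd: "\<bar>F (ext v)\<bar> \<le> L2_norm ?M (\<lambda>x. f x - s x) * (2 * R) + L2_norm ?M ?U"
    if v: "v \<in> H10 \<omega>" "H1_seminorm \<omega> v \<le> 1" for v
  proof -
    have vw: "has_weak_gradient \<omega> v (weak_gradient \<omega> v)" by (rule H10_has_weak_gradient[OF v(1)])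
    have "L2_norm ?M v \<le> 2 * R * H1_seminorm \<omega> v"
      by (rule H10_poincare) (use \<omega> R v in auto)
    also have "\<dots> \<le> 2 * R * 1" using v R by (intro mult_left_mono) auto
    finally have "L2_norm ?M v \<le> 2 * R" by simp
    then have "L2_norm ?M (\<lambda>x. f x - s x) * L2_norm ?M v \<le> L2_norm ?M (\<lambda>x. f x - s x) * (2 * R)"
      by (intro mult_left_mono) auto
    moreover have "L2_norm ?M ?U * L2_norm ?M (weak_gradient \<omega> v) \<le> L2_norm ?M ?U * 1"
      using v(2) by (intro mult_left_mono) (auto simp: H1_seminorm_def)
    ultimately show ?thesis
      using L2_inner_le[OF L2(1) has_weak_gradientD(1)[OF vw]] L2_inner_le[OF L2(2) has_weak_gradientD(2)[OF vw]]
      unfolding F_eq[OF v(1) vw] by linarith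
  qed
  have Hm1: "\<bar>F (ext v)\<bar> \<le> Hm1_norm \<omega> F" if "v \<in> H10 \<omega>" "H1_seminorm \<omega> v \<le> 1" for v
    unfolding Hm1_norm_def
  proof (rule cSup_upper)
    show "\<bar>F (ext v)\<bar> \<in> {\<bar>F (\<lambda>x. if x \<in> \<omega> then v x else 0)\<bar> |v. v \<in> H10 \<omega> \<and> H1_seminorm \<omega> v \<le> 1}"
      using that by (auto simp: ext_def)
    show "bdd_above {\<bar>F (\<lambda>x. if x \<in> \<omega> then v x else 0)\<bar> |v. v \<in> H10 \<omega> \<and> H1_seminorm \<omega> v \<le> 1}"
      by (rule bdd_aboveI[of _ "L2_norm ?M (\<lambda>x. f x - s x) * (2 * R) + L2_norm ?M ?U"])
         (use bdd in \<open>auto simp: ext_def\<close>)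
  qed
  have vg: "has_weak_gradient \<omega> v (gradient v)" by (rule has_weak_gradient_test_function[OF v m(1)])
  define v' where "v' x = 1 / S * v x" for x
  have v': "v' \<in> test_functions \<omega>" unfolding v'_def by (rule test_functions_scale[OF v])
  have v'g: "gradient v' x = (1 / S) *\<^sub>R gradient v x" for x
    unfolding v'_def using gradient_mult[of "\<lambda>_. 1 / S" x v] test_functionsD(2)[OF v] by simp
  have v'w: "has_weak_gradient \<omega> v' (gradient v')" by (rule has_weak_gradient_test_function[OF v' m(1)])
  have "H1_seminorm \<omega> v' = 1 / S * L2_norm ?M (gradient v)"
    unfolding H1_seminorm_eq[OF \<omega>(1) v'w] v'g using L2_norm_scale[of ?M "1 / S" "gradient v"] S by simp
  then have "\<bar>F (ext v')\<bar> \<le> Hm1_norm \<omega> F"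
    using S by (intro Hm1 test_functions_subset_H10[OF \<omega>(1) v']) (simp add: pos_divide_le_eq)
  also have "F (ext v') = (1 / S) * (L2_inner ?M (\<lambda>x. f x - s x) v - L2_inner ?M ?U (gradient v))"
    unfolding F_eq[OF test_functions_subset_H10[OF \<omega>(1) v'] v'w]
    by (simp add: L2_inner_def v'_def v'g diff_divide_distrib)
  finally have 1: "\<bar>L2_inner ?M (\<lambda>x. f x - s x) v - L2_inner ?M ?U (gradient v)\<bar> \<le> S * Hm1_norm \<omega> F"
    using S by (simp add: abs_mult pos_divide_le_eq mult.commute)
  have hd: "has_weak_gradient \<omega> (\<lambda>x. u x - w x) (\<lambda>x. ?U x - ?W x)"
    by (rule has_weak_gradient_subset[OF has_weak_gradient_diff[OF hu hw m(2)] \<omega>(1-3)])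
  have "\<bar>L2_inner ?M (\<lambda>x. ?U x - ?W x) (gradient v)\<bar> \<le> H1_seminorm \<omega> (\<lambda>x. u x - w x) * L2_norm ?M (gradient v)"
    unfolding H1_seminorm_eq[OF \<omega>(1) hd] using has_weak_gradientD(2)[OF hd] has_weak_gradientD(2)[OF vg]
    by (rule L2_inner_le)
  also have "\<dots> \<le> H1_seminorm \<omega> (\<lambda>x. u x - w x) * S"
    using S by (intro mult_left_mono) (auto simp: H1_seminorm_def)
  finally have "\<bar>L2_inner ?M (\<lambda>x. ?U x - ?W x) (gradient v)\<bar> \<le> S * H1_seminorm \<omega> (\<lambda>x. u x - w x)"
    by (simp add: mult.commute)
  moreover have "L2_inner ?M (\<lambda>x. ?U x - ?W x) (gradient v) = L2_inner ?M ?U (gradient v) - L2_inner ?M ?W (gradient v)"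
    using integrable_L2_inner[OF L2(2) has_weak_gradientD(2)[OF vg]] integrable_L2_inner[OF L2(3) has_weak_gradientD(2)[OF vg]]
    by (simp add: L2_inner_def inner_diff_left)
  ultimately show ?thesis using 1 unfolding F_def [abs_def] by (simp add: distrib_left)
qed

section \<open>Triangles\<close>

text \<open>
  The determinant with columns \<open>p\<close> and \<open>q\<close>: twice the oriented area of the triangle that they span.
\<close>

definition cross2 :: "real^2 \<Rightarrow> real^2 \<Rightarrow> real" where
  "cross2 p q = p $ 1 * q $ 2 - p $ 2 * q $ 1"

definition rot :: "real^2 \<Rightarrow> real^2" where
  "rot p = vector [- (p $ 2), p $ 1]"

lemma inner_2: "p \<bullet> q = p $ 1 * q $ 1 + p $ 2 * q $ 2" for p q :: "real^2"
  by (simp add: inner_vec_def sum_2)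

lemma rot_inner: "rot p \<bullet> z = cross2 p z"
  by (simp add: rot_def inner_2 cross2_def)

lemma norm_rot: "norm (rot p) = norm p"
  by (simp add: norm_eq_sqrt_inner inner_2 rot_def add.commute)

lemma cross2_add_left: "cross2 (p + q) z = cross2 p z + cross2 q z"
  and cross2_add_right: "cross2 p (q + z) = cross2 p q + cross2 p z"
  and cross2_scale_left: "cross2 (c *\<^sub>R p) z = c * cross2 p z"
  and cross2_scale_right: "cross2 p (c *\<^sub>R z) = c * cross2 p z"
  and cross2_self: "cross2 p p = 0"
  by (simp_all add: cross2_def algebra_simps)

lemma cross2_power2: "(cross2 p q)\<^sup>2 = (norm p)\<^sup>2 * (norm q)\<^sup>2 - (p \<bullet> q)\<^sup>2"
  unfolding power2_norm_eq_inner inner_2 cross2_def by (simp add: power2_eq_square algebra_simps)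

lemma abs_cross2_le: "\<bar>cross2 p q\<bar> \<le> norm p * norm q"
  using Cauchy_Schwarz_ineq2[of "rot p" q] by (simp add: rot_inner norm_rot)

lemma cross2_coordinates:
  assumes "cross2 p q \<noteq> 0"
  shows "z = (cross2 z q / cross2 p q) *\<^sub>R p + (cross2 p z / cross2 p q) *\<^sub>R q"
proof -
  have "cross2 p q *\<^sub>R z = cross2 z q *\<^sub>R p + cross2 p z *\<^sub>R q"
    by (simp add: vec_eq_iff forall_2 cross2_def algebra_simps)
  then have "(1 / cross2 p q) *\<^sub>R (cross2 p q *\<^sub>R z) = (1 / cross2 p q) *\<^sub>R (cross2 z q *\<^sub>R p + cross2 p z *\<^sub>R q)"
    by simp
  then show ?thesis using assms by (simp add: scaleR_add_right)
qed

text \<open>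
  The quotients are the barycentric coordinates of \<open>x\<close> at \<open>b\<close> and \<open>c\<close>, by Cramer's rule.
\<close>

lemma mem_triangle_iff:
  assumes "cross2 (b - a) (c - a) \<noteq> 0"
  shows "x \<in> convex hull {a, b, c} \<longleftrightarrow>
    0 \<le> cross2 (x - a) (c - a) / cross2 (b - a) (c - a) \<and>
    0 \<le> cross2 (b - a) (x - a) / cross2 (b - a) (c - a) \<and>
    cross2 (x - a) (c - a) / cross2 (b - a) (c - a) + cross2 (b - a) (x - a) / cross2 (b - a) (c - a) \<le> 1"
    (is "_ \<longleftrightarrow> 0 \<le> ?s \<and> 0 \<le> ?t \<and> ?s + ?t \<le> 1")
proof
  assume "0 \<le> ?s \<and> 0 \<le> ?t \<and> ?s + ?t \<le> 1"
  moreover have "x = (1 - ?s - ?t) *\<^sub>R a + ?s *\<^sub>R b + ?t *\<^sub>R c"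
    using cross2_coordinates[OF assms, of "x - a"] by (simp add: algebra_simps)
  ultimately show "x \<in> convex hull {a, b, c}"
    unfolding convex_hull_3 mem_Collect_eq
    by (intro exI[of _ "1 - ?s - ?t"] exI[of _ ?s] exI[of _ ?t]) simp
next
  assume "x \<in> convex hull {a, b, c}"
  then obtain u v w where uvw: "0 \<le> u" "0 \<le> v" "0 \<le> w" "u + v + w = 1" and x: "x = u *\<^sub>R a + v *\<^sub>R b + w *\<^sub>R c"
    unfolding convex_hull_3 by auto
  have u: "u = 1 - v - w" using uvw by simp
  have "x - a = v *\<^sub>R (b - a) + w *\<^sub>R (c - a)"
    unfolding x u by (simp add: algebra_simps)
  then have "?s = v" "?t = w"
    using assms by (simp_all add: cross2_add_left cross2_add_right cross2_scale_left cross2_scale_right cross2_self)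
  then show "0 \<le> ?s \<and> 0 \<le> ?t \<and> ?s + ?t \<le> 1" using uvw by simp
qed

text \<open>
  At least one of the other two sides has at least half the length of the longest one.  The angle
  between the two is acute, because it is not opposite to the longest side, so the upper bound for
  its cosine is a lower bound for its sine.
\<close>

lemma cross2_ge_of_longest_side:
  fixes p q :: "real^2"
  assumes \<kappa>: "0 < \<kappa>" "\<kappa> \<le> 1" and q: "norm q \<le> norm p" "norm (q - p) \<le> norm p"
    and ang: "p \<bullet> q \<le> (1 - \<kappa>) * norm p * norm q" "(- p) \<bullet> (q - p) \<le> (1 - \<kappa>) * norm p * norm (q - p)"
  shows "sqrt \<kappa> / 2 * (norm p)\<^sup>2 \<le> \<bar>cross2 p q\<bar>"
proof -
  have core: "sqrt \<kappa> / 2 * (norm r)\<^sup>2 \<le> \<bar>cross2 r s\<bar>"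
    if s: "norm r / 2 \<le> norm s" "norm (s - r) \<le> norm r" and a: "r \<bullet> s \<le> (1 - \<kappa>) * norm r * norm s"
    for r s :: "real^2"
  proof -
    have "(norm (s - r))\<^sup>2 \<le> (norm r)\<^sup>2" using s(2) by (intro power_mono) auto
    then have "0 \<le> r \<bullet> s"
      by (simp add: power2_norm_eq_inner inner_diff_left inner_diff_right inner_commute)
         (smt (verit) inner_ge_zero)
    then have "(r \<bullet> s)\<^sup>2 \<le> ((1 - \<kappa>) * norm r * norm s)\<^sup>2" using a by (intro power_mono) auto
    also have "\<dots> = (1 - \<kappa>)\<^sup>2 * ((norm r)\<^sup>2 * (norm s)\<^sup>2)" by (simp add: power_mult_distrib)
    also have "\<dots> \<le> (1 - \<kappa>) * ((norm r)\<^sup>2 * (norm s)\<^sup>2)"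
      using \<kappa> by (intro mult_right_mono) (auto simp: power2_eq_square mult_left_le)
    finally have "\<kappa> * ((norm r)\<^sup>2 * (norm s)\<^sup>2) \<le> (cross2 r s)\<^sup>2"
      by (simp add: cross2_power2 algebra_simps)
    moreover have "\<kappa> * ((norm r)\<^sup>2 * (norm r / 2)\<^sup>2) \<le> \<kappa> * ((norm r)\<^sup>2 * (norm s)\<^sup>2)"
      using \<kappa> s(1) by (intro mult_left_mono power_mono) auto
    moreover have "(sqrt \<kappa> / 2 * (norm r)\<^sup>2)\<^sup>2 = \<kappa> * ((norm r)\<^sup>2 * (norm r / 2)\<^sup>2)"
      using \<kappa> by (simp add: power_mult_distrib power_divide power2_eq_square)
    ultimately have "(sqrt \<kappa> / 2 * (norm r)\<^sup>2)\<^sup>2 \<le> \<bar>cross2 r s\<bar>\<^sup>2" by simp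
    then show ?thesis by (rule power2_le_imp_le) simp
  qed
  show ?thesis
  proof (cases "norm p / 2 \<le> norm q")
    case True
    then show ?thesis using core[of p q] q ang by simp
  next
    case False
    have "norm p \<le> norm q + norm (q - p)"
      using norm_triangle_ineq4[of q "q - p"] by simp
    then have "norm (- p) / 2 \<le> norm (q - p)" using False by simp
    then have "sqrt \<kappa> / 2 * (norm (- p))\<^sup>2 \<le> \<bar>cross2 (- p) (q - p)\<bar>"
      using core[of "- p" "q - p"] q ang by simp
    also have "cross2 (- p) (q - p) = - cross2 p q" by (simp add: cross2_def algebra_simps)
    finally show ?thesis by simp
  qed
qed

text \<open>
  The cosine of the angle at \<open>z\<close> is at most \<open>1 - \<kappa>\<close>, free of divisions.
\<close>

definition small_cosine :: "real \<Rightarrow> real^2 \<Rightarrow> real^2 \<Rightarrow> real^2 \<Rightarrow> bool" where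
  "small_cosine \<kappa> z a b \<longleftrightarrow> (a - z) \<bullet> (b - z) \<le> (1 - \<kappa>) * norm (a - z) * norm (b - z)"

lemma triangle_diameter:
  fixes a b c :: "'a::euclidean_space"
  defines "L \<equiv> diameter (convex hull {a, b, c})"
  shows "norm (b - a) \<le> L" "norm (c - a) \<le> L" "norm (c - b) \<le> L"
    "L = norm (b - a) \<or> L = norm (c - a) \<or> L = norm (c - b)"
    "x \<in> convex hull {a, b, c} \<Longrightarrow> y \<in> convex hull {a, b, c} \<Longrightarrow> norm (x - y) \<le> L"
proof -
  let ?T = "convex hull {a, b, c}"
  have "bounded ?T" by (intro bounded_convex_hull finite_imp_bounded) simp
  then have d: "norm (x - y) \<le> L" if "x \<in> ?T" "y \<in> ?T" for x y
    using diameter_bounded_bound[of ?T x y] that by (simp add: L_def dist_norm)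
  have v: "a \<in> ?T" "b \<in> ?T" "c \<in> ?T" by (auto intro: hull_inc)
  show 1: "norm (b - a) \<le> L" "norm (c - a) \<le> L" "norm (c - b) \<le> L" using d v by auto
  show "norm (x - y) \<le> L" if "x \<in> ?T" "y \<in> ?T" using d that .
  obtain u w where uw: "u \<in> {a, b, c}" "w \<in> {a, b, c}" "\<And>x y. x \<in> ?T \<Longrightarrow> y \<in> ?T \<Longrightarrow> norm (x - y) \<le> norm (u - w)"
    using simplex_extremal_le[of "{a, b, c}"] by blast
  have "L \<le> norm (u - w)" unfolding L_def by (rule diameter_le) (use uw in auto)
  moreover have "norm (u - w) \<le> L" using d uw v by auto
  ultimately have L: "L = norm (u - w)" by simp
  show "L = norm (b - a) \<or> L = norm (c - a) \<or> L = norm (c - b)"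
  proof (cases "u = w")
    case True
    then have "norm (b - a) = 0" using 1 L by (metis norm_ge_zero norm_zero order_antisym right_minus_eq)
    then show ?thesis using True L by simp
  next
    case False
    then show ?thesis using uw(1,2) L by (auto simp: norm_minus_commute)
  qed
qed

lemma triangle_area_ge:
  fixes a b c :: "real^2"
  assumes \<kappa>: "0 < \<kappa>" "\<kappa> \<le> 1"
    and ang: "small_cosine \<kappa> a b c" "small_cosine \<kappa> b a c" "small_cosine \<kappa> c a b"
  shows "sqrt \<kappa> / 2 * (diameter (convex hull {a, b, c}))\<^sup>2 \<le> \<bar>cross2 (b - a) (c - a)\<bar>"
proof -
  define L where "L = diameter (convex hull {a, b, c})"
  have L: "norm (b - a) \<le> L" "norm (c - a) \<le> L" "norm (c - b) \<le> L"
    "norm (a - b) \<le> L" "norm (a - c) \<le> L" "norm (b - c) \<le> L"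
    using triangle_diameter(1-3)[where a = a and b = b and c = c] by (simp_all add: L_def norm_minus_commute)
  have core: "sqrt \<kappa> / 2 * L\<^sup>2 \<le> \<bar>cross2 (y - x) (z - x)\<bar>"
    if "L = norm (y - x)" "norm (z - x) \<le> L" "norm (z - y) \<le> L" "small_cosine \<kappa> x y z" "small_cosine \<kappa> y x z"
    for x y z
  proof -
    have "sqrt \<kappa> / 2 * (norm (y - x))\<^sup>2 \<le> \<bar>cross2 (y - x) (z - x)\<bar>"
      using that \<kappa> by (intro cross2_ge_of_longest_side) (auto simp: small_cosine_def norm_minus_commute)
    then show ?thesis using that by simp
  qed
  have sym: "small_cosine \<kappa> z x y" if "small_cosine \<kappa> z y x" for x y z
    using that by (simp add: small_cosine_def inner_commute mult.commute mult.left_commute)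
  have c: "cross2 (c - a) (b - a) = - cross2 (b - a) (c - a)" "cross2 (c - b) (a - b) = cross2 (b - a) (c - a)"
    by (simp_all add: cross2_def algebra_simps)
  consider "L = norm (b - a)" | "L = norm (c - a)" | "L = norm (c - b)"
    using triangle_diameter(4)[where a = a and b = b and c = c] unfolding L_def by blast
  then have "sqrt \<kappa> / 2 * L\<^sup>2 \<le> \<bar>cross2 (b - a) (c - a)\<bar>"
  proof cases
    case 1
    then show ?thesis using core[of b a c] L ang by simp
  next
    case 2
    then show ?thesis using core[of c a b] L ang sym c by simp
  next
    case 3
    then show ?thesis using core[of c b a] L ang sym c by simp
  qed
  then show ?thesis by (simp add: L_def)
qed

text \<open>
  Shape regularity in the form in which it is used: the area is bounded below by the square of the
  diameter.
\<close>

definition thick :: "real \<Rightarrow> real^2 \<Rightarrow> real^2 \<Rightarrow> real^2 \<Rightarrow> bool" where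
  "thick \<mu> a b c \<longleftrightarrow> cross2 (b - a) (c - a) \<noteq> 0 \<and>
     \<mu> * (diameter (convex hull {a, b, c}))\<^sup>2 \<le> \<bar>cross2 (b - a) (c - a)\<bar>"

lemma thick_diameter:
  assumes "thick \<mu> a b c"
  shows "0 < diameter (convex hull {a, b, c})" "\<mu> * diameter (convex hull {a, b, c}) \<le> norm (b - a)"
proof -
  let ?L = "diameter (convex hull {a, b, c})"
  note d = triangle_diameter(1-3)[where a = a and b = b and c = c]
  have "a \<noteq> b" using assms by (auto simp: thick_def cross2_def)
  then have "0 < norm (b - a)" by simp
  then show L: "0 < ?L" using d(1) by linarith
  have "\<bar>cross2 (b - a) (c - a)\<bar> \<le> norm (b - a) * ?L"
    using abs_cross2_le[of "b - a" "c - a"] mult_left_mono[OF d(2), of "norm (b - a)"] by simp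
  then have "\<mu> * ?L * ?L \<le> norm (b - a) * ?L" using assms by (simp add: thick_def power2_eq_square)
  then show "\<mu> * ?L \<le> norm (b - a)" using L by (simp add: mult_le_cancel_right)
qed

text \<open>
  How far a displacement \<open>y\<close> can change a barycentric coordinate, \<open>z\<close> being the opposite side.
\<close>

lemma thick_quotient_le:
  assumes "thick \<mu> a b c" "0 < \<mu>" "norm y \<le> \<mu> * diameter (convex hull {a, b, c}) / k" "0 < k"
    and z: "norm z \<le> diameter (convex hull {a, b, c})"
  shows "\<bar>cross2 y z / cross2 (b - a) (c - a)\<bar> \<le> 1 / k"
proof -
  let ?L = "diameter (convex hull {a, b, c})"
  have D: "cross2 (b - a) (c - a) \<noteq> 0" using assms by (simp add: thick_def)
  have "\<bar>cross2 y z\<bar> \<le> (\<mu> * ?L / k) * ?L"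
    using abs_cross2_le[of y z] mult_mono[OF assms(3) z] thick_diameter(1)[OF assms(1)] assms(2,4) by simp
  also have "\<dots> = \<mu> * ?L\<^sup>2 / k" by (simp add: power2_eq_square)
  also have "\<dots> \<le> \<bar>cross2 (b - a) (c - a)\<bar> / k"
    using assms by (intro divide_right_mono) (auto simp: thick_def)
  finally show ?thesis using D \<open>0 < k\<close> by (simp add: field_simps)
qed

text \<open>
  All barycentric coordinates are \<open>1 / 3\<close> at the centroid and change by at most \<open>1 / 3\<close> on the disc.
\<close>

lemma cball_centroid_subset:
  assumes t: "thick \<mu> a b c" "0 < \<mu>"
  shows "cball ((1 / 3) *\<^sub>R (a + b + c)) (\<mu> * diameter (convex hull {a, b, c}) / 3) \<subseteq> convex hull {a, b, c}"
proof
  let ?L = "diameter (convex hull {a, b, c})" and ?g = "(1 / 3) *\<^sub>R (a + b + c)" and ?D = "cross2 (b - a) (c - a)"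
  note d = triangle_diameter(1-3)[where a = a and b = b and c = c]
  have D: "?D \<noteq> 0" using t by (simp add: thick_def)
  fix x assume "x \<in> cball ?g (\<mu> * ?L / 3)"
  define y where "y = x - ?g"
  have y: "norm y \<le> \<mu> * ?L / 3"
    using \<open>x \<in> _\<close> by (simp add: y_def dist_norm norm_minus_commute)
  have b: "\<bar>cross2 y z / ?D\<bar> \<le> 1 / 3" if "norm z \<le> ?L" for z
    by (rule thick_quotient_le[OF t y _ that]) simp
  have x: "x = ?g + y" by (simp add: y_def)
  have "3 * cross2 (x - a) (c - a) = ?D + 3 * cross2 y (c - a)"
    "3 * cross2 (b - a) (x - a) = ?D - 3 * cross2 y (b - a)"
    unfolding x by (simp_all add: cross2_def algebra_simps add_divide_distrib diff_divide_distrib)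
  then have s: "cross2 (x - a) (c - a) / ?D = 1 / 3 + cross2 y (c - a) / ?D"
    "cross2 (b - a) (x - a) / ?D = 1 / 3 - cross2 y (b - a) / ?D"
    using D by (simp_all add: field_simps)
  have "cross2 y (c - a) / ?D - cross2 y (b - a) / ?D = cross2 y (c - b) / ?D"
    unfolding diff_divide_distrib[symmetric] by (simp add: cross2_def algebra_simps)
  then show "x \<in> convex hull {a, b, c}"
    unfolding mem_triangle_iff[OF D] s using b[OF d(1)] b[OF d(2)] b[OF d(3)] by (intro conjI; linarith)
qed

text \<open>
  At the midpoint of a side two barycentric coordinates equal \<open>1 / 2\<close>, and they stay nonnegative on the
  disc; the third one is nonnegative on the side of the edge where the triangle lies.
\<close>

lemma half_ball_midpoint_subset:
  assumes t: "thick \<mu> a b c" "0 < \<mu>" and x: "dist (midpoint a b) x \<le> \<mu> * diameter (convex hull {a, b, c}) / 2"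
    and side: "0 \<le> cross2 (b - a) (x - a) / cross2 (b - a) (c - a)"
  shows "x \<in> convex hull {a, b, c}"
proof -
  let ?L = "diameter (convex hull {a, b, c})" and ?D = "cross2 (b - a) (c - a)"
  note d = triangle_diameter(1-3)[where a = a and b = b and c = c]
  have D: "?D \<noteq> 0" using t by (simp add: thick_def)
  define y where "y = x - midpoint a b"
  have y: "norm y \<le> \<mu> * ?L / 2" using x by (simp add: y_def dist_norm norm_minus_commute)
  have b: "\<bar>cross2 y z / ?D\<bar> \<le> 1 / 2" if "norm z \<le> ?L" for z
    by (rule thick_quotient_le[OF t y _ that]) simp
  have x: "x = (1 / 2) *\<^sub>R (a + b) + y" by (simp add: y_def midpoint_def)
  have e: "cross2 (x - a) (c - a) = ?D / 2 + cross2 y (c - a)"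
    "cross2 (x - a) (c - a) + cross2 (b - a) (x - a) = ?D / 2 + cross2 y (c - b)"
    unfolding x by (simp_all add: cross2_def algebra_simps add_divide_distrib diff_divide_distrib)
  have s: "cross2 (x - a) (c - a) / ?D = 1 / 2 + cross2 y (c - a) / ?D"
    "cross2 (x - a) (c - a) / ?D + cross2 (b - a) (x - a) / ?D = 1 / 2 + cross2 y (c - b) / ?D"
    using arg_cong[OF e(1), of "\<lambda>z. z / ?D"] arg_cong[OF e(2), of "\<lambda>z. z / ?D"] D
    by (simp_all add: add_divide_distrib)
  show ?thesis
    unfolding mem_triangle_iff[OF D] using side s b[OF d(2)] b[OF d(3)] by (intro conjI; linarith)
qed

lemma cross2_closed_segment:
  assumes "x \<in> closed_segment a b"
  shows "cross2 (b - a) (x - a) = 0"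
proof -
  obtain u where "x = (1 - u) *\<^sub>R a + u *\<^sub>R b" using assms by (auto simp: in_segment)
  then have "x - a = u *\<^sub>R (b - a)" by (simp add: algebra_simps)
  then show ?thesis by (simp add: cross2_scale_right cross2_self)
qed

text \<open>
  If both triangles lay on the same side of their common edge, a point of the first one close to the
  midpoint but off the edge would belong to the second one as well.
\<close>

lemma adjacent_triangles_opposite:
  assumes c: "thick \<mu> a b c" and d: "thick \<mu> a b d" and \<mu>: "0 < \<mu>"
    and int: "convex hull {a, b, c} \<inter> convex hull {a, b, d} = closed_segment a b"
  shows "sgn (cross2 (b - a) (d - a)) = - sgn (cross2 (b - a) (c - a))"
proof (rule ccontr)
  let ?C = "cross2 (b - a) (c - a)" and ?D = "cross2 (b - a) (d - a)"
  assume "sgn ?D \<noteq> - sgn ?C"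
  moreover have nz: "?C \<noteq> 0" "?D \<noteq> 0" using c d by (auto simp: thick_def)
  ultimately have pos: "0 < ?C / ?D"
    by (auto simp: sgn_if zero_less_divide_iff split: if_splits)
  let ?r = "\<mu> * diameter (convex hull {a, b, d}) / 2"
  have r: "0 < ?r" using thick_diameter(1)[OF d] \<mu> by simp
  define \<epsilon> where "\<epsilon> = min 1 (?r / (norm (c - midpoint a b) + 1))"
  have \<epsilon>: "0 < \<epsilon>" "\<epsilon> \<le> 1" using r by (auto simp: \<epsilon>_def divide_pos_pos add_nonneg_pos)
  have "\<epsilon> * norm (c - midpoint a b) \<le> ?r / (norm (c - midpoint a b) + 1) * (norm (c - midpoint a b) + 1)"
    using r by (intro mult_mono) (auto simp: \<epsilon>_def)
  also have "\<dots> = ?r"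
  proof -
    have "norm (c - midpoint a b) + 1 \<noteq> 0" using norm_ge_zero[of "c - midpoint a b"] by linarith
    then have "k / (norm (c - midpoint a b) + 1) * (norm (c - midpoint a b) + 1) = k" for k by simp
    then show ?thesis .
  qed
  finally have near: "\<epsilon> * norm (c - midpoint a b) \<le> ?r" .
  define x where "x = (1 - \<epsilon>) *\<^sub>R midpoint a b + \<epsilon> *\<^sub>R c"
  have xm: "x - midpoint a b = \<epsilon> *\<^sub>R (c - midpoint a b)" by (simp add: x_def algebra_simps)
  have "midpoint a b \<in> convex hull {a, b}"
    using midpoint_in_closed_segment[of a b] by (simp add: segment_convex_hull)
  then have "midpoint a b \<in> convex hull {a, b, c}"
    using hull_mono[of "{a, b}" "{a, b, c}" convex] by auto
  moreover have "c \<in> convex hull {a, b, c}" by (simp add: hull_inc)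
  ultimately have xc: "x \<in> convex hull {a, b, c}"
    unfolding x_def using \<epsilon> by (intro convexD) auto
  have cx: "cross2 (b - a) (x - a) = \<epsilon> * ?C"
    by (simp add: x_def midpoint_def cross2_def algebra_simps add_divide_distrib diff_divide_distrib)
  have "x \<in> convex hull {a, b, d}"
  proof (rule half_ball_midpoint_subset[OF d \<mu>])
    show "dist (midpoint a b) x \<le> ?r"
      using near xm \<epsilon> by (simp add: dist_norm norm_minus_commute)
    show "0 \<le> cross2 (b - a) (x - a) / ?D" unfolding cx using pos \<epsilon>
      by (metis less_imp_le mult_pos_pos times_divide_eq_right)
  qed
  then have "cross2 (b - a) (x - a) = 0" using xc int cross2_closed_segment by blast
  then show False using cx nz \<epsilon> by simp
qed

lemma orthogonal_multiple_of_rot: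
  assumes "d \<bullet> p = 0" "p \<noteq> 0"
  shows "d = ((d \<bullet> rot p) / (norm p)\<^sup>2) *\<^sub>R rot p"
proof -
  have "d $ 1 * (p $ 1)\<^sup>2 + d $ 1 * (p $ 2)\<^sup>2 = - (d \<bullet> rot p) * p $ 2"
    "d $ 2 * (p $ 1)\<^sup>2 + d $ 2 * (p $ 2)\<^sup>2 = (d \<bullet> rot p) * p $ 1"
    using assms(1) unfolding inner_2 rot_def
    by (simp_all add: power2_eq_square) algebra+
  then have "(norm p)\<^sup>2 *\<^sub>R d = (d \<bullet> rot p) *\<^sub>R rot p"
    unfolding power2_norm_eq_inner inner_2 by (simp add: vec_eq_iff forall_2 rot_def power2_eq_square algebra_simps)
  then have "(1 / (norm p)\<^sup>2) *\<^sub>R ((norm p)\<^sup>2 *\<^sub>R d) = (1 / (norm p)\<^sup>2) *\<^sub>R ((d \<bullet> rot p) *\<^sub>R rot p)" by simp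
  then show ?thesis using assms(2) by simp
qed

text \<open>
  A unit vector that makes a nonpositive product with both directions of the edge is orthogonal to it,
  which leaves two candidates; the opposite vertex selects one.
\<close>

lemma outer_normal_triangle:
  assumes D: "cross2 (b - a) (c - a) \<noteq> 0"
  defines "n \<equiv> (- sgn (cross2 (b - a) (c - a)) / norm (b - a)) *\<^sub>R rot (b - a)"
  shows "outer_normal (convex hull {a, b, c}) (closed_segment a b) = n"
    and "norm n = 1"
    and "x \<in> closed_segment a b \<Longrightarrow> y \<in> convex hull {a, b, c} \<Longrightarrow> n \<bullet> (y - x) \<le> 0"
proof -
  let ?D = "cross2 (b - a) (c - a)" and ?p = "b - a"
  have p: "?p \<noteq> 0" using D by (auto simp: cross2_def)
  show n1: "norm n = 1" using p D by (simp add: n_def norm_rot abs_sgn_eq)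
  have nz: "n \<bullet> z = - (sgn ?D * cross2 ?p z) / norm ?p" for z
    by (simp add: n_def rot_inner)
  show n2: "n \<bullet> (y - x) \<le> 0" if "x \<in> closed_segment a b" "y \<in> convex hull {a, b, c}" for x y
  proof -
    have "cross2 ?p (y - x) = cross2 ?p (y - a) - cross2 ?p (x - a)"
      by (simp add: cross2_def algebra_simps)
    also have "\<dots> = cross2 ?p (y - a)" using cross2_closed_segment[OF that(1)] by simp
    finally have e: "cross2 ?p (y - x) = cross2 ?p (y - a)" .
    have "0 \<le> cross2 ?p (y - a) / ?D" using that(2) unfolding mem_triangle_iff[OF D] by blast
    then have "0 \<le> sgn ?D * cross2 ?p (y - a)"
      by (auto simp: sgn_if zero_le_divide_iff)
    then show ?thesis unfolding nz e by simp
  qed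
  have v: "a \<in> convex hull {a, b, c}" "b \<in> convex hull {a, b, c}" "c \<in> convex hull {a, b, c}"
    by (auto intro: hull_inc)
  show "outer_normal (convex hull {a, b, c}) (closed_segment a b) = n"
    unfolding outer_normal_def
  proof (rule the_equality)
    fix m assume m: "norm m = 1 \<and> (\<forall>x\<in>closed_segment a b. \<forall>y\<in>convex hull {a, b, c}. m \<bullet> (y - x) \<le> 0)"
    then have "m \<bullet> (b - a) \<le> 0" "m \<bullet> (a - b) \<le> 0" and mc: "m \<bullet> (c - a) \<le> 0" using v by auto
    then have "m \<bullet> ?p = 0" by (simp add: inner_diff_right)
    then have mr: "m = ((m \<bullet> rot ?p) / (norm ?p)\<^sup>2) *\<^sub>R rot ?p" using p by (rule orthogonal_multiple_of_rot)
    define k where "k = (m \<bullet> rot ?p) / (norm ?p)\<^sup>2"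
    have mk: "m = k *\<^sub>R rot ?p" using mr by (simp add: k_def)
    have "\<bar>k\<bar> * norm ?p = 1" using m mk by (metis norm_rot norm_scaleR)
    then have k: "\<bar>k\<bar> = 1 / norm ?p" using p by (simp add: field_simps)
    have "k * ?D \<le> 0" using mc mk by (simp add: rot_inner)
    then have "k = - sgn ?D * \<bar>k\<bar>" using D by (auto simp: sgn_if mult_le_0_iff abs_if split: if_splits)
    then show "m = n" using mk k by (simp add: n_def)
  qed (use n1 n2 in blast)
qed

lemma P1_gradient_eq:
  assumes u: "\<And>x. x \<in> T \<Longrightarrow> u x = c + q \<bullet> x" and T: "interior T \<noteq> {}"
  shows "P1_gradient T u = q"
  unfolding P1_gradient_def
proof (rule the_equality)
  fix r assume "\<exists>c. \<forall>x\<in>T. u x = c + r \<bullet> x"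
  then obtain c' where r: "\<And>x. x \<in> T \<Longrightarrow> u x = c' + r \<bullet> x" by blast
  obtain z e where ze: "0 < e" "cball z e \<subseteq> T"
    using T by (meson all_not_in_conv mem_interior_cball)
  show "r = q"
  proof (rule ccontr)
    assume "r \<noteq> q"
    define y where "y = z + (e / norm (r - q)) *\<^sub>R (r - q)"
    have y: "y \<in> T" "z \<in> T" using ze \<open>r \<noteq> q\<close> by (auto simp: y_def dist_norm intro!: subsetD[OF ze(2)])
    have "(r - q) \<bullet> (y - z) = 0" using u[OF y(1)] u[OF y(2)] r[OF y(1)] r[OF y(2)]
      by (simp add: inner_diff_left inner_diff_right)
    then have "e / norm (r - q) * (norm (r - q))\<^sup>2 = 0" by (simp add: y_def power2_norm_eq_inner)
    then show False using ze(1) \<open>r \<noteq> q\<close> by simp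
  qed
qed (use u in blast)

section \<open>Shape-regular meshes\<close>

text \<open>
  An angle of at least \<open>\<theta>\<close> bounds its cosine away from \<open>1\<close>; the truncations make the bound
  meaningful for every \<open>\<theta> > 0\<close>, including those that no triangle attains.
\<close>

definition cosine_gap :: "real \<Rightarrow> real" where
  "cosine_gap \<theta> = 1 - max 0 (cos (min \<theta> pi))"

definition thickness :: "real \<Rightarrow> real" where
  "thickness \<theta> = sqrt (cosine_gap \<theta>) / 2"

lemma cosine_gap_bounds:
  assumes "0 < \<theta>"
  shows "0 < cosine_gap \<theta>" "cosine_gap \<theta> \<le> 1"
proof -
  have "cos (min \<theta> pi) < cos 0" using assms by (intro cos_monotone_0_pi) auto
  then show "0 < cosine_gap \<theta>" by (simp add: cosine_gap_def)
  show "cosine_gap \<theta> \<le> 1" by (simp add: cosine_gap_def)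
qed

lemma thickness_bounds:
  assumes "0 < \<theta>"
  shows "0 < thickness \<theta>" "thickness \<theta> \<le> 1 / 2"
  using cosine_gap_bounds[OF assms] by (auto simp: thickness_def)

lemma small_cosine_of_angle:
  assumes \<theta>: "0 < \<theta>" "\<theta> \<le> angle_at z a b" and ne: "a \<noteq> z" "b \<noteq> z"
  shows "small_cosine (cosine_gap \<theta>) z a b"
proof -
  let ?N = "norm (a - z) * norm (b - z)"
  let ?y = "((a - z) \<bullet> (b - z)) / ?N"
  have N: "0 < ?N" using ne by simp
  have "\<bar>(a - z) \<bullet> (b - z)\<bar> \<le> ?N" by (rule Cauchy_Schwarz_ineq2)
  then have y: "- 1 \<le> ?y" "?y \<le> 1" using N by (simp_all add: pos_le_divide_eq pos_divide_le_eq abs_le_iff)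
  have "cos (arccos ?y) \<le> cos (min \<theta> pi)"
    using \<theta> arccos_ubound[OF y] by (intro cos_monotone_0_pi_le) (auto simp: angle_at_def)
  then have "?y \<le> 1 - cosine_gap \<theta>" using y by (simp add: cos_arccos cosine_gap_def)
  then show ?thesis using N by (simp add: small_cosine_def pos_divide_le_eq mult.assoc)
qed

lemma vertices_convex_hull: "\<not> affine_dependent C \<Longrightarrow> vertices (convex hull C) = C"
  by (auto simp: vertices_def extreme_point_of_convex_hull_affine_independent)

lemma mesh_triangle:
  assumes "conforming_mesh \<Omega> \<T>" "T \<in> \<T>"
  obtains C where "\<not> affine_dependent C" "card C = 3" "T = convex hull C" "vertices T = C"
  using assms vertices_convex_hull by (auto simp: conforming_mesh_def simplex_def)

lemma thick_of_shape_regular: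
  assumes \<theta>: "0 < \<theta>" and s: "shape_regular \<theta> \<T>" and T: "T \<in> \<T>" "T = convex hull {a, b, c}" "vertices T = {a, b, c}"
    and d: "card {a, b, c} = 3"
  shows "thick (thickness \<theta>) a b c"
proof -
  have ne: "a \<noteq> b" "a \<noteq> c" "b \<noteq> c" using d by (auto simp: card_insert_if split: if_splits)
  have ang: "small_cosine (cosine_gap \<theta>) z x y" if "z \<in> {a, b, c}" "x \<in> {a, b, c} - {z}" "y \<in> {a, b, c} - {z, x}" for z x y
  proof (rule small_cosine_of_angle[OF \<theta>])
    show "\<theta> \<le> angle_at z x y" using s T(1) that unfolding shape_regular_def T(3)[symmetric] by blast
  qed (use that in auto)
  have ge: "thickness \<theta> * (diameter (convex hull {a, b, c}))\<^sup>2 \<le> \<bar>cross2 (b - a) (c - a)\<bar>"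
    unfolding thickness_def
    by (rule triangle_area_ge[OF cosine_gap_bounds[OF \<theta>]]; rule ang) (use ne in auto)
  have "0 < norm (b - a)" using ne by simp
  also have "\<dots> \<le> diameter (convex hull {a, b, c})" by (rule triangle_diameter(1))
  finally have "0 < thickness \<theta> * (diameter (convex hull {a, b, c}))\<^sup>2"
    using thickness_bounds[OF \<theta>] by simp
  then show ?thesis using ge by (auto simp: thick_def)
qed

lemma mesh_triangle_thick:
  assumes "0 < \<theta>" "conforming_mesh \<Omega> \<T>" "shape_regular \<theta> \<T>" "T \<in> \<T>"
  obtains a b c where "T = convex hull {a, b, c}" "thick (thickness \<theta>) a b c"
proof -
  obtain C where C: "card C = 3" "T = convex hull C" "vertices T = C"
    using mesh_triangle[OF assms(2,4)] by blast
  obtain a b c where abc: "C = {a, b, c}" using C(1) by (auto simp: card_3_iff)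
  show ?thesis
    using that[of a b c] thick_of_shape_regular[OF assms(1,3,4), of a b c] C unfolding abc by blast
qed

text \<open>
  A face of a simplex is spanned by a subset of its vertices, here by two of them.
\<close>

lemma edge_endpoints:
  assumes C: "\<not> affine_dependent C" "card C = 3" and e: "e face_of (convex hull C)" "aff_dim e = 1"
  obtains a b c where "C = {a, b, c}" "e = convex hull {a, b}" "\<not> affine_dependent {a, b}"
proof -
  obtain B where B: "B \<subseteq> C" "e = convex hull B" using e(1) face_of_convex_hull_affine_independent[OF C(1)] by blast
  have Bi: "\<not> affine_dependent B" using affine_independent_subset[OF C(1) B(1)] .
  have "int (card B) = 2" using aff_dim_affine_independent[OF Bi] e(2) B(2) by (simp add: aff_dim_convex_hull)
  then obtain a b where ab: "B = {a, b}" "a \<noteq> b" by (auto simp: card_2_iff)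
  have "card (C - B) = 1"
    using C(2) B(1) ab by (simp add: card_Diff_subset)
  then obtain c where "C - B = {c}" by (auto simp: card_1_singleton_iff)
  then have "C = {a, b, c}" using B(1) ab by auto
  then show ?thesis using that B(2) Bi ab by blast
qed

lemma mesh_interior_edge:
  assumes \<theta>: "0 < \<theta>" and m: "conforming_mesh \<Omega> \<T>" "shape_regular \<theta> \<T>"
    and T: "Tp \<in> \<T>" "Tm \<in> \<T>" and e: "e \<in> interior_edges \<Omega> \<T>" "e = Tp \<inter> Tm"
  obtains a b c d where "Tp = convex hull {a, b, c}" "Tm = convex hull {a, b, d}" "e = closed_segment a b"
    "thick (thickness \<theta>) a b c" "thick (thickness \<theta>) a b d"
proof -
  obtain P where P: "\<not> affine_dependent P" "card P = 3" "Tp = convex hull P" "vertices Tp = P"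
    using mesh_triangle[OF m(1) T(1)] .
  obtain M where M: "\<not> affine_dependent M" "card M = 3" "Tm = convex hull M" "vertices Tm = M"
    using mesh_triangle[OF m(1) T(2)] .
  have "e face_of Tp" "e face_of Tm"
    using m(1) T e(2) by (auto simp: conforming_mesh_def triangulation_def) (metis Int_commute)
  moreover have d: "aff_dim e = 1" using e(1) by (auto simp: interior_edges_def edge_of_def)
  ultimately obtain a b c a' b' d where 1: "P = {a, b, c}" "e = convex hull {a, b}" "\<not> affine_dependent {a, b}"
    and 2: "M = {a', b', d}" "e = convex hull {a', b'}" "\<not> affine_dependent {a', b'}"
    using edge_endpoints[OF P(1,2)] edge_endpoints[OF M(1,2)] unfolding P(3) M(3) by metis
  \<comment> \<open>The edge is a face of both triangles, and its extreme points are the vertices in either description.\<close>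
  have "{a, b} = {a', b'}" using vertices_convex_hull[OF 1(3)] vertices_convex_hull[OF 2(3)] 1(2) 2(2) by simp
  then have M': "M = {a, b, d}" unfolding 2(1) by (metis insert_commute insert_is_Un Un_insert_left)
  show ?thesis
  proof (rule that)
    show "Tp = convex hull {a, b, c}" "Tm = convex hull {a, b, d}" using P(3) M(3) 1(1) M' by auto
    show "e = closed_segment a b" using 1(2) by (simp add: segment_convex_hull)
    show "thick (thickness \<theta>) a b c"
      by (rule thick_of_shape_regular[OF \<theta> m(2) T(1)]) (use P 1(1) in auto)
    show "thick (thickness \<theta>) a b d"
      by (rule thick_of_shape_regular[OF \<theta> m(2) T(2)]) (use M M' in auto)
  qed
qed

text \<open>
  The closed cells may touch the boundary of the domain, but as there are no slits the domain is the
  interior of their union.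
\<close>

lemma mesh_interior_subset:
  assumes "polygonal_domain \<Omega>" "conforming_mesh \<Omega> \<T>" "A \<subseteq> \<Union>\<T>"
  shows "interior A \<subseteq> \<Omega>"
  using interior_mono[OF assms(3)] assms(1,2) by (simp add: polygonal_domain_def conforming_mesh_def)

section \<open>Arc length of a segment\<close>

text \<open>
  Only the upper bound of the length is needed, for which a single cover at each scale suffices.
\<close>

lemma hausdorff1_closed_segment_le:
  fixes a b :: "'a::euclidean_space"
  assumes "a \<noteq> b"
  shows "hausdorff1 (closed_segment a b) \<le> ennreal (norm (b - a))"
  unfolding hausdorff1_def
proof (rule SUP_least)
  fix \<delta> :: real assume "\<delta> \<in> {0<..}"
  then have \<delta>: "0 < \<delta>" by simp
  let ?l = "norm (b - a)"
  obtain N :: nat where N: "?l / \<delta> < real N" using reals_Archimedean2 by blast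
  have "0 \<le> ?l / \<delta>" using \<delta> by simp
  then have N0: "0 < real N" using N by linarith
  have fine: "?l / real N \<le> \<delta>" using N N0 \<delta> by (simp add: field_simps)
  define \<gamma> where "\<gamma> t = a + t *\<^sub>R (b - a)" for t
  have \<gamma>: "\<gamma> t = \<gamma> t' \<longleftrightarrow> t = t'" for t t' using assms by (simp add: \<gamma>_def)
  \<comment> \<open>Half-open pieces, since covers have to be disjoint, and the end point separately.\<close>
  define I where "I i = (if i < N then {real i / real N ..< real (Suc i) / real N} else if i = N then {1} else {})" for i
  define A where "A i = \<gamma> ` I i" for i
  have low: "real i / real N \<le> t" if "t \<in> I i" for i t
    using that N0 by (auto simp: I_def split: if_splits)
  have up: "t < real (Suc i) / real N" if "t \<in> I i" for i t
    using that N0 by (auto simp: I_def split: if_splits)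
  have "I i \<inter> I j = {}" if "i < j" for i j
  proof (rule ccontr)
    assume "I i \<inter> I j \<noteq> {}"
    then obtain t where "t \<in> I i" "t \<in> I j" by blast
    then have "real j / real N < real (Suc i) / real N" using low[of t j] up[of t i] by linarith
    then show False using that N0 by (simp add: divide_less_cancel)
  qed
  then have I: "i = j" if "t \<in> I i" "t \<in> I j" for i j t
    using that by (cases i j rule: linorder_cases) blast+
  have disj: "disjoint_family A"
    unfolding disjoint_family_on_def
  proof (intro ballI impI)
    fix i j :: nat assume "i \<noteq> j"
    show "A i \<inter> A j = {}"
    proof (rule ccontr)
      assume "A i \<inter> A j \<noteq> {}"
      then obtain t t' where "t \<in> I i" "t' \<in> I j" "\<gamma> t = \<gamma> t'" by (auto simp: A_def)
      then show False using I[of t i j] \<gamma> \<open>i \<noteq> j\<close> by simp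
    qed
  qed
  have cover: "closed_segment a b \<subseteq> (\<Union>i. A i)"
  proof
    fix x assume "x \<in> closed_segment a b"
    then obtain t where t: "0 \<le> t" "t \<le> 1" and x: "x = \<gamma> t"
      by (auto simp: in_segment \<gamma>_def algebra_simps)
    define i where "i = nat \<lfloor>t * real N\<rfloor>"
    have i: "real i \<le> t * real N" "t * real N < real i + 1"
      using t N0 by (auto simp: i_def)
    have "t \<in> I i"
    proof (cases "t = 1")
      case True
      then show ?thesis by (simp add: i_def I_def)
    next
      case False
      then have "t * real N < real N" using t N0 by simp
      then have "i < N" using i(1) by linarith
      then show ?thesis using i N0 by (simp add: I_def field_simps)
    qed
    then show "x \<in> (\<Union>i. A i)" using x by (auto simp: A_def)
  qed
  have small: "small_diameter \<delta> (A i) \<le> (if i < N then ennreal (?l / real N) else 0)" for i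
  proof -
    let ?d = "if i < N then ?l / real N else 0"
    have dist: "norm (x - y) \<le> ?d" if xy: "x \<in> A i" "y \<in> A i" for x y
    proof -
      obtain t t' where t: "t \<in> I i" "t' \<in> I i" "x = \<gamma> t" "y = \<gamma> t'" using xy by (auto simp: A_def)
      show ?thesis
      proof (cases "i < N")
        case True
        have "\<bar>t - t'\<bar> \<le> real (Suc i) / real N - real i / real N"
          using low[OF t(1)] low[OF t(2)] up[OF t(1)] up[OF t(2)] by linarith
        also have "\<dots> = 1 / real N" by (simp add: diff_divide_distrib[symmetric])
        finally have "\<bar>t - t'\<bar> * ?l \<le> 1 / real N * ?l" by (intro mult_right_mono) auto
        moreover have "x - y = (t - t') *\<^sub>R (b - a)" unfolding t(3,4) \<gamma>_def by (simp add: algebra_simps)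
        ultimately show ?thesis using True by simp
      next
        case False
        then show ?thesis using t by (auto simp: I_def split: if_splits)
      qed
    qed
    have bd: "bounded (A i)"
    proof (cases "A i = {}")
      case False
      then obtain y where "y \<in> A i" by blast
      then have "A i \<subseteq> cball y ?d" using dist by (auto simp: dist_norm norm_minus_commute)
      then show ?thesis using bounded_subset bounded_cball by blast
    qed simp
    have le: "diameter (A i) \<le> ?d" by (rule diameter_le) (use dist N0 in auto)
    moreover have "?d \<le> \<delta>" using fine \<delta> by simp
    ultimately have "small_diameter \<delta> (A i) = ennreal (diameter (A i))"
      using bd by (simp add: small_diameter_def)
    also have "\<dots> \<le> ennreal ?d" using le by (rule ennreal_leI)
    also have "\<dots> = (if i < N then ennreal (?l / real N) else 0)" by simp
    finally show ?thesis .
  qed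
  have "outer_measure UNIV (small_diameter \<delta>) (closed_segment a b) \<le> (\<Sum>i. small_diameter \<delta> (A i))"
    unfolding outer_measure_def using disj cover by (intro INF_lower) auto
  also have "\<dots> \<le> (\<Sum>i. if i < N then ennreal (?l / real N) else 0)"
    by (intro suminf_le small) auto
  also have "\<dots> = (\<Sum>i<N. ennreal (?l / real N))"
    by (subst suminf_finite[of "{..<N}"]) auto
  also have "\<dots> = ennreal ?l"
    using N0 by (simp add: ennreal_of_nat_eq_real_of_nat flip: ennreal_mult)
  finally show "outer_measure UNIV (small_diameter \<delta>) (closed_segment a b) \<le> ennreal ?l" .
qed

lemma L2_norm_const_segment_le:
  assumes "a \<noteq> b"
  shows "L2_norm (restrict_space arc_length (closed_segment a b)) (\<lambda>_. J :: real) \<le> \<bar>J\<bar> * sqrt (norm (b - a))"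
proof -
  let ?e = "closed_segment a b"
  have e: "?e \<in> sets borel" by (simp add: borel_closed)
  have "space arc_length = UNIV" using sets_eq_imp_space_eq[OF sets_arc_length] by simp
  then have "measure (restrict_space arc_length ?e) (space (restrict_space arc_length ?e)) = measure arc_length ?e"
    using e by (simp add: measure_restrict_space space_restrict_space sets_arc_length)
  also have "\<dots> \<le> norm (b - a)"
    unfolding measure_def using hausdorff1_closed_segment_le[OF assms] e
    by (intro enn2real_leI) (auto simp: emeasure_arc_length)
  finally have m: "measure (restrict_space arc_length ?e) (space (restrict_space arc_length ?e)) \<le> norm (b - a)" .
  have "L2_norm (restrict_space arc_length ?e) (\<lambda>_. J)
      = sqrt (measure (restrict_space arc_length ?e) (space (restrict_space arc_length ?e)) * (J * J))"
    by (simp add: L2_norm_def L2_inner_def)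
  also have "\<dots> \<le> sqrt (norm (b - a) * (J * J))" by (intro real_sqrt_le_mono mult_right_mono m) simp
  also have "\<dots> = \<bar>J\<bar> * sqrt (norm (b - a))" by (simp add: real_sqrt_mult mult.commute)
  finally show ?thesis .
qed

section \<open>Local lower bounds\<close>

lemma L2_inner_const_gradient:
  assumes v: "v \<in> test_functions \<omega>" and m: "\<omega> \<in> sets lebesgue"
  shows "L2_inner (lebesgue_on \<omega>) (\<lambda>_. q) (gradient v) = 0"
proof -
  have i: "integrable (lebesgue_on \<omega>) (\<lambda>x. gradient v x $ i)" for i
  proof -
    obtain R where g0: "\<And>x. x \<notin> cball 0 R \<Longrightarrow> gradient v x = 0" using test_functionsD(5)[OF v] by blast
    have "integrable lborel (\<lambda>x. gradient v x $ i)"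
      by (rule integrable_compact_support[of _ R])
         (use C_1_D(3)[OF test_functionsD(1)[OF v]] g0 in \<open>auto intro!: continuous_intros\<close>)
    then show ?thesis by (rule integrable_lborel_on[OF _ m]) (use test_functionsD(4)[OF v] in auto)
  qed
  have "(\<integral>x. gradient v x $ i \<partial>lebesgue_on \<omega>) = 0" for i
    using integral_by_parts[OF C_k_const[of "Suc 0" 1] v m, of i] by simp
  then show ?thesis using i by (simp add: L2_inner_def inner_2)
qed

lemma content_cball_2: "0 \<le> r \<Longrightarrow> measure lborel (cball (c :: real^2) r) = pi * r\<^sup>2"
  using content_cball[of r c] by (simp add: unit_ball_vol_2)

lemma L2_norm_supported_le:
  fixes v :: "real^2 \<Rightarrow> 'b::euclidean_space"
  assumes v: "continuous_on UNIV v" "\<And>x. x \<notin> cball c \<rho> \<Longrightarrow> v x = 0" "\<And>x. x \<in> cball c \<rho> \<Longrightarrow> norm (v x) \<le> B"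
    and \<rho>: "0 \<le> \<rho>" "cball c \<rho> \<subseteq> \<omega>" "\<omega> \<in> sets lebesgue" and B: "0 \<le> B"
  shows "L2_norm (lebesgue_on \<omega>) v \<le> B * (sqrt pi * \<rho>)"
proof -
  let ?K = "cball c \<rho>"
  have m: "v \<in> borel_measurable (lebesgue_on ?K)" by (rule measurable_continuous_lebesgue_on[OF v(1)])
  note b = bounded_imp_L2_space[OF lmeasurable_cball m v(3) B]
  have e: "(\<lambda>x. if x \<in> ?K then v x else 0) = v" using v(2) by (auto simp: fun_eq_iff)
  have "L2_norm (lebesgue_on \<omega>) v = L2_norm (lebesgue_on ?K) v"
    using L2_norm_extend[OF b(1) _ \<rho>(3,2)] unfolding e by simp
  also have "\<dots> \<le> B * sqrt (measure lebesgue ?K)" by (rule b(2))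
  also have "\<dots> = B * (sqrt pi * \<rho>)" using \<rho>(1) by (simp add: content_cball_2 real_sqrt_mult)
  finally show ?thesis .
qed

text \<open>
  All lower bounds for test integrals come from one disc on which the integrand is bounded below.
\<close>

lemma integral_ge_on_cball:
  fixes g :: "real^2 \<Rightarrow> real"
  assumes g: "integrable (lebesgue_on \<omega>) g" "\<And>x. x \<in> \<omega> \<Longrightarrow> 0 \<le> g x" "\<And>x. x \<in> cball z r \<Longrightarrow> k \<le> g x"
    and r: "0 \<le> r" "cball z r \<subseteq> \<omega>" "\<omega> \<in> sets lebesgue"
  shows "k * (pi * r\<^sup>2) \<le> (\<integral>x. g x \<partial>lebesgue_on \<omega>)"
proof -
  let ?K = "cball z r"
  have ik: "integrable (lebesgue_on \<omega>) (\<lambda>x. if x \<in> ?K then k else 0)"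
    and vk: "(\<integral>x. (if x \<in> ?K then k else 0) \<partial>lebesgue_on \<omega>) = k * (pi * r\<^sup>2)"
  proof -
    have s: "(\<lambda>x. k *\<^sub>R (indicator ?K x :: real)) = (\<lambda>x. if x \<in> ?K then k else 0)"
      by (auto simp: indicator_def)
    have "integrable lebesgue (\<lambda>x. indicator ?K x :: real)"
      using lmeasurable_cball[of z r] by (intro integrable_real_indicator) (auto simp: fmeasurable_def)
    then have "integrable lebesgue (\<lambda>x. if x \<in> ?K then k else 0)"
      unfolding s[symmetric] by (intro integrable_scaleR_right)
    then have "integrable lebesgue (\<lambda>x. indicator \<omega> x *\<^sub>R (if x \<in> ?K then k else 0))"
      by (intro integrable_mult_indicator r)
    then show "integrable (lebesgue_on \<omega>) (\<lambda>x. if x \<in> ?K then k else 0)"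
      using r by (subst integrable_restrict_space) auto
    have "(\<integral>x. (if x \<in> ?K then k else 0) \<partial>lebesgue_on \<omega>) = (\<integral>x. k \<partial>lebesgue_on ?K)"
      using r by (intro integral_restrict) auto
    also have "\<dots> = k * (pi * r\<^sup>2)"
      using r by (simp add: measure_restrict_space content_cball_2)
    finally show "(\<integral>x. (if x \<in> ?K then k else 0) \<partial>lebesgue_on \<omega>) = k * (pi * r\<^sup>2)" .
  qed
  show ?thesis unfolding vk[symmetric]
    by (rule integral_mono[OF ik g(1)]) (use g(2,3) in auto)
qed

text \<open>
  The data that enter the residual: \<open>w\<close> stands for the discrete solution and \<open>s\<close> for the discrete
  multiplier.
\<close>

locale obstacle_residual =
  fixes \<Omega> :: "(real^2) set" and f s u w :: "real^2 \<Rightarrow> real" and \<sigma> :: "(real^2 \<Rightarrow> real) \<Rightarrow> real"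
  assumes \<Omega>: "open \<Omega>" "bounded \<Omega>"
    and f: "f \<in> L2_space (lebesgue_on \<Omega>)" and s: "s \<in> L2_space (lebesgue_on \<Omega>)"
    and u: "u \<in> H1 \<Omega>" and w: "w \<in> H1 \<Omega>" and \<sigma>: "multiplier \<Omega> f u \<sigma>"
begin

text \<open>The two error terms that carry no power of the mesh size.\<close>

definition err :: "(real^2) set \<Rightarrow> real" where
  "err \<omega> = H1_seminorm \<omega> (\<lambda>x. u x - w x) + Hm1_norm \<omega> (\<lambda>v. \<sigma> v - L2_inner (lebesgue_on \<Omega>) s v)"

lemma residual_le:
  assumes "open \<omega>" "\<omega> \<subseteq> \<Omega>" "v \<in> test_functions \<omega>" "L2_norm (lebesgue_on \<omega>) (gradient v) \<le> S" "0 < S"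
  shows "\<bar>L2_inner (lebesgue_on \<omega>) (\<lambda>x. f x - s x) v - L2_inner (lebesgue_on \<omega>) (weak_gradient \<Omega> w) (gradient v)\<bar> \<le> S * err \<omega>"
  unfolding err_def by (rule residual_bound[OF assms(1) \<Omega>(1) assms(2) \<Omega>(2) f s u w \<sigma> assms(3-5)])

lemma err_nonneg:
  assumes "open \<omega>" "\<omega> \<subseteq> \<Omega>"
  shows "0 \<le> err \<omega>"
proof -
  have "(\<lambda>x. 0) \<in> test_functions \<omega>" by (simp add: test_functions_def)
  from residual_le[OF assms this, of 1] show ?thesis by (simp add: L2_norm_def L2_inner_def)
qed

lemma weak_gradient_affine:
  assumes "open A" "A \<subseteq> \<Omega>" and aff: "\<And>x. x \<in> A \<Longrightarrow> w x = \<alpha> + q \<bullet> x"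
  shows "AE x in lebesgue_on A. weak_gradient \<Omega> w x = q"
proof (rule has_weak_gradient_unique[OF assms(1)])
  show "has_weak_gradient A w (weak_gradient \<Omega> w)"
    by (rule has_weak_gradient_subset[OF has_weak_gradient_weak_gradient[OF w] assms(1) \<Omega>(1) assms(2)])
  show "has_weak_gradient A w (\<lambda>_. q)"
    using assms(1) by (intro has_weak_gradient_affine[OF bounded_subset[OF \<Omega>(2) assms(2)] _ aff]) auto
qed

text \<open>
  The residual tested with a bump times \<open>p = k - s\<close>, an affine function whose modulus on the disc is at
  most \<open>M\<close> and, on a smaller disc, at least \<open>M / 8\<close>.  The energy of \<open>w\<close> drops out, because its gradient
  is constant where the test function lives.  The factor \<open>5\<close> collects \<open>1\<close> from the gradient of \<open>p\<close> and \<open>4\<close>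
  from that of the bump; \<open>4096\<close> is the product of the squares of \<open>8\<close> from \<open>M / 8\<close> and from the radius
  \<open>\<rho> / 8\<close> of the smaller disc.
\<close>

lemma affine_residual_le:
  assumes \<omega>: "open \<omega>" "\<omega> \<subseteq> \<Omega>" and A: "open A" "A \<subseteq> \<omega>" and \<rho>: "0 < \<rho>" "cball c \<rho> \<subseteq> A"
    and wA: "\<And>x. x \<in> A \<Longrightarrow> w x = \<alpha> + b \<bullet> x" and sA: "\<And>x. x \<in> A \<Longrightarrow> s x = \<beta> + q \<bullet> x"
    and fbar: "AE x in lebesgue_on A. fbar x = k"
  defines "M \<equiv> \<bar>k - s c\<bar> + norm q * \<rho>"
  shows "exp (-2) * pi / 4096 * (M * \<rho>\<^sup>2) \<le> 5 * sqrt pi * (err \<omega> + \<rho> * L2_norm (lebesgue_on A) (\<lambda>x. f x - fbar x))"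
proof (cases "M = 0")
  case True
  then show ?thesis using err_nonneg[OF \<omega>] \<rho> by simp
next
  case False
  have M: "0 < M" using False \<rho> by (auto simp: M_def add_nonneg_eq_0_iff less_le)
  have Am: "A \<in> sets lebesgue" and \<omega>m: "\<omega> \<in> sets lebesgue" and \<Omega>m: "\<Omega> \<in> sets lebesgue"
    using A \<omega> \<Omega> by auto
  let ?MA = "lebesgue_on A" and ?M = "lebesgue_on \<omega>"
  define p where "p x = (k - \<beta>) + (- q) \<bullet> x" for x
  have pC: "C_k j p" for j unfolding p_def [abs_def] by (rule C_k_affine)
  have pg: "gradient p x = - q" for x unfolding p_def [abs_def] by (rule gradient_affine)
  have pA: "p x = k - s x" if "x \<in> A" for x using sA[OF that] by (simp add: p_def)
  have cA: "c \<in> A" using \<rho> by auto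
  have pc: "p x = p c - q \<bullet> (x - c)" for x by (simp add: p_def inner_diff_right)
  have pM: "\<bar>p x\<bar> \<le> M" if "x \<in> cball c \<rho>" for x
  proof -
    have "\<bar>q \<bullet> (x - c)\<bar> \<le> norm q * norm (x - c)" by (rule Cauchy_Schwarz_ineq2)
    also have "\<dots> \<le> norm q * \<rho>" using that by (intro mult_left_mono) (auto simp: dist_norm norm_minus_commute)
    finally show ?thesis using pc[of x] pA[OF cA] by (simp add: M_def)
  qed
  define v where "v x = bump c \<rho> x * p x" for x
  have vA: "v \<in> test_functions A" unfolding v_def [abs_def] by (rule bump_times_in_test_functions[OF \<rho> pC])
  have v\<omega>: "v \<in> test_functions \<omega>" using vA test_functions_mono[OF A(2)] by blast
  have v0: "v x = 0" if "x \<notin> cball c \<rho>" for x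
    using that bump_eq_0_iff[OF \<rho>(1), of c x] by (auto simp: v_def)
  have g0: "gradient v x = 0" if "x \<notin> cball c \<rho>" for x
    by (rule gradient_eq_0_off_closed[of "cball c \<rho>"]) (use v0 that in auto)
  have vM: "norm (v x) \<le> M" if "x \<in> cball c \<rho>" for x
    using mult_mono[OF bump_bounds(2)[of c \<rho> x] pM[OF that]] bump_bounds(1)[of c \<rho> x]
    by (simp add: v_def abs_mult)
  have gM: "norm (gradient v x) \<le> 5 * M / \<rho>" if "x \<in> cball c \<rho>" for x
  proof -
    have "gradient v x = bump c \<rho> x *\<^sub>R (- q) + p x *\<^sub>R gradient (bump c \<rho>) x"
      unfolding v_def using gradient_mult[OF C_1_D(1)[OF C_k_bump] C_1_D(1)[OF pC]] by (simp add: pg)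
    then have "norm (gradient v x) \<le> norm (bump c \<rho> x *\<^sub>R (- q)) + norm (p x *\<^sub>R gradient (bump c \<rho>) x)"
      by (simp only: norm_triangle_ineq)
    also have "\<dots> = bump c \<rho> x * norm q + \<bar>p x\<bar> * norm (gradient (bump c \<rho>) x)"
      using bump_bounds(1)[of c \<rho> x] by simp
    also have "\<dots> \<le> 1 * norm q + M * (4 / \<rho>)"
      using M by (intro add_mono mult_mono bump_bounds pM that norm_gradient_bump \<rho>) auto
    also have "norm q \<le> M / \<rho>" using \<rho> by (simp add: M_def field_simps)
    finally show ?thesis using \<rho> by (simp add: field_simps)
  qed
  note vc = C_1_D(2,3)[OF test_functionsD(1)[OF vA]]
  have "L2_norm ?M (gradient v) \<le> 5 * M / \<rho> * (sqrt pi * \<rho>)"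
    using \<rho> A M by (intro L2_norm_supported_le[OF vc(2) g0 gM _ _ \<omega>m]) auto
  also have "\<dots> = 5 * sqrt pi * M" using \<rho> by simp
  finally have S: "L2_norm ?M (gradient v) \<le> 5 * sqrt pi * M" .
  have vL2: "L2_norm ?MA v \<le> M * (sqrt pi * \<rho>)"
    using \<rho> M by (intro L2_norm_supported_le[OF vc(1) v0 vM _ _ Am]) auto
  have wW: "weak_gradient \<Omega> w \<in> L2_space ?MA"
    using has_weak_gradientD(2)[OF has_weak_gradient_weak_gradient[OF w]] by (rule L2_space_subset) (use Am \<Omega>m A \<omega> in auto)
  have cq: "(\<lambda>_. b) \<in> L2_space ?MA"
    by (rule continuous_imp_L2_space) (use Am A \<omega> \<Omega> bounded_subset in \<open>auto intro: bounded_subset\<close>)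
  have "L2_inner ?M (weak_gradient \<Omega> w) (gradient v) = L2_inner ?MA (weak_gradient \<Omega> w) (gradient v)"
    by (rule L2_inner_extend[OF Am \<omega>m A(2)]) (use test_functionsD(4)[OF vA] in auto)
  also have "\<dots> = L2_inner ?MA (\<lambda>_. b) (gradient v)"
    by (rule L2_inner_cong_AE[OF wW test_function_L2(2)[OF vA Am] cq test_function_L2(2)[OF vA Am] weak_gradient_affine[OF A(1) _ wA]])
       (use A \<omega> in auto)
  also have "\<dots> = 0" by (rule L2_inner_const_gradient[OF vA Am])
  finally have w0: "L2_inner ?M (weak_gradient \<Omega> w) (gradient v) = 0" .
  have "L2_inner ?M (\<lambda>x. f x - s x) v = L2_inner ?MA (\<lambda>x. f x - s x) v"
    by (rule L2_inner_extend[OF Am \<omega>m A(2)]) (use test_functionsD(3)[OF vA] in auto)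
  then have r: "\<bar>L2_inner ?MA (\<lambda>x. f x - s x) v\<bar> \<le> 5 * sqrt pi * M * err \<omega>"
    using residual_le[OF \<omega> v\<omega> S] M w0 by simp
  have fsA: "f \<in> L2_space ?MA" "s \<in> L2_space ?MA"
    by (rule L2_space_subset[OF f]; use Am \<Omega>m A \<omega> in auto) (rule L2_space_subset[OF s]; use Am \<Omega>m A \<omega> in auto)
  have kL2: "(\<lambda>_. k) \<in> L2_space ?MA" "p \<in> L2_space ?MA"
    using C_1_D(2)[OF pC] Am A \<omega> \<Omega> by (auto intro!: continuous_imp_L2_space intro: bounded_subset)
  have fb: "fbar \<in> L2_space ?MA"
    by (rule L2_space_cong_AE_lebesgue[OF kL2(1) Am]) (use fbar in \<open>auto elim: eventually_mono\<close>)
  have ffb: "(\<lambda>x. f x - fbar x) \<in> L2_space ?MA" by (rule L2_space_diff[OF fsA(1) fb])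
  note vs = test_function_L2(1)[OF vA Am]
  have split: "L2_inner ?MA (\<lambda>x. f x - s x) v = L2_inner ?MA (\<lambda>x. f x - fbar x) v + L2_inner ?MA p v"
  proof -
    have "L2_inner ?MA (\<lambda>x. f x - fbar x) v + L2_inner ?MA p v = L2_inner ?MA (\<lambda>x. (f x - fbar x) + p x) v"
      using integrable_L2_inner[OF ffb vs] integrable_L2_inner[OF kL2(2) vs]
      by (simp add: L2_inner_def distrib_right)
    also have "\<dots> = L2_inner ?MA (\<lambda>x. f x - s x) v"
    proof (rule L2_inner_cong_AE[OF L2_space_add[OF ffb kL2(2)] vs L2_space_diff[OF fsA] vs])
      show "AE x in ?MA. f x - fbar x + p x = f x - s x"
        using fbar AE_space by eventually_elim (simp add: pA)
    qed simp
    finally show ?thesis by simp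
  qed
  have low: "exp (-2) * (M / 8)\<^sup>2 * (pi * (\<rho> / 8)\<^sup>2) \<le> L2_inner ?MA p v"
  proof -
    \<comment> \<open>The smaller disc is shifted in the direction in which the linear part of \<open>p\<close> has the sign of \<open>p c\<close>,
      so that both parts add up in modulus.\<close>
    define \<tau> :: real where "\<tau> = (if 0 \<le> p c then - 1 else 1)"
    define z where "z = c + (\<tau> * \<rho> / 4) *\<^sub>R sgn q"
    have zc: "norm (z - c) \<le> \<rho> / 4"
      using \<rho> by (simp add: z_def norm_sgn \<tau>_def)
    have near: "norm (x - c) \<le> 3 * \<rho> / 8" if "x \<in> cball z (\<rho> / 8)" for x
      using norm_triangle_ineq[of "x - z" "z - c"] zc that by (simp add: dist_norm norm_minus_commute)
    have big: "M / 8 \<le> \<bar>p x\<bar>" if "x \<in> cball z (\<rho> / 8)" for x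
    proof -
      have "q \<bullet> (z - c) = \<tau> * \<rho> / 4 * norm q"
        by (cases "q = 0") (simp_all add: z_def sgn_div_norm power2_norm_eq_inner[symmetric] power2_eq_square)
      then have "q \<bullet> (z - c) = \<tau> * (norm q * \<rho> / 4)" by (simp add: ac_simps)
      moreover have "q \<bullet> (x - c) = q \<bullet> (z - c) + q \<bullet> (x - z)" by (simp add: inner_diff_right)
      ultimately have 1: "q \<bullet> (x - c) = \<tau> * (norm q * \<rho> / 4) + q \<bullet> (x - z)" by simp
      have "\<bar>q \<bullet> (x - z)\<bar> \<le> norm q * (\<rho> / 8)"
        using that by (intro order_trans[OF Cauchy_Schwarz_ineq2] mult_left_mono) (auto simp: dist_norm norm_minus_commute)
      then have 2: "\<bar>q \<bullet> (x - z)\<bar> \<le> norm q * \<rho> / 8" by simp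
      have "\<bar>p c\<bar> + norm q * \<rho> / 8 \<le> \<bar>p x\<bar>"
      proof (cases "0 \<le> p c")
        case True
        then have "q \<bullet> (x - c) = - (norm q * \<rho> / 4) + q \<bullet> (x - z)" using 1 by (simp add: \<tau>_def)
        then show ?thesis using 2 pc[of x] True by linarith
      next
        case False
        then have "q \<bullet> (x - c) = norm q * \<rho> / 4 + q \<bullet> (x - z)" using 1 by (simp add: \<tau>_def)
        then show ?thesis using 2 pc[of x] False by linarith
      qed
      moreover have "\<bar>p c\<bar> = \<bar>k - s c\<bar>" using pA[OF cA] by simp
      moreover have "\<bar>k - s c\<bar> / 8 \<le> \<bar>k - s c\<bar>" by simp
      ultimately show ?thesis unfolding M_def add_divide_distrib by linarith
    qed
    show ?thesis unfolding L2_inner_def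
    proof (rule integral_ge_on_cball)
      show "integrable ?MA (\<lambda>x. p x \<bullet> v x)" by (rule integrable_L2_inner[OF kL2(2) vs])
      show "0 \<le> p x \<bullet> v x" for x
        using mult_nonneg_nonneg[OF bump_bounds(1)[of c \<rho> x] zero_le_square[of "p x"]]
        by (simp add: v_def mult.left_commute)
      show "exp (-2) * (M / 8)\<^sup>2 \<le> p x \<bullet> v x" if x: "x \<in> cball z (\<rho> / 8)" for x
      proof -
        have "exp (-2) \<le> bump c \<rho> x" by (rule bump_ge[OF \<rho>(1)]) (use near[OF x] \<rho> in simp)
        moreover have "(M / 8)\<^sup>2 \<le> \<bar>p x\<bar>\<^sup>2" using big[OF x] M by (intro power_mono) auto
        ultimately have "exp (-2) * (M / 8)\<^sup>2 \<le> bump c \<rho> x * \<bar>p x\<bar>\<^sup>2"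
          using bump_bounds(1)[of c \<rho> x] by (intro mult_mono) auto
        then show ?thesis by (simp add: v_def power2_eq_square mult.left_commute)
      qed
      show "cball z (\<rho> / 8) \<subseteq> A"
      proof
        fix x assume "x \<in> cball z (\<rho> / 8)"
        then have "x \<in> cball c \<rho>" using near[of x] \<rho> by (simp add: dist_norm norm_minus_commute)
        then show "x \<in> A" using \<rho> by blast
      qed
    qed (use \<rho> Am in auto)
  qed
  have "\<bar>L2_inner ?MA (\<lambda>x. f x - fbar x) v\<bar> \<le> L2_norm ?MA (\<lambda>x. f x - fbar x) * L2_norm ?MA v"
    by (rule L2_inner_le[OF ffb vs])
  also have "\<dots> \<le> L2_norm ?MA (\<lambda>x. f x - fbar x) * (M * (sqrt pi * \<rho>))"
    by (intro mult_left_mono vL2) simp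
  finally have osc: "\<bar>L2_inner ?MA (\<lambda>x. f x - fbar x) v\<bar> \<le> L2_norm ?MA (\<lambda>x. f x - fbar x) * (M * (sqrt pi * \<rho>))" .
  let ?N = "L2_norm ?MA (\<lambda>x. f x - fbar x)"
  have "exp (-2) * (M / 8)\<^sup>2 * (pi * (\<rho> / 8)\<^sup>2) \<le> 5 * sqrt pi * M * err \<omega> + ?N * (M * (sqrt pi * \<rho>))"
    using low r osc split by linarith
  also have "\<dots> \<le> 5 * sqrt pi * M * err \<omega> + 5 * (?N * (M * (sqrt pi * \<rho>)))"
    using M \<rho> by simp
  finally have "M * (exp (-2) * pi / 4096 * (M * \<rho>\<^sup>2)) \<le> M * (5 * sqrt pi * (err \<omega> + \<rho> * ?N))"
    by (simp add: power2_eq_square algebra_simps)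
  then show ?thesis using M by (simp only: mult_le_cancel_left_pos)
qed

text \<open>
  On the whole triangle \<open>p = k - s\<close> is at most \<open>M\<close> times the ratio \<open>6 / \<mu>\<close> of the diameter and the radius.
  Two more powers of that ratio appear when the square of the diameter, one factor of which comes from
  the area of the triangle, is traded for the square of the radius.  The gradient of \<open>s\<close> is that of \<open>p\<close>
  up to the sign, and \<open>M\<close> contains its norm times the radius.
\<close>

lemma triangle_estimate:
  assumes \<omega>: "open \<omega>" "\<omega> \<subseteq> \<Omega>" "interior T \<subseteq> \<omega>" and \<mu>: "0 < \<mu>" and T: "T = convex hull {a, b, d}" "thick \<mu> a b d"
    and wT: "P1_on T w" and sT: "P1_on T s" and fbar: "P0_on T fbar"
  defines "C \<equiv> sqrt pi * (6 / \<mu>) ^ 3 * (5 * sqrt pi / (exp (-2) * pi / 4096)) + 1"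
  shows "diameter T * L2_norm (lebesgue_on T) (\<lambda>x. f x - s x)
      \<le> C * (err \<omega> + diameter T * L2_norm (lebesgue_on T) (\<lambda>x. f x - fbar x))"
    and "(diameter T)\<^sup>2 * H1_seminorm (interior T) s
      \<le> C * (err \<omega> + diameter T * L2_norm (lebesgue_on T) (\<lambda>x. f x - fbar x))"
    and "(\<lambda>x. f x - fbar x) \<in> L2_space (lebesgue_on T)"
    and "(\<lambda>x. f x - s x) \<in> L2_space (lebesgue_on T)"
proof -
  define L where "L = diameter T"
  define A where "A = interior T"
  define c where "c = (1 / 3) *\<^sub>R (a + b + d)"
  \<comment> \<open>Half the radius of the disc around the centroid, so that the closed disc lies in the interior.\<close>
  define \<rho> where "\<rho> = \<mu> * L / 6"
  define c0 :: real where "c0 = exp (-2) * pi / 4096"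
  have L: "0 < L" using thick_diameter(1)[OF T(2)] by (simp add: L_def T(1))
  have \<rho>: "0 < \<rho>" "L = 6 / \<mu> * \<rho>" using L \<mu> by (auto simp: \<rho>_def)
  have c0: "0 < c0" by (simp add: c0_def)
  have \<mu>1: "\<mu> \<le> 1"
  proof -
    have "\<mu> * L \<le> norm (b - a)" using thick_diameter(2)[OF T(2)] by (simp add: L_def T(1))
    also have "\<dots> \<le> L" using triangle_diameter(1)[of b a d] by (simp add: L_def T(1))
    finally show ?thesis using L by simp
  qed
  have big: "cball c (2 * \<rho>) \<subseteq> T"
    using cball_centroid_subset[OF T(2) \<mu>] by (simp add: c_def \<rho>_def L_def T(1))
  have inA: "cball c \<rho> \<subseteq> A"
  proof -
    have "cball c \<rho> \<subseteq> ball c (2 * \<rho>)" using \<rho> by auto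
    also have "\<dots> \<subseteq> A" unfolding A_def by (rule interior_maximal) (use big ball_subset_cball in \<open>auto intro: subset_trans\<close>)
    finally show ?thesis .
  qed
  have AT: "A \<subseteq> T" "open A" by (auto simp: A_def interior_subset)
  have convT: "convex T" "compact T" by (auto simp: T(1) finite_imp_compact_convex_hull)
  have Tm: "T \<in> sets lebesgue" "A \<in> sets lebesgue" using AT convT by (auto dest: compact_imp_closed)
  have \<Omega>m: "\<Omega> \<in> sets lebesgue" using \<Omega> by auto
  have A\<Omega>: "A \<subseteq> \<Omega>" using \<omega> by (auto simp: A_def)
  have null: "negligible (T - A)" unfolding A_def by (rule negligible_diff_interior[OF convT(1)])
  have Tc: "T \<subseteq> cball c L"
  proof
    fix x assume "x \<in> T"
    moreover have "c \<in> T" using big \<rho> by auto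
    ultimately show "x \<in> cball c L"
      using triangle_diameter(5)[of c a b d x] by (simp add: T(1) L_def dist_norm)
  qed
  have areaT: "measure lebesgue T \<le> pi * L\<^sup>2"
    using measure_mono_fmeasurable[OF Tc Tm(1) lmeasurable_cball] content_cball_2[of L c] L by simp
  obtain \<alpha> bw where wA: "\<And>x. x \<in> T \<Longrightarrow> w x = \<alpha> + bw \<bullet> x" using wT by (auto simp: P1_on_def)
  obtain \<beta> q where sA: "\<And>x. x \<in> T \<Longrightarrow> s x = \<beta> + q \<bullet> x" using sT by (auto simp: P1_on_def)
  obtain k where kT: "AE x in lebesgue_on T. fbar x = k" using fbar by (auto simp: P0_on_def)
  have kA: "AE x in lebesgue_on A. fbar x = k"
    using kT Tm AT(1) by (auto simp: AE_restrict_space_iff elim!: eventually_mono)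
  define M where "M = \<bar>k - s c\<bar> + norm q * \<rho>"
  let ?E = "err \<omega>" and ?N = "L2_norm (lebesgue_on T) (\<lambda>x. f x - fbar x)"
  have fA: "f \<in> L2_space (lebesgue_on A)" "s \<in> L2_space (lebesgue_on A)"
    by (rule L2_space_subset[OF f Tm(2) \<Omega>m A\<Omega>], rule L2_space_subset[OF s Tm(2) \<Omega>m A\<Omega>])
  have bT: "bounded T" using convT(2) by (rule compact_imp_bounded)
  have fbT: "fbar \<in> L2_space (lebesgue_on T)"
    by (rule L2_space_cong_AE_lebesgue[OF continuous_imp_L2_space[OF continuous_on_const[of UNIV k] Tm(1) bT] Tm(1)])
       (use kT in \<open>auto elim: eventually_mono\<close>)
  have fT: "f \<in> L2_space (lebesgue_on T)" "s \<in> L2_space (lebesgue_on T)"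
    by (rule L2_space_negligible[OF fA(1) Tm(2) AT(1) null], rule L2_space_negligible[OF fA(2) Tm(2) AT(1) null])
  show ffb: "(\<lambda>x. f x - fbar x) \<in> L2_space (lebesgue_on T)" by (rule L2_space_diff[OF fT(1) fbT])
  show "(\<lambda>x. f x - s x) \<in> L2_space (lebesgue_on T)" by (rule L2_space_diff[OF fT])
  have "c0 * (M * \<rho>\<^sup>2) \<le> 5 * sqrt pi * (?E + \<rho> * L2_norm (lebesgue_on A) (\<lambda>x. f x - fbar x))"
    unfolding c0_def M_def
    by (rule affine_residual_le[OF \<omega>(1,2) AT(2) _ \<rho>(1) inA wA sA kA]) (use \<omega>(3) AT A_def in auto)
  also have "L2_norm (lebesgue_on A) (\<lambda>x. f x - fbar x) \<le> ?N"
    by (rule L2_norm_subset[OF ffb Tm(2) Tm(1) AT(1)])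
  also have "\<rho> * ?N \<le> L * ?N" using \<mu>1 L by (intro mult_right_mono) (auto simp: \<rho>_def)
  finally have "c0 * (M * \<rho>\<^sup>2) \<le> 5 * sqrt pi * (?E + L * ?N)" using \<rho> by simp
  then have M: "M * \<rho>\<^sup>2 \<le> 5 * sqrt pi / c0 * (?E + L * ?N)"
    using c0 by (simp add: field_simps)
  have E: "0 \<le> ?E" by (rule err_nonneg[OF \<omega>(1,2)])
  have N: "0 \<le> L * ?N" using L by simp
  have C: "C = sqrt pi * (6 / \<mu>) ^ 3 * (5 * sqrt pi / c0) + 1" by (simp add: C_def c0_def)
  have CM: "sqrt pi * (6 / \<mu>) ^ 3 * (M * \<rho>\<^sup>2) \<le> (C - 1) * (?E + L * ?N)"
    using mult_left_mono[OF M, of "sqrt pi * (6 / \<mu>) ^ 3"] \<mu> by (simp add: C mult.assoc)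
  have "1 \<le> 6 / \<mu>" using \<mu> \<mu>1 by simp
  define p where "p x = (k - \<beta>) + (- q) \<bullet> x" for x
  have pT: "p x = k - s x" if "x \<in> T" for x using sA[OF that] by (simp add: p_def)
  have pc: "continuous_on UNIV p" unfolding p_def by (intro continuous_intros)
  have M0: "0 \<le> M" using \<rho> by (simp add: M_def)
  have pM: "norm (p x) \<le> 6 / \<mu> * M" if x: "x \<in> T" for x
  proof -
    have "p x = p c - q \<bullet> (x - c)" by (simp add: p_def inner_diff_right)
    moreover have "\<bar>q \<bullet> (x - c)\<bar> \<le> norm q * L"
      using x Tc by (intro order_trans[OF Cauchy_Schwarz_ineq2] mult_left_mono) (auto simp: dist_norm norm_minus_commute)
    moreover have "p c = k - s c" using big \<rho> by (intro pT) auto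
    ultimately have "norm (p x) \<le> \<bar>k - s c\<bar> + norm q * L" by simp
    also have "\<dots> \<le> 6 / \<mu> * \<bar>k - s c\<bar> + norm q * (6 / \<mu> * \<rho>)"
      using mult_right_mono[OF \<open>1 \<le> 6 / \<mu>\<close>, of "\<bar>k - s c\<bar>"] \<rho>(2) by simp
    also have "\<dots> = 6 / \<mu> * M" by (simp add: M_def algebra_simps)
    finally show ?thesis .
  qed
  have lT: "T \<in> lmeasurable" using convT(2) by (rule lmeasurable_compact)
  note pL2 = bounded_imp_L2_space[OF lT measurable_continuous_lebesgue_on[OF pc] pM]
  have sqT: "sqrt (measure lebesgue T) \<le> sqrt pi * L"
    using real_sqrt_le_mono[OF areaT] L by (simp add: real_sqrt_mult)
  have "L2_norm (lebesgue_on T) p \<le> 6 / \<mu> * M * sqrt (measure lebesgue T)"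
    by (rule pL2(2)) (use M0 \<mu> in auto)
  also have "\<dots> \<le> 6 / \<mu> * M * (sqrt pi * L)"
    by (rule mult_left_mono[OF sqT]) (use M0 \<mu> in auto)
  finally have "L * L2_norm (lebesgue_on T) p \<le> L * (6 / \<mu> * M * (sqrt pi * L))"
    using L by (intro mult_left_mono) auto
  also have "\<dots> = sqrt pi * (6 / \<mu>) ^ 3 * (M * \<rho>\<^sup>2)"
    unfolding \<rho>(2) by (simp add: power2_eq_square power3_eq_cube ac_simps)
  finally have Lp: "L * L2_norm (lebesgue_on T) p \<le> (C - 1) * (?E + L * ?N)" using CM by linarith
  have "L2_norm (lebesgue_on T) (\<lambda>x. f x - s x) = L2_norm (lebesgue_on T) (\<lambda>x. (f x - fbar x) + p x)"
  proof (rule L2_norm_cong_AE[OF L2_space_diff[OF fT] L2_space_add[OF ffb pL2(1)]])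
    show "AE x in lebesgue_on T. f x - s x = f x - fbar x + p x"
      using kT AE_space by eventually_elim (simp add: pT)
  qed (use M0 \<mu> in auto)
  also have "\<dots> \<le> ?N + L2_norm (lebesgue_on T) p"
    by (rule L2_norm_triangle[OF ffb pL2(1)]) (use M0 \<mu> in auto)
  finally have "L * L2_norm (lebesgue_on T) (\<lambda>x. f x - s x) \<le> L * ?N + L * L2_norm (lebesgue_on T) p"
    using L by (simp add: distrib_left[symmetric])
  also have "\<dots> \<le> (?E + L * ?N) + (C - 1) * (?E + L * ?N)" using Lp E by simp
  also have "\<dots> = C * (?E + L * ?N)" by (simp add: algebra_simps)
  finally show "diameter T * L2_norm (lebesgue_on T) (\<lambda>x. f x - s x) \<le> C * (?E + diameter T * ?N)"
    by (simp add: L_def)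
  have "has_weak_gradient A s (\<lambda>_. q)"
    by (rule has_weak_gradient_affine[OF bounded_subset[OF bT AT(1)] Tm(2)]) (use sA AT in auto)
  then have "H1_seminorm A s = L2_norm (lebesgue_on A) (\<lambda>x. q)" by (rule H1_seminorm_eq[OF AT(2)])
  also have "\<dots> \<le> L2_norm (lebesgue_on T) (\<lambda>x. q)"
    by (rule L2_norm_subset[OF continuous_imp_L2_space[OF continuous_on_const Tm(1) bT] Tm(2) Tm(1) AT(1)])
  also have "\<dots> \<le> norm q * sqrt (measure lebesgue T)"
    by (rule bounded_imp_L2_space(2)[OF lT]) auto
  also have "\<dots> \<le> norm q * (sqrt pi * L)" by (rule mult_left_mono[OF sqT]) simp
  finally have "L\<^sup>2 * H1_seminorm A s \<le> L\<^sup>2 * (norm q * (sqrt pi * L))" by (rule mult_left_mono) simp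
  also have "\<dots> = sqrt pi * (6 / \<mu>) ^ 3 * ((norm q * \<rho>) * \<rho>\<^sup>2)"
    unfolding \<rho>(2) by (simp add: power2_eq_square power3_eq_cube ac_simps)
  also have "\<dots> \<le> sqrt pi * (6 / \<mu>) ^ 3 * (M * \<rho>\<^sup>2)"
    using \<mu> by (intro mult_left_mono mult_right_mono) (auto simp: M_def)
  also have "\<dots> \<le> C * (?E + L * ?N)" using CM E N by (simp add: algebra_simps)
  finally show "(diameter T)\<^sup>2 * H1_seminorm (interior T) s \<le> C * (?E + diameter T * ?N)"
    by (simp add: L_def A_def)
qed

text \<open>
  Across the common side of two triangles the gradient of \<open>w\<close> jumps by \<open>J\<close> times the normal, so testing
  with a bump centred at the midpoint of the side leaves \<open>J\<close> times the integral of the normal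
  derivative of the bump over one of the triangles.  That derivative has one sign there, and on a
  disc of comparable size it is of the order of the inverse radius.
\<close>

lemma edge_estimate:
  assumes \<omega>: "interior (P \<union> Q) \<subseteq> \<Omega>" and \<mu>: "0 < \<mu>" "\<mu> \<le> 1"
    and P: "P = convex hull {a, b, c}" "thick \<mu> a b c" and Q: "Q = convex hull {a, b, d}" "thick \<mu> a b d"
    and PQ: "P \<inter> Q = closed_segment a b"
    and wP: "P1_on P w" "P1_on P s" "P0_on P fbar" and wQ: "P1_on Q w" "P1_on Q s" "P0_on Q fbar"
  defines "C \<equiv> sqrt pi * (6 / \<mu>) ^ 3 * (5 * sqrt pi / (exp (-2) * pi / 4096)) + 1"
  defines "J \<equiv> normal_jump P Q (\<lambda>_. P1_gradient P w) (\<lambda>_. P1_gradient Q w) a"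
  shows "norm (b - a) * \<bar>J\<bar> \<le> 4 / \<mu> * (2 * sqrt pi * C + 4 * sqrt pi) / (exp (-2) * pi / 256) *
    (err (interior (P \<union> Q)) + norm (b - a) * L2_norm (lebesgue_on (P \<union> Q)) (\<lambda>x. f x - fbar x))"
proof -
  define h where "h = norm (b - a)"
  \<comment> \<open>Half the radius that the midpoint of the edge admits, so that the closed disc lies in the interior.\<close>
  define \<rho> where "\<rho> = \<mu> * h / 4"
  define m where "m = midpoint a b"
  define U where "U = interior (P \<union> Q)"
  let ?M = "lebesgue_on U"
  have conv: "convex P" "compact P" "convex Q" "compact Q"
    by (auto simp: P(1) Q(1) finite_imp_compact_convex_hull)
  have Pm: "P \<in> sets lebesgue" "Q \<in> sets lebesgue" using conv by (auto dest: compact_imp_closed)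
  have \<omega>o: "open U" and \<omega>m: "U \<in> sets lebesgue" and \<Omega>m: "\<Omega> \<in> sets lebesgue"
    using \<Omega> by (auto simp: U_def)
  have \<omega>\<Omega>: "U \<subseteq> \<Omega>" using \<omega> by (simp add: U_def)
  have \<omega>PQ: "U \<subseteq> P \<union> Q" by (simp add: U_def interior_subset)
  have sub: "interior P \<subseteq> U" "interior Q \<subseteq> U" unfolding U_def by (auto intro: interior_mono[THEN subsetD])
  have DP: "cross2 (b - a) (c - a) \<noteq> 0" and DQ: "cross2 (b - a) (d - a) \<noteq> 0"
    using P(2) Q(2) by (auto simp: thick_def)
  have ab: "a \<noteq> b" using DP by (auto simp: cross2_def)
  have h: "0 < h" using ab by (simp add: h_def)
  have hL: "h \<le> diameter P" "h \<le> diameter Q"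
    using triangle_diameter(1)[of b a c] triangle_diameter(1)[of b a d] by (simp_all add: h_def P(1) Q(1))
  have \<rho>: "0 < \<rho>" "\<rho> \<le> h" using h \<mu> by (auto simp: \<rho>_def)
  have opp: "sgn (cross2 (b - a) (d - a)) = - sgn (cross2 (b - a) (c - a))"
    by (rule adjacent_triangles_opposite[OF P(2) Q(2) \<mu>(1)]) (use PQ P(1) Q(1) in simp)
  have near: "x \<in> P \<union> Q" if x: "dist m x \<le> \<mu> * h / 2" for x
  proof -
    let ?X = "cross2 (b - a) (x - a)"
    have "\<mu> * h \<le> \<mu> * diameter P" "\<mu> * h \<le> \<mu> * diameter Q" using hL \<mu> by simp_all
    then have dd: "dist (midpoint a b) x \<le> \<mu> * diameter P / 2" "dist (midpoint a b) x \<le> \<mu> * diameter Q / 2"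
      using x unfolding m_def by linarith+
    have "0 \<le> ?X / cross2 (b - a) (c - a) \<or> 0 \<le> ?X / cross2 (b - a) (d - a)"
      using opp DP DQ by (auto simp: sgn_if zero_le_divide_iff split: if_splits)
    then show ?thesis
      using half_ball_midpoint_subset[OF P(2) \<mu>(1), of x] half_ball_midpoint_subset[OF Q(2) \<mu>(1), of x] dd
      unfolding P(1) Q(1) by blast
  qed
  have disc: "cball m \<rho> \<subseteq> U"
  proof -
    have "\<rho> < \<mu> * h / 2" using \<rho>(1) by (simp add: \<rho>_def)
    then have "cball m \<rho> \<subseteq> ball m (\<mu> * h / 2)" by auto
    also have "\<dots> \<subseteq> U" unfolding U_def by (rule interior_maximal) (rule subsetI, rule near, simp, simp)
    finally show ?thesis .
  qed
  have mP: "m \<in> closed_segment a b" by (simp add: m_def)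
  define n where "n = (- sgn (cross2 (b - a) (c - a)) / norm (b - a)) *\<^sub>R rot (b - a)"
  have n': "(- sgn (cross2 (b - a) (d - a)) / norm (b - a)) *\<^sub>R rot (b - a) = - n"
    by (simp add: n_def opp)
  have nP: "outer_normal P (closed_segment a b) = n"
    unfolding P(1) n_def by (rule outer_normal_triangle(1)[OF DP])
  have nQ: "outer_normal Q (closed_segment a b) = - n"
    unfolding Q(1) n'[symmetric] by (rule outer_normal_triangle(1)[OF DQ])
  have n1: "norm n = 1" unfolding n_def by (rule outer_normal_triangle(2)[OF DP])
  have nle: "n \<bullet> (y - x) \<le> 0" if "x \<in> closed_segment a b" "y \<in> P" for x y
    unfolding n_def by (rule outer_normal_triangle(3)[OF DP that(1) that(2)[unfolded P(1)]])
  have nge: "- n \<bullet> (y - x) \<le> 0" if "x \<in> closed_segment a b" "y \<in> Q" for x y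
    unfolding n'[symmetric] by (rule outer_normal_triangle(3)[OF DQ that(1) that(2)[unfolded Q(1)]])
  obtain \<alpha>1 b1 where w1: "\<And>x. x \<in> P \<Longrightarrow> w x = \<alpha>1 + b1 \<bullet> x" using wP(1) by (auto simp: P1_on_def)
  obtain \<alpha>2 b2 where w2: "\<And>x. x \<in> Q \<Longrightarrow> w x = \<alpha>2 + b2 \<bullet> x" using wQ(1) by (auto simp: P1_on_def)
  have intne: "interior (convex hull {a, b, x}) \<noteq> {}" if "thick \<mu> a b x" for x
  proof -
    let ?r = "\<mu> * diameter (convex hull {a, b, x}) / 3" and ?g = "(1 / 3) *\<^sub>R (a + b + x)"
    have "0 < ?r" using thick_diameter(1)[OF that] \<mu> by simp
    moreover have "cball ?g ?r \<subseteq> convex hull {a, b, x}" by (rule cball_centroid_subset[OF that \<mu>(1)])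
    ultimately show ?thesis using mem_interior_cball[of ?g "convex hull {a, b, x}"] by blast
  qed
  have g1: "P1_gradient P w = b1" by (rule P1_gradient_eq[OF w1]) (use intne[OF P(2)] P(1) in auto)
  have g2: "P1_gradient Q w = b2" by (rule P1_gradient_eq[OF w2]) (use intne[OF Q(2)] Q(1) in auto)
  have Jn: "J = (b1 - b2) \<bullet> n"
    unfolding J_def normal_jump_def g1 g2 PQ nP nQ by (simp add: inner_diff_left)
  have jump: "b1 - b2 = J *\<^sub>R n"
  proof -
    \<comment> \<open>The two affine pieces agree at both end points, so the tangential part of the jump vanishes.\<close>
    have "a \<in> P \<inter> Q" "b \<in> P \<inter> Q" unfolding PQ by auto
    then have "\<alpha>1 + b1 \<bullet> a = \<alpha>2 + b2 \<bullet> a" "\<alpha>1 + b1 \<bullet> b = \<alpha>2 + b2 \<bullet> b" using w1 w2 by force+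
    then have "(b1 - b2) \<bullet> (b - a) = 0" by (simp add: inner_diff_left inner_diff_right)
    from orthogonal_multiple_of_rot[OF this] ab
    have "b1 - b2 = (((b1 - b2) \<bullet> rot (b - a)) / h\<^sup>2) *\<^sub>R rot (b - a)" by (simp add: h_def)
    moreover have "J *\<^sub>R n = (((b1 - b2) \<bullet> rot (b - a)) / h\<^sup>2) *\<^sub>R rot (b - a)"
      unfolding Jn n_def h_def[symmetric] using DP by (simp add: power2_eq_square sgn_if)
    ultimately show ?thesis by simp
  qed
  define v where "v = bump m \<rho>"
  have v: "v \<in> test_functions U"
    using bump_times_in_test_functions[OF \<rho>(1) disc, of "\<lambda>_. 1"] by (simp add: v_def)
  note vc = C_1_D(2,3)[OF test_functionsD(1)[OF v]]
  have v0: "v x = 0" if "x \<notin> cball m \<rho>" for x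
    using that bump_eq_0_iff[OF \<rho>(1), of m x] by (auto simp: v_def)
  have vg0: "gradient v x = 0" if "x \<notin> cball m \<rho>" for x
    by (rule gradient_eq_0_off_closed[of "cball m \<rho>"]) (use v0 that in auto)
  have "L2_norm ?M (gradient v) \<le> 4 / \<rho> * (sqrt pi * \<rho>)"
    by (rule L2_norm_supported_le[OF vc(2) vg0 _ _ disc \<omega>m]) (use \<rho> norm_gradient_bump in \<open>auto simp: v_def\<close>)
  then have S: "L2_norm ?M (gradient v) \<le> 4 * sqrt pi" using \<rho> by simp
  have vN: "L2_norm ?M v \<le> 1 * (sqrt pi * \<rho>)"
    by (rule L2_norm_supported_le[OF vc(1) v0 _ _ disc \<omega>m]) (use \<rho> bump_bounds in \<open>auto simp: v_def abs_le_iff intro: order_trans[of _ 0]\<close>)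
  define G where "G = (\<lambda>x. if x \<in> P then b1 else b2)"
  have null: "negligible (P - interior P)" "negligible (Q - interior Q)"
    by (rule negligible_diff_interior[OF conv(1)], rule negligible_diff_interior[OF conv(3)])
  have PQn: "negligible (P \<inter> Q)"
    using negligible_diff_interior[OF convex_Int[OF conv(1,3)]] interior_closed_segment_ge2[of a b]
    unfolding PQ by simp
  have WG: "AE x in ?M. weak_gradient \<Omega> w x = G x"
  proof -
    have aff: "AE x in lebesgue. x \<in> A \<longrightarrow> weak_gradient \<Omega> w x = r"
      if "open A" "A \<subseteq> U" "\<And>x. x \<in> A \<Longrightarrow> w x = \<alpha> + r \<bullet> x" for A \<alpha> r
    proof -
      have "AE x in lebesgue_on A. weak_gradient \<Omega> w x = r"
        by (rule weak_gradient_affine[OF that(1) subset_trans[OF that(2) \<omega>\<Omega>] that(3)])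
      then show ?thesis using that(1) by (subst (asm) AE_restrict_space_iff) auto
    qed
    have 1: "AE x in lebesgue. x \<in> interior P \<longrightarrow> weak_gradient \<Omega> w x = b1"
      by (rule aff[OF open_interior sub(1) w1]) (rule subsetD[OF interior_subset])
    have 2: "AE x in lebesgue. x \<in> interior Q \<longrightarrow> weak_gradient \<Omega> w x = b2"
      by (rule aff[OF open_interior sub(2) w2]) (rule subsetD[OF interior_subset])
    have n0: "AE x in lebesgue. x \<notin> N" if "negligible N" for N :: "(real^2) set"
      using that by (auto simp: negligible_iff_null_sets intro: AE_not_in)
    have "AE x in lebesgue. x \<in> U \<longrightarrow> weak_gradient \<Omega> w x = G x"
      using 1 2 n0[OF null(1)] n0[OF null(2)] n0[OF PQn]
      by eventually_elim (use \<omega>PQ interior_subset[of P] interior_subset[of Q] in \<open>auto simp: G_def\<close>)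
    then show ?thesis using \<omega>m by (subst AE_restrict_space_iff) auto
  qed
  have wW: "weak_gradient \<Omega> w \<in> L2_space ?M"
    using has_weak_gradientD(2)[OF has_weak_gradient_weak_gradient[OF w]] by (rule L2_space_subset) (use \<omega>m \<Omega>m \<omega>\<Omega> in auto)
  have GL2: "G \<in> L2_space ?M" by (rule L2_space_cong_AE_lebesgue[OF wW \<omega>m WG])
  have b\<omega>: "bounded U" using \<omega>\<Omega> \<Omega> bounded_subset by blast
  have cL2: "(\<lambda>_. b2) \<in> L2_space ?M" by (rule continuous_imp_L2_space[OF continuous_on_const \<omega>m b\<omega>])
  note vL2 = test_function_L2[OF v \<omega>m]
  define I where "I = (\<integral>x. (if x \<in> P then n \<bullet> gradient v x else 0) \<partial>?M)"
  have eq: "L2_inner ?M (weak_gradient \<Omega> w) (gradient v) = J * I"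
  proof -
    have "L2_inner ?M (weak_gradient \<Omega> w) (gradient v) = L2_inner ?M G (gradient v)"
      by (rule L2_inner_cong_AE[OF wW vL2(2) GL2 vL2(2) WG]) simp
    also have "\<dots> = L2_inner ?M (\<lambda>x. G x - b2) (gradient v) + L2_inner ?M (\<lambda>_. b2) (gradient v)"
      using integrable_L2_inner[OF GL2 vL2(2)] integrable_L2_inner[OF cL2 vL2(2)]
      by (simp add: L2_inner_def inner_diff_left)
    also have "L2_inner ?M (\<lambda>_. b2) (gradient v) = 0" by (rule L2_inner_const_gradient[OF v \<omega>m])
    also have "L2_inner ?M (\<lambda>x. G x - b2) (gradient v) = (\<integral>x. J * (if x \<in> P then n \<bullet> gradient v x else 0) \<partial>?M)"
      unfolding L2_inner_def by (rule Bochner_Integration.integral_cong) (auto simp: G_def jump)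
    finally show ?thesis by (simp add: I_def)
  qed
  have In: "n \<bullet> gradient v x = 2 * bump_slope m \<rho> x / \<rho>\<^sup>2 * (- (n \<bullet> (x - m)))" for x
    unfolding v_def gradient_bump by simp
  have low: "exp (-2) / (4 * \<rho>) * (pi * (\<rho> / 8)\<^sup>2) \<le> I"
    unfolding I_def
  proof (rule integral_ge_on_cball)
    have nL2: "(\<lambda>_. n) \<in> L2_space ?M" by (rule continuous_imp_L2_space[OF continuous_on_const \<omega>m b\<omega>])
    have "integrable lebesgue (\<lambda>x. indicator P x *\<^sub>R (indicator U x *\<^sub>R (n \<bullet> gradient v x)))"
      using integrable_L2_inner[OF nL2 vL2(2)] \<omega>m
      by (intro integrable_mult_indicator[OF Pm(1)]) (simp add: integrable_restrict_space)
    also have "(\<lambda>x. indicator P x *\<^sub>R (indicator U x *\<^sub>R (n \<bullet> gradient v x)))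
        = (\<lambda>x. indicator U x *\<^sub>R (if x \<in> P then n \<bullet> gradient v x else 0))"
      by (auto simp: indicator_def)
    finally show "integrable ?M (\<lambda>x. if x \<in> P then n \<bullet> gradient v x else 0)"
      using \<omega>m by (simp add: integrable_restrict_space)
    show "0 \<le> (if x \<in> P then n \<bullet> gradient v x else 0)" for x
    proof -
      have "0 \<le> 2 * bump_slope m \<rho> x / \<rho>\<^sup>2 * (- (n \<bullet> (x - m)))" if "x \<in> P"
        by (rule mult_nonneg_nonneg) (use nle[OF mP that] bump_slope_bounds(1)[of m \<rho> x] in simp_all)
      then show ?thesis using In[of x] by auto
    qed
    \<comment> \<open>The disc is shifted into \<open>P\<close> against the outer normal.\<close>
    let ?z = "m - (\<rho> / 4) *\<^sub>R n"
    have close: "norm (x - m) \<le> 3 * \<rho> / 8" and side: "\<rho> / 8 \<le> - (n \<bullet> (x - m))"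
      if x: "x \<in> cball ?z (\<rho> / 8)" for x
    proof -
      have xz: "norm (x - ?z) \<le> \<rho> / 8" using x by (simp add: dist_norm norm_minus_commute)
      have xm: "x - m = (x - ?z) - (\<rho> / 4) *\<^sub>R n" by simp
      show "norm (x - m) \<le> 3 * \<rho> / 8"
        unfolding xm using norm_triangle_ineq4[of "x - ?z" "(\<rho> / 4) *\<^sub>R n"] xz n1 \<rho> by simp
      have "\<bar>n \<bullet> (x - ?z)\<bar> \<le> \<rho> / 8"
        using Cauchy_Schwarz_ineq2[of n "x - ?z"] xz n1 by simp
      moreover have "n \<bullet> (x - m) = n \<bullet> (x - ?z) - \<rho> / 4"
        unfolding xm inner_diff_right using n1 by (simp add: power2_norm_eq_inner[symmetric])
      ultimately show "\<rho> / 8 \<le> - (n \<bullet> (x - m))" by linarith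
    qed
    show "exp (-2) / (4 * \<rho>) \<le> (if x \<in> P then n \<bullet> gradient v x else 0)" if x: "x \<in> cball ?z (\<rho> / 8)" for x
    proof -
      have "dist m x \<le> \<mu> * h / 2"
        using close[OF x] \<rho> by (simp add: dist_norm norm_minus_commute \<rho>_def)
      then have "x \<in> P \<union> Q" by (rule near)
      moreover have "x \<notin> Q" using nge[OF mP, of x] side[OF x] \<rho> by auto
      ultimately have xP: "x \<in> P" by simp
      have sl: "exp (-2) \<le> bump_slope m \<rho> x" by (rule bump_slope_ge[OF \<rho>(1)]) (use close[OF x] \<rho> in simp)
      have "exp (-2) / (4 * \<rho>) = 2 * exp (-2) / \<rho>\<^sup>2 * (\<rho> / 8)"
        using \<rho> by (simp add: power2_eq_square)
      also have "\<dots> \<le> 2 * bump_slope m \<rho> x / \<rho>\<^sup>2 * (- (n \<bullet> (x - m)))"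
        using sl side[OF x] \<rho> bump_slope_bounds(1)[of m \<rho> x]
        by (intro mult_mono divide_right_mono mult_left_mono) auto
      finally show ?thesis using xP In[of x] by simp
    qed
    show "cball ?z (\<rho> / 8) \<subseteq> U"
    proof
      fix x assume "x \<in> cball ?z (\<rho> / 8)"
      then have "x \<in> cball m \<rho>" using close[of x] \<rho> by (simp add: dist_norm norm_minus_commute)
      then show "x \<in> U" using disc by blast
    qed
  qed (use \<rho> \<omega>m in auto)
  let ?E = "err U" and ?N = "L2_norm (lebesgue_on (P \<union> Q)) (\<lambda>x. f x - fbar x)"
  let ?R = "\<lambda>A. L2_norm (lebesgue_on A) (\<lambda>x. f x - s x)"
  note tP = triangle_estimate[OF \<omega>o \<omega>\<Omega> sub(1) \<mu>(1) P wP, folded C_def]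
  note tQ = triangle_estimate[OF \<omega>o \<omega>\<Omega> sub(2) \<mu>(1) Q wQ, folded C_def]
  have PQm: "P \<union> Q \<in> sets lebesgue" using Pm by auto
  have E: "0 \<le> ?E" by (rule err_nonneg[OF \<omega>o \<omega>\<Omega>])
  have C0: "0 \<le> C" using \<mu> by (simp add: C_def)
  have ffb: "(\<lambda>x. f x - fbar x) \<in> L2_space (lebesgue_on (P \<union> Q))" by (rule L2_space_Un[OF tP(3) tQ(3) Pm])
  have NP: "L2_norm (lebesgue_on P) (\<lambda>x. f x - fbar x) \<le> ?N" "L2_norm (lebesgue_on Q) (\<lambda>x. f x - fbar x) \<le> ?N"
    by (rule L2_norm_subset[OF ffb _ PQm]; use Pm in auto)+
  \<comment> \<open>The element estimates are scaled by the diameters of the triangles, which are at least \<open>h \<ge> \<rho>\<close>.\<close>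
  have scale: "\<rho> * r \<le> C * (?E + h * ?N)"
    if "L * r \<le> C * (?E + L * y)" "h \<le> L" "0 \<le> y" "y \<le> ?N" for r L y
  proof -
    have L: "0 < L" using that h by simp
    have "\<rho> * r = \<rho> / L * (L * r)" using L by simp
    also have "\<dots> \<le> \<rho> / L * (C * (?E + L * y))" using \<rho> L that by (intro mult_left_mono) auto
    also have "\<dots> = C * (\<rho> / L * ?E + \<rho> * y)" using L by (simp add: field_simps)
    also have "\<dots> \<le> C * (1 * ?E + h * ?N)"
      using \<rho> L that E C0 by (intro mult_left_mono add_mono mult_mono) auto
    finally show ?thesis by simp
  qed
  have rP: "\<rho> * ?R P \<le> C * (?E + h * ?N)" by (rule scale[OF tP(1) hL(1) _ NP(1)]) simp
  have rQ: "\<rho> * ?R Q \<le> C * (?E + h * ?N)" by (rule scale[OF tQ(1) hL(2) _ NP(2)]) simp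
  have fs: "(\<lambda>x. f x - s x) \<in> L2_space (lebesgue_on (P \<union> Q))" by (rule L2_space_Un[OF tP(4) tQ(4) Pm])
  have "?R U \<le> ?R (P \<union> Q)" by (rule L2_norm_subset[OF fs \<omega>m PQm \<omega>PQ])
  also have "\<dots> \<le> ?R P + ?R Q" by (rule L2_norm_Un_le[OF tP(4) tQ(4) Pm])
  finally have "\<rho> * ?R U \<le> \<rho> * (?R P + ?R Q)" using \<rho> by (intro mult_left_mono) auto
  then have "\<rho> * ?R U \<le> 2 * C * (?E + h * ?N)" using rP rQ by (simp add: distrib_left)
  then have "sqrt pi * (\<rho> * ?R U) \<le> sqrt pi * (2 * C * (?E + h * ?N))" by (intro mult_left_mono) auto
  moreover have "sqrt pi * (\<rho> * ?R U) = ?R U * (sqrt pi * \<rho>)"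
    "sqrt pi * (2 * C * (?E + h * ?N)) = 2 * sqrt pi * C * (?E + h * ?N)" by simp_all
  moreover have "\<bar>L2_inner ?M (\<lambda>x. f x - s x) v\<bar> \<le> ?R U * (sqrt pi * \<rho>)"
    using L2_inner_le[OF L2_space_subset[OF fs \<omega>m PQm \<omega>PQ] vL2(1)] mult_left_mono[OF vN, of "?R U"] by simp
  ultimately have t1: "\<bar>L2_inner ?M (\<lambda>x. f x - s x) v\<bar> \<le> 2 * sqrt pi * C * (?E + h * ?N)"
    by linarith
  have "\<bar>J * I\<bar> \<le> \<bar>L2_inner ?M (\<lambda>x. f x - s x) v\<bar> + 4 * sqrt pi * ?E"
    using residual_le[OF \<omega>o \<omega>\<Omega> v S] unfolding eq by simp
  also have "\<dots> \<le> 2 * sqrt pi * C * (?E + h * ?N) + 4 * sqrt pi * (?E + h * ?N)"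
    using t1 h by (intro add_mono mult_left_mono) auto
  also have "\<dots> = (2 * sqrt pi * C + 4 * sqrt pi) * (?E + h * ?N)" by (simp add: algebra_simps)
  finally have up: "\<bar>J * I\<bar> \<le> (2 * sqrt pi * C + 4 * sqrt pi) * (?E + h * ?N)" .
  define k0 :: real where "k0 = exp (-2) * pi / 256"
  have k0: "0 < k0" by (simp add: k0_def)
  have "exp (-2) / (4 * \<rho>) * (pi * (\<rho> / 8)\<^sup>2) = k0 * \<rho>"
    using \<rho> by (simp add: k0_def power2_eq_square)
  then have kI: "k0 * \<rho> \<le> I" using low by simp
  have "0 \<le> k0 * \<rho>" using k0 \<rho> by simp
  then have "k0 * \<rho> * \<bar>J\<bar> \<le> \<bar>J * I\<bar>" using mult_right_mono[OF kI, of "\<bar>J\<bar>"] kI by (simp add: abs_mult mult.commute)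
  then have "k0 * (\<mu> * h / 4) * \<bar>J\<bar> \<le> (2 * sqrt pi * C + 4 * sqrt pi) * (?E + h * ?N)"
    using up by (simp add: \<rho>_def)
  then have "h * \<bar>J\<bar> \<le> 4 / \<mu> * (2 * sqrt pi * C + 4 * sqrt pi) / k0 * (?E + h * ?N)"
    using k0 \<mu> by (simp add: field_simps)
  then show ?thesis by (simp add: h_def k0_def U_def)
qed

end

theorem theorem5p2:
  fixes \<theta> :: real
  assumes "\<theta> > 0"
  shows "\<exists>C>0. \<forall>\<Omega> \<T> f g \<psi> g\<^sub>h u \<sigma> u\<^sub>h \<sigma>\<^sub>h fbar.
    polygonal_domain \<Omega> \<and> conforming_mesh \<Omega> \<T> \<and> shape_regular \<theta> \<T> \<and>
    at_most_one_boundary_edge \<Omega> \<T> \<and> obstacle_data \<Omega> f g \<psi> \<and>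
    boundary_interpolant \<Omega> \<T> g g\<^sub>h \<and>
    obstacle_solution \<Omega> f g \<psi> u \<and> multiplier \<Omega> f u \<sigma> \<and>
    discrete_solution \<Omega> \<T> f g\<^sub>h \<psi> u\<^sub>h \<and> discrete_multiplier \<Omega> \<T> f u\<^sub>h \<sigma>\<^sub>h \<and>
    (\<forall>T\<in>\<T>. P0_on T fbar) \<longrightarrow>
    (\<forall>T\<in>\<T>.
       diameter T * L2_norm (lebesgue_on T) (\<lambda>x. f x - \<sigma>\<^sub>h x)
         \<le> C * (H1_seminorm (interior T) (\<lambda>x. u x - u\<^sub>h x)
                + Hm1_norm (interior T) (\<lambda>v. \<sigma> v - L2_inner (lebesgue_on \<Omega>) \<sigma>\<^sub>h v)
                + diameter T * L2_norm (lebesgue_on T) (\<lambda>x. f x - fbar x)) \<and>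
       (diameter T)\<^sup>2 * H1_seminorm (interior T) \<sigma>\<^sub>h
         \<le> C * (H1_seminorm (interior T) (\<lambda>x. u x - u\<^sub>h x)
                + Hm1_norm (interior T) (\<lambda>v. \<sigma> v - L2_inner (lebesgue_on \<Omega>) \<sigma>\<^sub>h v)
                + diameter T * L2_norm (lebesgue_on T) (\<lambda>x. f x - fbar x))) \<and>
    (\<forall>e\<in>interior_edges \<Omega> \<T>. \<forall>Tp\<in>\<T>. \<forall>Tm\<in>\<T>. Tp \<noteq> Tm \<and> e = Tp \<inter> Tm \<longrightarrow>
       sqrt (diameter e) * L2_norm (restrict_space arc_length e)
           (normal_jump Tp Tm (\<lambda>_. P1_gradient Tp u\<^sub>h) (\<lambda>_. P1_gradient Tm u\<^sub>h))
         \<le> C * (H1_seminorm (interior (Tp \<union> Tm)) (\<lambda>x. u x - u\<^sub>h x)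
                + Hm1_norm (interior (Tp \<union> Tm)) (\<lambda>v. \<sigma> v - L2_inner (lebesgue_on \<Omega>) \<sigma>\<^sub>h v)
                + diameter e * L2_norm (lebesgue_on (Tp \<union> Tm)) (\<lambda>x. f x - fbar x)))"
proof -
  define \<mu> where "\<mu> = thickness \<theta>"
  have \<mu>: "0 < \<mu>" "\<mu> \<le> 1" using thickness_bounds[OF assms] by (auto simp: \<mu>_def)
  define C1 where "C1 = sqrt pi * (6 / \<mu>) ^ 3 * (5 * sqrt pi / (exp (-2) * pi / 4096)) + 1"
  define C2 where "C2 = 4 / \<mu> * (2 * sqrt pi * C1 + 4 * sqrt pi) / (exp (-2) * pi / 256)"
  have C1: "0 < C1" using \<mu> by (simp add: C1_def add_nonneg_pos)
  then have C: "0 < max C1 C2" by simp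
  show ?thesis
  proof (intro exI[of _ "max C1 C2"] conjI[OF C] allI impI, goal_cases)
    case A: (1 \<Omega> \<T> f g \<psi> g\<^sub>h u \<sigma> u\<^sub>h \<sigma>\<^sub>h fbar)
    then have dom: "polygonal_domain \<Omega>" and mesh: "conforming_mesh \<Omega> \<T>" and reg: "shape_regular \<theta> \<T>"
      by auto
    have P: "P1_on T u\<^sub>h" "P1_on T \<sigma>\<^sub>h" "P0_on T fbar" if "T \<in> \<T>" for T
      using A that by (auto simp: discrete_solution_def K_h_def discrete_multiplier_def V_h0_def V_h_def)
    have "\<sigma>\<^sub>h \<in> H1 \<Omega>" using A by (auto simp: discrete_multiplier_def V_h0_def V_h_def)
    then have "\<sigma>\<^sub>h \<in> L2_space (lebesgue_on \<Omega>)" by (auto simp: H1_def dest: has_weak_gradientD(1))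
    then interpret obstacle_residual \<Omega> f \<sigma>\<^sub>h u u\<^sub>h \<sigma>
      using A
      by unfold_locales
         (auto simp: polygonal_domain_def obstacle_data_def obstacle_solution_def K_set_def
            discrete_solution_def K_h_def V_h_def)
    have inner: "interior X \<subseteq> \<Omega>" if "X \<subseteq> \<Union>\<T>" for X
      by (rule mesh_interior_subset[OF dom mesh that])
    have weaken: "x \<le> max C1 C2 * y" if "x \<le> C * y" "C = C1 \<or> C = C2" "0 \<le> y" for x y C
      using that mult_right_mono[of C "max C1 C2" y] by auto
    have nonneg: "0 \<le> err (interior X) + d * L2_norm M v" if "X \<subseteq> \<Union>\<T>" "0 \<le> d"
      for X d and M :: "(real^2) measure" and v :: "real^2 \<Rightarrow> real"
      using err_nonneg[OF open_interior inner[OF that(1)]] that(2) by simp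
    show ?case
      unfolding err_def[symmetric]
    proof (rule conjI; intro ballI impI)
      fix T assume T: "T \<in> \<T>"
      obtain a b c where abc: "T = convex hull {a, b, c}" "thick \<mu> a b c"
        using mesh_triangle_thick[OF assms mesh reg T] unfolding \<mu>_def .
      have TU: "T \<subseteq> \<Union>\<T>" using T by blast
      have "0 \<le> diameter T" using thick_diameter(1)[OF abc(2)] abc(1) by simp
      note y = nonneg[OF TU this]
      note t = triangle_estimate[OF open_interior inner[OF TU] subset_refl \<mu>(1) abc P[OF T], folded C1_def]
      show "diameter T * L2_norm (lebesgue_on T) (\<lambda>x. f x - \<sigma>\<^sub>h x)
          \<le> max C1 C2 * (err (interior T) + diameter T * L2_norm (lebesgue_on T) (\<lambda>x. f x - fbar x)) \<and>
        (diameter T)\<^sup>2 * H1_seminorm (interior T) \<sigma>\<^sub>h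
          \<le> max C1 C2 * (err (interior T) + diameter T * L2_norm (lebesgue_on T) (\<lambda>x. f x - fbar x))"
        using weaken[OF t(1) _ y] weaken[OF t(2) _ y] by simp
    next
      fix e Tp Tm
      assume e: "e \<in> interior_edges \<Omega> \<T>" and T: "Tp \<in> \<T>" "Tm \<in> \<T>" and "Tp \<noteq> Tm \<and> e = Tp \<inter> Tm"
      then have eq: "e = Tp \<inter> Tm" by blast
      obtain a b c d where abc: "Tp = convex hull {a, b, c}" "Tm = convex hull {a, b, d}" "e = closed_segment a b"
        "thick \<mu> a b c" "thick \<mu> a b d"
        using mesh_interior_edge[OF assms mesh reg T e eq] unfolding \<mu>_def .
      have TU: "Tp \<union> Tm \<subseteq> \<Union>\<T>" using T by blast
      let ?j = "normal_jump Tp Tm (\<lambda>_. P1_gradient Tp u\<^sub>h) (\<lambda>_. P1_gradient Tm u\<^sub>h)"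
      have j: "?j = (\<lambda>_. ?j a)" by (simp add: normal_jump_def fun_eq_iff)
      have h: "diameter e = norm (b - a)"
        using triangle_diameter(1,4)[where a = a and b = b and c = b] unfolding abc(3) segment_convex_hull
        by (auto simp: insert_absorb2)
      have "a \<noteq> b" using abc(4) by (auto simp: thick_def cross2_def)
      then have "L2_norm (restrict_space arc_length e) ?j \<le> \<bar>?j a\<bar> * sqrt (norm (b - a))"
        unfolding abc(3) by (subst j) (rule L2_norm_const_segment_le)
      then have "sqrt (diameter e) * L2_norm (restrict_space arc_length e) ?j
          \<le> sqrt (norm (b - a)) * (\<bar>?j a\<bar> * sqrt (norm (b - a)))"
        unfolding h by (rule mult_left_mono) simp
      also have "\<dots> = norm (b - a) * \<bar>?j a\<bar>" by simp
      also have "\<dots> \<le> C2 * (err (interior (Tp \<union> Tm)) + diameter e * L2_norm (lebesgue_on (Tp \<union> Tm)) (\<lambda>x. f x - fbar x))"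
        unfolding h C2_def C1_def
        by (rule edge_estimate[OF inner[OF TU] \<mu> abc(1,4,2,5) _ P[OF T(1)] P[OF T(2)]]) (use eq abc(3) in simp)
      finally show "sqrt (diameter e) * L2_norm (restrict_space arc_length e) ?j
          \<le> max C1 C2 * (err (interior (Tp \<union> Tm)) + diameter e * L2_norm (lebesgue_on (Tp \<union> Tm)) (\<lambda>x. f x - fbar x))"
        by (rule weaken[OF _ _ nonneg[OF TU]]) (simp_all add: h)
    qed
  qed
qed

end
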